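(* Let $m,n\in\mathbb{N}$, $S=\{1,\ldots,m\}$, $T=\{1,\ldots,n\}$, $S'\subseteq S$, $T'\subseteq T$. Let $\lambda_1,\ldots,\lambda_m\in\mathbb{C}^*$ be pairwise distinct and let $\mu_1,\ldots,\mu_n\in\mathbb{C}^*$ be pairwise distinct. Let $\alpha_i,\beta_i\in\mathbb{C}$ ($i\in S$) be such that $\beta_i\ne0$ for $i\in S'$, and $\alpha_i\neq0$, $\beta_i=0$ for $i\in S\setminus S'$; let $c_j,d_j\in\mathbb{C}$ ($j\in T$) be such that $d_j\neq0$ for $j\in T'$, and $c_j\neq0$, $d_j=0$ for $j\in T\setminus T'$. Let $M_1$ and $M_2$ be modules satisfying condition $(\ast)$ (defined in the context). Then $$\Big(\bigotimes_{i=1}^m\Omega(\lambda_i,\alpha_i,\beta_i)\Big)\otimes\mathrm{Ind}(M_1)\quad\text{and}\quad\Big(\bigotimes_{j=1}^n\Omega(\mu_j,c_j,d_j)\Big)\otimes\mathrm{Ind}(M_2)$$ are isomorphic as $\mathcal{H}$-modules if and only if $m=n$, $\mathrm{card}(S')=\mathrm{card}(T')$, $\mathrm{Ind}(M_1)\cong\mathrm{Ind}(M_2)$ as $\mathcal{H}$-modules, and there exist bijections $\varphi_1:S'\to T'$ and $\varphi_2:S\setminus S'\to T\setminus T'$ such that $(\lambda_i,\alpha_i,\beta_i)=(\mu_{\varphi_1(i)},c_{\varphi_1(i)},d_{\varphi_1(i)})$ for all $i\in S'$, and $(\lambda_j,\alpha_j)=(\mu_{\varphi_2(j)},c_{\varphi_2(j)})$,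 $\beta_j=d_{\varphi_2(j)}=0$ for all $j\in S\setminus S'$.
   Context: $\mathbb{C}^*$, $\mathbb{Z}_+$, $\mathbb{N}$ denote the nonzero complex numbers, nonnegative integers and positive integers; $\mathrm{card}(A)$ is the number of elements of a set $A$. All vector spaces are over $\mathbb{C}$. The twisted Heisenberg-Virasoro algebra $\mathcal{H}$ is the complex Lie algebra with basis $\{L_m,I_m,C_1,C_2,C_3\mid m\in\mathbb{Z}\}$ and brackets $$[L_m,L_n]=(n-m)L_{m+n}+\delta_{m+n,0}\tfrac{m^3-m}{12}C_1,\quad [L_m,I_n]=nI_{m+n}+\delta_{m+n,0}(m^2+m)C_2,\quad [I_m,I_n]=n\delta_{m+n,0}C_3,$$ with $C_1,C_2,C_3$ central. For $\lambda\in\mathbb{C}^*$, $\alpha,\beta\in\mathbb{C}$, $\Omega(\lambda,\alpha,\beta)$ is the $\mathcal{H}$-module with underlying space the polynomial algebra $\mathbb{C}[\partial]$ and action $L_k\partial^n=\lambda^k(\partial+k\alpha)(\partial-k)^n$, $I_k\partial^n=\lambda^k\beta(\partial-k)^n$, $C_j\partial^n=0$ for $k\in\mathbb{Z}$, $n\in\mathbb{Z}_+$, $j=1,2,3$. For $e\in\mathbb{Z}_+$, $\mathcal{H}_e$ is the subalgebra $\sum_{m\in\mathbb{Z}_+}(\mathbb{C}L_m\oplus\mathbb{C}I_{m-e})\oplus\mathbb{C}C_1\oplus\mathbb{C}C_2\oplus\mathbb{C}C_3$ of $\mathcal{H}$. For an $\mathcal{H}_e$-module $M$, $\mathrm{Ind}(M)=\mathcal{U}(\mathcal{H})\otimes_{\mathcal{U}(\mathcal{H}_e)}M$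 is the induced $\mathcal{H}$-module. Tensor products of $\mathcal{H}$-modules are over $\mathbb{C}$ with the usual Lie algebra action. Condition $(\ast)$ on $M$: for some $e\in\mathbb{Z}_+$, $M$ is a simple $\mathcal{H}_e$-module on which $I_0,C_1,C_2,C_3$ act as scalars $\kappa_0,\kappa_1,\kappa_2,\kappa_3$ respectively, with $\kappa_3=0$, and there exists $k\in\mathbb{Z}_+$ such that (a) if $k\neq0$, the action of $I_k$ on $M$ is injective; if $k=0$, $\kappa_0+(n-1)\kappa_2\neq0$ for all $n\in\mathbb{Z}\setminus\{0\}$; (b) $I_nM=L_{n'}M=0$ for all $n>k$ and $n'>k+e$. *)

theory Defs
  imports
    "HOL-Algebra.Algebraic_Closure_Type"
    "HOL-Library.Poly_Mapping"
    "HOL-Library.FuncSet"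
    Complex_Main
begin

section \<open>Complex vector spaces, Lie algebras and their modules\<close>

text \<open>
  Complex vector spaces are carrier-based modules over the field of complex numbers. The record
  type of modules extends that of rings; for a plain vector space the fields \<open>mult\<close> and \<open>one\<close> play
  no role.
\<close>

abbreviation complex_ring :: "complex ring"
  where "complex_ring \<equiv> ring_of_type_algebra"

record 'g lie_algebra = "(complex, 'g) module" +
  bracket :: "'g \<Rightarrow> 'g \<Rightarrow> 'g"

record ('g, 'v) lie_module = "(complex, 'v) module" +
  act :: "'g \<Rightarrow> 'v \<Rightarrow> 'v"

definition is_lie_module :: "'g lie_algebra \<Rightarrow> ('g, 'v) lie_module \<Rightarrow> bool"
  where "is_lie_module G M \<longleftrightarrow>
    Module.module complex_ring M \<and>
    (\<forall>x\<in>carrier G. \<forall>v\<in>carrier M. act M x v \<in> carrier M) \<and>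
    (\<forall>x\<in>carrier G. \<forall>v\<in>carrier M. \<forall>w\<in>carrier M.
      act M x (v \<oplus>\<^bsub>M\<^esub> w) = act M x v \<oplus>\<^bsub>M\<^esub> act M x w) \<and>
    (\<forall>x\<in>carrier G. \<forall>c. \<forall>v\<in>carrier M. act M x (c \<odot>\<^bsub>M\<^esub> v) = c \<odot>\<^bsub>M\<^esub> act M x v) \<and>
    (\<forall>x\<in>carrier G. \<forall>y\<in>carrier G. \<forall>v\<in>carrier M.
      act M (x \<oplus>\<^bsub>G\<^esub> y) v = act M x v \<oplus>\<^bsub>M\<^esub> act M y v) \<and>
    (\<forall>c. \<forall>x\<in>carrier G. \<forall>v\<in>carrier M. act M (c \<odot>\<^bsub>G\<^esub> x) v = c \<odot>\<^bsub>M\<^esub> act M x v) \<and>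
    (\<forall>x\<in>carrier G. \<forall>y\<in>carrier G. \<forall>v\<in>carrier M.
      act M (bracket G x y) v = act M x (act M y v) \<ominus>\<^bsub>M\<^esub> act M y (act M x v))"

definition simple_lie_module :: "'g lie_algebra \<Rightarrow> ('g, 'v) lie_module \<Rightarrow> bool"
  where "simple_lie_module G M \<longleftrightarrow>
    is_lie_module G M \<and> carrier M \<noteq> {\<zero>\<^bsub>M\<^esub>} \<and>
    (\<forall>W. submodule W complex_ring M \<and> (\<forall>x\<in>carrier G. \<forall>w\<in>W. act M x w \<in> W)
      \<longrightarrow> W = {\<zero>\<^bsub>M\<^esub>} \<or> W = carrier M)"

definition lie_module_isomorphic ::
    "'g lie_algebra \<Rightarrow> ('g, 'v) lie_module \<Rightarrow> ('g, 'w) lie_module \<Rightarrow> bool"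
  where "lie_module_isomorphic G V W \<longleftrightarrow>
    (\<exists>f. bij_betw f (carrier V) (carrier W) \<and>
      (\<forall>v\<in>carrier V. \<forall>v'\<in>carrier V. f (v \<oplus>\<^bsub>V\<^esub> v') = f v \<oplus>\<^bsub>W\<^esub> f v') \<and>
      (\<forall>c. \<forall>v\<in>carrier V. f (c \<odot>\<^bsub>V\<^esub> v) = c \<odot>\<^bsub>W\<^esub> f v) \<and>
      (\<forall>x\<in>carrier G. \<forall>v\<in>carrier V. f (act V x v) = act W x (f v)))"


section \<open>Spaces given by generators and relations\<close>

abbreviation basis :: "'x \<Rightarrow> 'x \<Rightarrow>\<^sub>0 complex"
  where "basis x \<equiv> Poly_Mapping.single x 1"

definition scale :: "complex \<Rightarrow> ('x \<Rightarrow>\<^sub>0 complex) \<Rightarrow> 'x \<Rightarrow>\<^sub>0 complex"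
  where "scale c p = Poly_Mapping.map ((*) c) p"

definition linear_extension ::
    "('x \<Rightarrow> 'y \<Rightarrow>\<^sub>0 complex) \<Rightarrow> ('x \<Rightarrow>\<^sub>0 complex) \<Rightarrow> 'y \<Rightarrow>\<^sub>0 complex"
  where "linear_extension F p =
    (\<Sum>x\<in>Poly_Mapping.keys p. scale (Poly_Mapping.lookup p x) (F x))"

definition free_space :: "'x set \<Rightarrow> (complex, 'x \<Rightarrow>\<^sub>0 complex) module"
  where "free_space B =
    \<lparr>carrier = {p. Poly_Mapping.keys p \<subseteq> B}, monoid.mult = undefined, monoid.one = undefined,
     ring.zero = 0, add = (+), module.smult = scale\<rparr>"

definition module_span :: "(complex, 'v) module \<Rightarrow> 'v set \<Rightarrow> 'v set"
  where "module_span V R = \<Inter>{W. submodule W complex_ring V \<and> R \<subseteq> W}"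

text \<open>
  The free vector space on \<open>B\<close> modulo the span of \<open>R\<close>, where an element \<open>g\<close> of the Lie algebra acts
  on the generators by \<open>F g\<close>. The action on cosets is the induced one provided that the linear
  extension of \<open>F g\<close> preserves the span of \<open>R\<close>.
\<close>

definition presented_module ::
    "'x set \<Rightarrow> ('x \<Rightarrow>\<^sub>0 complex) set \<Rightarrow> ('g \<Rightarrow> 'x \<Rightarrow> 'x \<Rightarrow>\<^sub>0 complex)
      \<Rightarrow> ('g, ('x \<Rightarrow>\<^sub>0 complex) set) lie_module"
  where "presented_module B R F =
    (let V = free_space B; N = module_span V R in
    \<lparr>carrier = a_rcosets\<^bsub>V\<^esub> N, monoid.mult = undefined, monoid.one = undefined,
     ring.zero = N, add = set_add V,
     module.smult = (\<lambda>c A. N <+>\<^bsub>V\<^esub> (scale c ` A)),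
     act = (\<lambda>g A. N <+>\<^bsub>V\<^esub> (linear_extension (F g) ` A))\<rparr>)"


section \<open>Tensor products\<close>

definition tensor_relations ::
    "(complex, 'v, 'm) module_scheme \<Rightarrow> (complex, 'w, 'n) module_scheme
      \<Rightarrow> ('v \<times> 'w \<Rightarrow>\<^sub>0 complex) set"
  where "tensor_relations V W =
    {basis (v \<oplus>\<^bsub>V\<^esub> v', w) - basis (v, w) - basis (v', w) | v v' w.
      v \<in> carrier V \<and> v' \<in> carrier V \<and> w \<in> carrier W} \<union>
    {basis (v, w \<oplus>\<^bsub>W\<^esub> w') - basis (v, w) - basis (v, w') | v w w'.
      v \<in> carrier V \<and> w \<in> carrier W \<and> w' \<in> carrier W} \<union>
    {basis (c \<odot>\<^bsub>V\<^esub> v, w) - scale c (basis (v, w)) | c v w.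
      v \<in> carrier V \<and> w \<in> carrier W} \<union>
    {basis (v, c \<odot>\<^bsub>W\<^esub> w) - scale c (basis (v, w)) | c v w.
      v \<in> carrier V \<and> w \<in> carrier W}"

definition tensor_module ::
    "('g, 'v) lie_module \<Rightarrow> ('g, 'w) lie_module \<Rightarrow> ('g, ('v \<times> 'w \<Rightarrow>\<^sub>0 complex) set) lie_module"
  where "tensor_module V W =
    presented_module (carrier V \<times> carrier W) (tensor_relations V W)
      (\<lambda>x (v, w). basis (act V x v, w) + basis (v, act W x w))"

text \<open>
  The tensor product of a family indexed by \<open>J\<close>: the generator \<open>f\<close> is the pure tensor with factor
  \<open>f i\<close> at position \<open>i\<close>, and the Lie algebra acts by the Leibniz rule.
\<close>

definition tensor_family_relations ::
    "'i set \<Rightarrow> ('i \<Rightarrow> ('g, 'v) lie_module) \<Rightarrow> (('i \<Rightarrow> 'v) \<Rightarrow>\<^sub>0 complex) set"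
  where "tensor_family_relations J V =
    {basis (f(i := v \<oplus>\<^bsub>V i\<^esub> v')) - basis (f(i := v)) - basis (f(i := v')) | f i v v'.
      f \<in> (\<Pi>\<^sub>E j\<in>J. carrier (V j)) \<and> i \<in> J \<and> v \<in> carrier (V i) \<and> v' \<in> carrier (V i)} \<union>
    {basis (f(i := c \<odot>\<^bsub>V i\<^esub> v)) - scale c (basis (f(i := v))) | f i c v.
      f \<in> (\<Pi>\<^sub>E j\<in>J. carrier (V j)) \<and> i \<in> J \<and> v \<in> carrier (V i)}"

definition tensor_family ::
    "'i set \<Rightarrow> ('i \<Rightarrow> ('g, 'v) lie_module) \<Rightarrow> ('g, (('i \<Rightarrow> 'v) \<Rightarrow>\<^sub>0 complex) set) lie_module"
  where "tensor_family J V =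
    presented_module (\<Pi>\<^sub>E j\<in>J. carrier (V j)) (tensor_family_relations J V)
      (\<lambda>x f. \<Sum>i\<in>J. basis (f(i := act (V i) x (f i))))"


section \<open>Universal enveloping algebras and induced modules\<close>

text \<open>
  The free associative unital algebra on a set \<open>B\<close>, with basis the words over \<open>B\<close>.
\<close>

definition free_algebra :: "'x set \<Rightarrow> ('x list \<Rightarrow>\<^sub>0 complex) ring"
  where "free_algebra B =
    \<lparr>carrier = {p. Poly_Mapping.keys p \<subseteq> lists B},
     monoid.mult = (\<lambda>p q. \<Sum>u\<in>Poly_Mapping.keys p. \<Sum>v\<in>Poly_Mapping.keys q.
        Poly_Mapping.single (u @ v) (Poly_Mapping.lookup p u * Poly_Mapping.lookup q v)),
     monoid.one = basis [], ring.zero = 0, add = (+)\<rparr>"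

text \<open>
  The letters of the free algebra are all elements of \<open>G\<close>, so the linear relations among them
  are imposed together with the commutator relations: the first two families turn the free algebra
  into the tensor algebra of \<open>G\<close>.
\<close>

definition uea_ideal :: "'g lie_algebra \<Rightarrow> ('g list \<Rightarrow>\<^sub>0 complex) set"
  where "uea_ideal G = Idl\<^bsub>free_algebra (carrier G)\<^esub>
    ({basis [x \<oplus>\<^bsub>G\<^esub> y] - basis [x] - basis [y] | x y. x \<in> carrier G \<and> y \<in> carrier G} \<union>
     {basis [c \<odot>\<^bsub>G\<^esub> x] - scale c (basis [x]) | c x. x \<in> carrier G} \<union>
     {basis [x, y] - basis [y, x] - basis [bracket G x y] | x y. x \<in> carrier G \<and> y \<in> carrier G})"

definition uea_class :: "'g lie_algebra \<Rightarrow> ('g list \<Rightarrow>\<^sub>0 complex) \<Rightarrow> ('g list \<Rightarrow>\<^sub>0 complex) set"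
  where "uea_class G p = uea_ideal G +>\<^bsub>free_algebra (carrier G)\<^esub> p"

definition uea :: "'g lie_algebra \<Rightarrow> (complex, ('g list \<Rightarrow>\<^sub>0 complex) set) module"
  where "uea G =
    (let U = free_algebra (carrier G) Quot uea_ideal G in
     ring.extend U
       (module.fields (\<lambda>c A. uea_class G (Poly_Mapping.single [] c) \<otimes>\<^bsub>U\<^esub> A)))"

definition uea_embed ::
    "'g lie_algebra \<Rightarrow> ('g list \<Rightarrow>\<^sub>0 complex) set \<Rightarrow> ('g list \<Rightarrow>\<^sub>0 complex) set"
  \<comment> \<open>on an element of \<open>uea H\<close>, for a subalgebra \<open>H\<close> of \<open>G\<close>, the natural map to \<open>uea G\<close>\<close>
  where "uea_embed G A = uea_ideal G <+>\<^bsub>free_algebra (carrier G)\<^esub> A"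

definition word_act :: "('g, 'v) lie_module \<Rightarrow> ('g list \<Rightarrow>\<^sub>0 complex) \<Rightarrow> 'v \<Rightarrow> 'v"
  where "word_act M p v =
    (\<Oplus>\<^bsub>M\<^esub>w\<in>Poly_Mapping.keys p. Poly_Mapping.lookup p w \<odot>\<^bsub>M\<^esub> foldr (act M) w v)"

definition uea_act :: "('g, 'v) lie_module \<Rightarrow> ('g list \<Rightarrow>\<^sub>0 complex) set \<Rightarrow> 'v \<Rightarrow> 'v"
  \<comment> \<open>the common value of \<open>word_act M p v\<close> over all representatives \<open>p\<close> of the class \<open>A\<close>\<close>
  where "uea_act M A v = the_elem ((\<lambda>p. word_act M p v) ` A)"

text \<open>
  The tensor product of \<open>uea G\<close> and \<open>M\<close> over \<open>uea H\<close>, where \<open>H\<close> is a subalgebra of \<open>G\<close> and \<open>M\<close> is an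
  \<open>H\<close>-module, with \<open>G\<close> acting by left multiplication.
\<close>

definition induced_module ::
    "'g lie_algebra \<Rightarrow> 'g lie_algebra \<Rightarrow> ('g, 'v) lie_module
      \<Rightarrow> ('g, (('g list \<Rightarrow>\<^sub>0 complex) set \<times> 'v \<Rightarrow>\<^sub>0 complex) set) lie_module"
  where "induced_module G H M =
    presented_module (carrier (uea G) \<times> carrier M)
      (tensor_relations (uea G) M \<union>
       {basis (u \<otimes>\<^bsub>uea G\<^esub> uea_embed G a, v) - basis (u, uea_act M a v) | u a v.
         u \<in> carrier (uea G) \<and> a \<in> carrier (uea H) \<and> v \<in> carrier M})
      (\<lambda>x (u, v). basis (uea_class G (basis [x]) \<otimes>\<^bsub>uea G\<^esub> u, v))"


section \<open>The twisted Heisenberg-Virasoro algebra\<close>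

datatype hv_basis = L int | I int | C1 | C2 | C3

type_synonym hv = "hv_basis \<Rightarrow>\<^sub>0 complex"

fun hv_bracket_basis :: "hv_basis \<Rightarrow> hv_basis \<Rightarrow> hv"
  where
    "hv_bracket_basis (L m) (L n) =
       Poly_Mapping.single (L (m + n)) (of_int (n - m)) +
       (if m + n = 0 then Poly_Mapping.single C1 (of_int (m ^ 3 - m) / 12) else 0)"
  | "hv_bracket_basis (L m) (I n) =
       Poly_Mapping.single (I (m + n)) (of_int n) +
       (if m + n = 0 then Poly_Mapping.single C2 (of_int (m ^ 2 + m)) else 0)"
  | "hv_bracket_basis (I n) (L m) =
       - (Poly_Mapping.single (I (m + n)) (of_int n) +
          (if m + n = 0 then Poly_Mapping.single C2 (of_int (m ^ 2 + m)) else 0))"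
  | "hv_bracket_basis (I m) (I n) =
       (if m + n = 0 then Poly_Mapping.single C3 (of_int n) else 0)"
  | "hv_bracket_basis _ _ = 0"

definition hv_bracket :: "hv \<Rightarrow> hv \<Rightarrow> hv"
  where "hv_bracket x y =
    linear_extension (\<lambda>a. linear_extension (\<lambda>b. hv_bracket_basis a b) y) x"

definition HV :: "hv lie_algebra"
  where "HV =
    \<lparr>carrier = UNIV, monoid.mult = undefined, monoid.one = undefined, ring.zero = 0, add = (+),
     module.smult = scale, bracket = hv_bracket\<rparr>"

definition HV_sub :: "nat \<Rightarrow> hv lie_algebra"
  where "HV_sub e = HV\<lparr>carrier :=
    {x. Poly_Mapping.keys x \<subseteq>
      {L m | m. 0 \<le> m} \<union> {I m | m. - int e \<le> m} \<union> {C1, C2, C3}}\<rparr>"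

text \<open>
  The polynomial variable is \<open>\<partial>\<close>. The action is written directly on all polynomials, as the linear
  extension from the powers of \<open>\<partial>\<close>: \<open>(\<partial> - k)\<close> to the power \<open>n\<close> becomes \<open>f(\<partial> - k)\<close>.
\<close>

fun Omega_act_basis ::
    "complex \<Rightarrow> complex \<Rightarrow> complex \<Rightarrow> hv_basis \<Rightarrow> complex poly \<Rightarrow> complex poly"
  where
    "Omega_act_basis l a b (L k) p =
       Polynomial.smult (l powi k) ([:of_int k * a, 1:] * pcompose p [:- of_int k, 1:])"
  | "Omega_act_basis l a b (I k) p =
       Polynomial.smult (l powi k * b) (pcompose p [:- of_int k, 1:])"
  | "Omega_act_basis l a b _ p = 0"

definition Omega :: "complex \<Rightarrow> complex \<Rightarrow> complex \<Rightarrow> (hv, complex poly) lie_module"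
  where "Omega l a b =
    \<lparr>carrier = UNIV, monoid.mult = undefined, monoid.one = undefined, ring.zero = 0, add = (+),
     module.smult = Polynomial.smult,
     act = (\<lambda>x p. \<Sum>h\<in>Poly_Mapping.keys x.
       Polynomial.smult (Poly_Mapping.lookup x h) (Omega_act_basis l a b h p))\<rparr>"

abbreviation Ind ::
    "nat \<Rightarrow> (hv, 'a) lie_module \<Rightarrow> (hv, ((hv list \<Rightarrow>\<^sub>0 complex) set \<times> 'a \<Rightarrow>\<^sub>0 complex) set) lie_module"
  where "Ind e M \<equiv> induced_module HV (HV_sub e) M"

definition condition_star :: "nat \<Rightarrow> (hv, 'a) lie_module \<Rightarrow> bool"
  where "condition_star e M \<longleftrightarrow>
    simple_lie_module (HV_sub e) M \<and>
    (\<exists>\<kappa>\<^sub>0 \<kappa>\<^sub>1 \<kappa>\<^sub>2 \<kappa>\<^sub>3 :: complex.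
      (\<forall>v\<in>carrier M. act M (basis (I 0)) v = \<kappa>\<^sub>0 \<odot>\<^bsub>M\<^esub> v) \<and>
      (\<forall>v\<in>carrier M. act M (basis C1) v = \<kappa>\<^sub>1 \<odot>\<^bsub>M\<^esub> v) \<and>
      (\<forall>v\<in>carrier M. act M (basis C2) v = \<kappa>\<^sub>2 \<odot>\<^bsub>M\<^esub> v) \<and>
      (\<forall>v\<in>carrier M. act M (basis C3) v = \<kappa>\<^sub>3 \<odot>\<^bsub>M\<^esub> v) \<and>
      \<kappa>\<^sub>3 = 0 \<and>
      (\<exists>k::nat.
        (k \<noteq> 0 \<longrightarrow> inj_on (act M (basis (I (int k)))) (carrier M)) \<and>
        (k = 0 \<longrightarrow> (\<forall>n::int. n \<noteq> 0 \<longrightarrow> \<kappa>\<^sub>0 + (of_int n - 1) * \<kappa>\<^sub>2 \<noteq> 0)) \<and>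
        (\<forall>n>k. \<forall>v\<in>carrier M. act M (basis (I (int n))) v = \<zero>\<^bsub>M\<^esub>) \<and>
        (\<forall>n>k + e. \<forall>v\<in>carrier M. act M (basis (L (int n))) v = \<zero>\<^bsub>M\<^esub>)))"

end

theory Submission
  imports Defs
begin

text \<open>
  The argument rests on two properties of the induced modules \<open>V = Ind(M)\<close>: they are nonzero, and they are
  restricted, that is, every vector is killed by \<open>L k\<close> and \<open>I k\<close> for all large \<open>k\<close>.

  On a tensor \<open>f \<otimes> v\<close>, where \<open>f\<close> is a polynomial in the variables \<open>\<partial> i\<close>, the element \<open>L k\<close> acts for large \<open>k\<close>
  as \<open>\<Sum>i. \<lambda> i ^ k (\<partial> i + k \<alpha> i) f(\<partial> i - k) \<otimes> v\<close>, where the shift concerns the \<open>i\<close>-th variable, and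
  \<open>I k\<close> acts as \<open>\<Sum>i. \<lambda> i ^ k \<beta> i f(\<partial> i - k) \<otimes> v\<close>. These are exponential polynomials in \<open>k\<close>, whose coefficients
  are unique (\<open>exponential_expansion_unique\<close>). Hence every isomorphism commutes with the coefficient
  operators. The coefficient of \<open>\<lambda> i ^ k\<close> in the action of \<open>L k\<close> is multiplication by \<open>\<partial> i\<close>; it does not vanish, so the
  \<open>\<lambda> i\<close> are determined. The coefficient of \<open>k \<lambda> i ^ k\<close> is \<open>\<alpha> i - \<partial> i D i\<close> with \<open>D i\<close> the derivative, and has the
  eigenvalues \<open>\<alpha> i, \<alpha> i - 1, \<dots>\<close>, which determine \<open>\<alpha> i\<close>. The coefficient of \<open>\<lambda> i ^ k\<close> in the action of \<open>I k\<close> is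
  the scalar \<open>\<beta> i\<close>. This is \<open>parameters_recovered\<close>. Once the parameters agree, an isomorphism preserves the
  joint eigenspace \<open>1 \<otimes> V\<close> of the operators \<open>\<alpha> i - \<partial> i D i\<close> for the eigenvalues \<open>\<alpha> i\<close>, and the map that
  it induces between the last factors is an isomorphism of modules (\<open>vacuum_preserved\<close>, \<open>tensor_cancel\<close>). The converse
  is functoriality of tensor products (\<open>reindexed_isomorphic\<close>).

  That the induced module is restricted follows by moving \<open>L k\<close> and \<open>I k\<close> past the letters of a word. That it is
  not zero is a theorem of Poincare-Birkhoff-Witt type. It is obtained by letting the whole algebra act on pairs of
  a sorted word in the complementary letters and a coordinate of \<open>M\<close> (\<open>partial_representation\<close>); Frobenius
  reciprocity (\<open>exists_map_from_Ind\<close>) then maps the induced module to this module.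
\<close>

section \<open>Linear algebra over carrier sets\<close>

abbreviation lookup where "lookup \<equiv> Poly_Mapping.lookup"
abbreviation keys where "keys \<equiv> Poly_Mapping.keys"

lemma complex_ring_simps [simp]:
  "carrier complex_ring = UNIV" "x \<otimes>\<^bsub>complex_ring\<^esub> y = x * y" "x \<oplus>\<^bsub>complex_ring\<^esub> y = x + y"
  "\<zero>\<^bsub>complex_ring\<^esub> = 0" "\<one>\<^bsub>complex_ring\<^esub> = 1"
  by (simp_all add: ring_of_type_algebra_def)

lemma cring_complex_ring: "cring complex_ring"
proof (rule cringI)
  show "abelian_group complex_ring"
    by (rule abelian_groupI) (auto simp: algebra_simps intro: exI[of _ "- x" for x])
  show "Group.comm_monoid complex_ring"
    by (rule comm_monoidI) (auto simp: algebra_simps)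
qed (auto simp: algebra_simps)

locale complex_space =
  fixes V :: "(complex, 'v, 'm) module_scheme" (structure)
  assumes module_complex: "Module.module complex_ring V"

sublocale complex_space \<subseteq> Module.module complex_ring V
  by (rule module_complex)

context complex_space
begin

lemma smult_in [simp, intro]: "v \<in> carrier V \<Longrightarrow> c \<odot> v \<in> carrier V"
  by (rule smult_closed) auto

lemma smult_plus: "v \<in> carrier V \<Longrightarrow> (a + b) \<odot> v = a \<odot> v \<oplus> b \<odot> v"
  using smult_l_distr[of a b v] by simp

lemma smult_oplus: "v \<in> carrier V \<Longrightarrow> w \<in> carrier V \<Longrightarrow> a \<odot> (v \<oplus> w) = a \<odot> v \<oplus> a \<odot> w"
  using smult_r_distr[of a v w] by simp

lemma smult_smult: "v \<in> carrier V \<Longrightarrow> a \<odot> (b \<odot> v) = (a * b) \<odot> v"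
  using smult_assoc1[of a b v] by simp

lemma smult_1 [simp]: "v \<in> carrier V \<Longrightarrow> 1 \<odot> v = v"
  using smult_one[of v] by simp

lemma smult_0 [simp]: "v \<in> carrier V \<Longrightarrow> 0 \<odot> v = \<zero>"
  using smult_l_null[of v] by simp

lemma smult_zero [simp]: "c \<odot> \<zero> = \<zero>"
  using smult_r_null[of c] by simp

lemma minus_eq_smult: "v \<in> carrier V \<Longrightarrow> \<ominus> v = (-1) \<odot> v"
  using smult_plus[of v 1 "-1"] by (simp add: M.minus_equality M.a_comm)

lemma diff_eq_smult: "v \<in> carrier V \<Longrightarrow> w \<in> carrier V \<Longrightarrow> v \<ominus> w = v \<oplus> (-1) \<odot> w"
  by (simp add: a_minus_def minus_eq_smult)

lemma diff_zero_iff: "v \<in> carrier V \<Longrightarrow> w \<in> carrier V \<Longrightarrow> v \<oplus> (-1) \<odot> w = \<zero> \<longleftrightarrow> v = w"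
  by (metis M.add.inv_closed M.minus_equality M.minus_minus M.r_neg minus_eq_smult smult_in M.a_comm)

end

lemma complex_spaceI:
  fixes V :: "(complex, 'v, 'm) module_scheme" (structure)
  assumes "\<zero> \<in> carrier V"
    and "\<And>v w. v \<in> carrier V \<Longrightarrow> w \<in> carrier V \<Longrightarrow> v \<oplus> w \<in> carrier V"
    and "\<And>c v. v \<in> carrier V \<Longrightarrow> c \<odot> v \<in> carrier V"
    and "\<And>u v w. u \<in> carrier V \<Longrightarrow> v \<in> carrier V \<Longrightarrow> w \<in> carrier V \<Longrightarrow>
      (u \<oplus> v) \<oplus> w = u \<oplus> (v \<oplus> w)"
    and "\<And>v w. v \<in> carrier V \<Longrightarrow> w \<in> carrier V \<Longrightarrow> v \<oplus> w = w \<oplus> v"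
    and "\<And>v. v \<in> carrier V \<Longrightarrow> \<zero> \<oplus> v = v"
    and "\<And>v. v \<in> carrier V \<Longrightarrow> 0 \<odot> v = \<zero>"
    and "\<And>a b v. v \<in> carrier V \<Longrightarrow> (a + b) \<odot> v = a \<odot> v \<oplus> b \<odot> v"
    and "\<And>a v w. v \<in> carrier V \<Longrightarrow> w \<in> carrier V \<Longrightarrow> a \<odot> (v \<oplus> w) = a \<odot> v \<oplus> a \<odot> w"
    and "\<And>a b v. v \<in> carrier V \<Longrightarrow> (a * b) \<odot> v = a \<odot> (b \<odot> v)"
    and "\<And>v. v \<in> carrier V \<Longrightarrow> 1 \<odot> v = v"
  shows "complex_space V"
proof (rule complex_space.intro, rule moduleI)
  show "cring complex_ring" by (rule cring_complex_ring)
  show "abelian_group V"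
  proof (rule abelian_groupI)
    fix x assume x: "x \<in> carrier V"
    have "(-1) \<odot> x \<oplus> x = \<zero>"
      using assms(8)[OF x, of "-1" 1] assms(7,11) x by simp
    then show "\<exists>y\<in>carrier V. y \<oplus> x = \<zero>" using assms(3) x by blast
  qed (use assms in auto)
qed (use assms in auto)

definition linear_map ::
    "(complex, 'v, 'm) module_scheme \<Rightarrow> (complex, 'w, 'n) module_scheme \<Rightarrow> ('v \<Rightarrow> 'w) \<Rightarrow> bool"
  where "linear_map V W f \<longleftrightarrow> f \<in> carrier V \<rightarrow> carrier W \<and>
    (\<forall>v\<in>carrier V. \<forall>v'\<in>carrier V. f (v \<oplus>\<^bsub>V\<^esub> v') = f v \<oplus>\<^bsub>W\<^esub> f v') \<and>
    (\<forall>c. \<forall>v\<in>carrier V. f (c \<odot>\<^bsub>V\<^esub> v) = c \<odot>\<^bsub>W\<^esub> f v)"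

lemma linear_mapI:
  assumes "\<And>v. v \<in> carrier V \<Longrightarrow> f v \<in> carrier W"
    and "\<And>v v'. v \<in> carrier V \<Longrightarrow> v' \<in> carrier V \<Longrightarrow> f (v \<oplus>\<^bsub>V\<^esub> v') = f v \<oplus>\<^bsub>W\<^esub> f v'"
    and "\<And>c v. v \<in> carrier V \<Longrightarrow> f (c \<odot>\<^bsub>V\<^esub> v) = c \<odot>\<^bsub>W\<^esub> f v"
  shows "linear_map V W f"
  using assms by (auto simp: linear_map_def)

lemma linear_mapD:
  assumes "linear_map V W f" and "v \<in> carrier V"
  shows "f v \<in> carrier W"
    and "v' \<in> carrier V \<Longrightarrow> f (v \<oplus>\<^bsub>V\<^esub> v') = f v \<oplus>\<^bsub>W\<^esub> f v'"
    and "f (c \<odot>\<^bsub>V\<^esub> v) = c \<odot>\<^bsub>W\<^esub> f v"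
  using assms by (auto simp: linear_map_def)

lemma linear_map_zero:
  assumes "linear_map V W f" "complex_space V" "complex_space W"
  shows "f \<zero>\<^bsub>V\<^esub> = \<zero>\<^bsub>W\<^esub>"
proof -
  interpret V: complex_space V by fact
  interpret W: complex_space W by fact
  have "f (0 \<odot>\<^bsub>V\<^esub> \<zero>\<^bsub>V\<^esub>) = 0 \<odot>\<^bsub>W\<^esub> f \<zero>\<^bsub>V\<^esub>" by (rule linear_mapD(3)[OF assms(1)]) simp
  then show ?thesis using linear_mapD(1)[OF assms(1), of "\<zero>\<^bsub>V\<^esub>"] by simp
qed

lemma linear_map_comp:
  "linear_map V W f \<Longrightarrow> linear_map W U g \<Longrightarrow> linear_map V U (\<lambda>v. g (f v))"
  by (auto simp: linear_map_def Pi_iff)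

lemma linear_map_affine:
  assumes "linear_map V W f" "complex_space V" "v \<in> carrier V" "w \<in> carrier V"
  shows "f (s \<odot>\<^bsub>V\<^esub> v \<oplus>\<^bsub>V\<^esub> t \<odot>\<^bsub>V\<^esub> w) = s \<odot>\<^bsub>W\<^esub> f v \<oplus>\<^bsub>W\<^esub> t \<odot>\<^bsub>W\<^esub> f w"
proof -
  interpret complex_space V by fact
  show ?thesis
    using assms linear_mapD(2)[OF assms(1), of "s \<odot>\<^bsub>V\<^esub> v" "t \<odot>\<^bsub>V\<^esub> w"]
      linear_mapD(3)[OF assms(1)] by simp
qed

lemma smult_cancel:
  assumes "complex_space V" "v \<in> carrier V" "v \<noteq> \<zero>\<^bsub>V\<^esub>" "s \<odot>\<^bsub>V\<^esub> v = t \<odot>\<^bsub>V\<^esub> v"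
  shows "s = t"
proof (rule ccontr)
  interpret complex_space V by fact
  assume "s \<noteq> t"
  have "(s - t) \<odot>\<^bsub>V\<^esub> v = s \<odot>\<^bsub>V\<^esub> v \<oplus>\<^bsub>V\<^esub> (- 1) \<odot>\<^bsub>V\<^esub> (t \<odot>\<^bsub>V\<^esub> v)"
    using smult_plus[OF assms(2), of s "- t"] assms(2) by (simp add: smult_smult)
  also have "\<dots> = \<zero>\<^bsub>V\<^esub>" using assms(2,4) diff_zero_iff by simp
  finally have "inverse (s - t) \<odot>\<^bsub>V\<^esub> ((s - t) \<odot>\<^bsub>V\<^esub> v) = \<zero>\<^bsub>V\<^esub>" by simp
  then show False using assms(2,3) \<open>s \<noteq> t\<close> by (simp add: smult_smult)
qed

text \<open>
  The ground field as a vector space, so that functionals are linear maps.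
\<close>

definition scalars :: "(complex, complex) module"
  where "scalars = \<lparr>carrier = UNIV, monoid.mult = (*), monoid.one = 1, ring.zero = 0,
    add = (+), module.smult = (*)\<rparr>"

lemma scalars_simps [simp]:
  "carrier scalars = UNIV" "x \<oplus>\<^bsub>scalars\<^esub> y = x + y" "\<zero>\<^bsub>scalars\<^esub> = 0" "x \<odot>\<^bsub>scalars\<^esub> y = x * y"
  by (simp_all add: scalars_def)

lemma complex_space_scalars: "complex_space scalars"
  by (rule complex_spaceI) (auto simp: algebra_simps)

abbreviation functional :: "(complex, 'v, 'm) module_scheme \<Rightarrow> ('v \<Rightarrow> complex) \<Rightarrow> bool"
  where "functional V \<equiv> linear_map V scalars"

lemma functional_zero: "functional V l \<Longrightarrow> complex_space V \<Longrightarrow> l \<zero>\<^bsub>V\<^esub> = 0"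
  using linear_map_zero[OF _ _ complex_space_scalars] by fastforce

subsection \<open>Free spaces\<close>

lemma lookup_scale [simp]: "lookup (scale c p) x = c * lookup p x"
  by (simp add: scale_def Poly_Mapping.map.rep_eq when_def)

lemma vector_space_scale: "vector_space scale"
  by unfold_locales (auto intro!: poly_mapping_eqI simp: lookup_add algebra_simps)

interpretation fs: vector_space scale
  by (rule vector_space_scale)

lemmas scale_simps [simp] = fs.scale_zero_left fs.scale_zero_right fs.scale_one

lemma scale_basis: "scale c (basis x) = Poly_Mapping.single x c"
  by (rule poly_mapping_eqI) (simp add: lookup_single when_def)

lemma scale_minus_one: "scale (-1) p = - p"
  by (rule poly_mapping_eqI) simp

lemma keys_scale: "keys (scale c p) \<subseteq> keys p"
  by (auto simp: in_keys_iff)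

lemma keys_uminus [simp]: "keys (- p) = keys (p :: 'a \<Rightarrow>\<^sub>0 complex)"
  by (auto simp: in_keys_iff)

lemma keys_minus: "keys (p - q) \<subseteq> keys p \<union> keys (q :: 'a \<Rightarrow>\<^sub>0 complex)"
  by (auto simp: in_keys_iff lookup_minus)

lemma keys_add_subset [simp]:
  "keys p \<subseteq> B \<Longrightarrow> keys q \<subseteq> B \<Longrightarrow> keys (p + q) \<subseteq> B"
  using Poly_Mapping.keys_add[of p q] by blast

lemma keys_diff_subset [simp]:
  "keys p \<subseteq> B \<Longrightarrow> keys q \<subseteq> B \<Longrightarrow> keys (p - q :: 'a \<Rightarrow>\<^sub>0 complex) \<subseteq> B"
  using keys_minus[of p q] by blast

lemma keys_scale_subset [simp]: "keys p \<subseteq> B \<Longrightarrow> keys (scale c p) \<subseteq> B"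
  using keys_scale[of c p] by blast

lemma keys_basis_subset [simp]: "keys (basis x) \<subseteq> B \<longleftrightarrow> x \<in> B"
  by simp

lemma keys_sum_subset:
  "(\<And>x. x \<in> S \<Longrightarrow> keys (f x) \<subseteq> B) \<Longrightarrow> keys (\<Sum>x\<in>S. f x) \<subseteq> B"
  by (induction S rule: infinite_finite_induct) (auto intro!: keys_add_subset)

lemma free_space_simps [simp]:
  "carrier (free_space B) = {p. keys p \<subseteq> B}"
  "p \<oplus>\<^bsub>free_space B\<^esub> q = p + q" "\<zero>\<^bsub>free_space B\<^esub> = 0" "c \<odot>\<^bsub>free_space B\<^esub> p = scale c p"
  by (simp_all add: free_space_def)

lemma complex_space_free_space: "complex_space (free_space B)"
  by (rule complex_spaceI)
    (simp_all add: algebra_simps fs.scale_left_distrib fs.scale_right_distrib)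

text \<open>
  Restricting to vectors supported in \<open>B\<close> makes the rule applicable to quotients of
  the free space on a carrier set.
\<close>

lemma free_induct [consumes 1, case_names basis add zero scale]:
  assumes "keys p \<subseteq> B"
    and "\<And>x. x \<in> B \<Longrightarrow> P (basis x)"
    and "\<And>p q. keys p \<subseteq> B \<Longrightarrow> keys q \<subseteq> B \<Longrightarrow> P p \<Longrightarrow> P q \<Longrightarrow> P (p + q)"
    and "P 0"
    and "\<And>c p. keys p \<subseteq> B \<Longrightarrow> P p \<Longrightarrow> P (scale c p)"
  shows "P p"
proof -
  have "keys q \<subseteq> B \<Longrightarrow> P q" if "finite S" "keys q = S" for q S
    using that
  proof (induction S arbitrary: q)
    case empty
    then show ?case using assms(4) by simp
  next
    case (insert x S)
    define r where "r = q - scale (lookup q x) (basis x)"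
    have r: "keys r = S"
      using insert.prems insert.hyps
      by (auto simp: r_def in_keys_iff lookup_minus lookup_single when_def split: if_splits)
    have x: "x \<in> B" and S: "S \<subseteq> B" using insert.prems insert.hyps by auto
    have "P r" using insert.IH[of r] S r by simp
    moreover have "q = r + scale (lookup q x) (basis x)" by (simp add: r_def)
    moreover have "P (scale (lookup q x) (basis x))" using assms(2,5) x by simp
    ultimately show ?case
      using assms(3)[of r "scale (lookup q x) (basis x)"] r S x by (metis keys_basis_subset keys_scale_subset)
  qed
  from this[of "keys p" p] show ?thesis using assms(1) by simp
qed

definition combination ::
    "(complex, 'v, 'm) module_scheme \<Rightarrow> ('x \<Rightarrow> 'v) \<Rightarrow> ('x \<Rightarrow>\<^sub>0 complex) \<Rightarrow> 'v"
  where "combination V f p = (\<Oplus>\<^bsub>V\<^esub>x\<in>keys p. lookup p x \<odot>\<^bsub>V\<^esub> f x)"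

context complex_space
begin

lemma combination_superset:
  assumes "finite S" "keys p \<subseteq> S" "f \<in> S \<rightarrow> carrier V"
  shows "combination V f p = (\<Oplus>x\<in>S. lookup p x \<odot> f x)"
  unfolding combination_def
  by (rule M.add.finprod_mono_neutral_cong_left) (use assms in \<open>auto simp: in_keys_iff Pi_iff\<close>)

lemma combination_closed [intro]:
  "f \<in> keys p \<rightarrow> carrier V \<Longrightarrow> combination V f p \<in> carrier V"
  unfolding combination_def by (rule M.finsum_closed) auto

lemma subset_funcset: "f \<in> B \<rightarrow> C \<Longrightarrow> A \<subseteq> B \<Longrightarrow> f \<in> A \<rightarrow> C"
  by auto

lemma combination_zero [simp]: "combination V f 0 = \<zero>"
  by (simp add: combination_def)

lemma combination_basis [simp]: "f x \<in> carrier V \<Longrightarrow> combination V f (basis x) = f x"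
  by (simp add: combination_def)

lemma combination_add:
  assumes "f \<in> B \<rightarrow> carrier V" "keys p \<subseteq> B" "keys q \<subseteq> B"
  shows "combination V f (p + q) = combination V f p \<oplus> combination V f q"
proof -
  let ?S = "keys p \<union> keys q"
  have f: "f \<in> ?S \<rightarrow> carrier V" using assms by auto
  have "combination V f (p + q) = (\<Oplus>x\<in>?S. lookup (p + q) x \<odot> f x)"
    by (rule combination_superset) (use Poly_Mapping.keys_add[of p q] f in auto)
  also have "\<dots> = (\<Oplus>x\<in>?S. lookup p x \<odot> f x \<oplus> lookup q x \<odot> f x)"
    by (rule M.add.finprod_cong') (use f in \<open>auto simp: lookup_add smult_plus Pi_iff\<close>)
  also have "\<dots> = (\<Oplus>x\<in>?S. lookup p x \<odot> f x) \<oplus> (\<Oplus>x\<in>?S. lookup q x \<odot> f x)"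
    by (rule M.add.finprod_multf) (use f in auto)
  also have "\<dots> = combination V f p \<oplus> combination V f q"
    using combination_superset[of ?S p f] combination_superset[of ?S q f] f by simp
  finally show ?thesis .
qed

lemma combination_scale:
  assumes "f \<in> B \<rightarrow> carrier V" "keys p \<subseteq> B"
  shows "combination V f (scale c p) = c \<odot> combination V f p"
proof -
  let ?S = "keys p"
  have f: "f \<in> ?S \<rightarrow> carrier V" using assms by auto
  have "combination V f (scale c p) = (\<Oplus>x\<in>?S. lookup (scale c p) x \<odot> f x)"
    by (rule combination_superset) (use keys_scale[of c p] f in auto)
  also have "\<dots> = (\<Oplus>x\<in>?S. c \<odot> (lookup p x \<odot> f x))"
    by (rule M.add.finprod_cong') (use f in \<open>auto simp: smult_smult Pi_iff\<close>)
  also have "\<dots> = c \<odot> (\<Oplus>x\<in>?S. lookup p x \<odot> f x)"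
    by (rule finsum_smult_ldistr[symmetric]) (use f in auto)
  finally show ?thesis by (simp add: combination_def)
qed

lemma linear_map_combination:
  assumes "f \<in> B \<rightarrow> carrier V"
  shows "linear_map (free_space B) V (combination V f)"
  by (rule linear_mapI)
    (simp_all add: combination_add[OF assms] combination_scale[OF assms] combination_closed[OF subset_funcset[OF assms]])

lemma combination_diff:
  assumes "f \<in> B \<rightarrow> carrier V" "keys p \<subseteq> B" "keys q \<subseteq> B"
  shows "combination V f (p - q) = combination V f p \<ominus> combination V f q"
proof -
  have "p - q = p + scale (-1) q" by (simp add: scale_minus_one)
  then show ?thesis
    using assms combination_add[OF assms(1,2), of "scale (-1) q"] combination_scale[OF assms(1,3), of "-1"]
    by (simp add: diff_eq_smult combination_closed[OF subset_funcset[OF assms(1)]])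
qed

lemma combination_cong:
  "(\<And>x. x \<in> keys p \<Longrightarrow> f x = g x) \<Longrightarrow> f \<in> keys p \<rightarrow> carrier V \<Longrightarrow>
    combination V f p = combination V g p"
  unfolding combination_def by (rule M.add.finprod_cong') (auto simp: Pi_iff)

text \<open>
  The universal property of a free space: linear maps agree once they agree on the basis.
\<close>

lemma combination_unique:
  assumes "linear_map (free_space B) V F" "keys p \<subseteq> B"
  shows "F p = combination V (\<lambda>x. F (basis x)) p"
proof -
  have B: "(\<lambda>x. F (basis x)) \<in> B \<rightarrow> carrier V"
    using linear_mapD(1)[OF assms(1)] by auto
  note D = linear_mapD[OF assms(1)]
  from assms(2) show ?thesis
  proof (induction p rule: free_induct)
    case (basis x) then show ?case using B by (auto simp: Pi_iff)
  next
    case (add p q) then show ?case using D(2)[of p q] combination_add[OF B] by simp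
  next
    case zero
    show ?case using linear_map_zero[OF assms(1) complex_space_free_space complex_space_axioms] by simp
  next
    case (scale c p) then show ?case using D(3)[of p c] combination_scale[OF B] by simp
  qed
qed

end

lemma linear_map_of_combination:
  assumes "linear_map V W g" "complex_space V" "complex_space W" "f \<in> keys p \<rightarrow> carrier V"
  shows "g (combination V f p) = combination W (\<lambda>x. g (f x)) p"
proof -
  interpret V: complex_space V by fact
  interpret W: complex_space W by fact
  have "linear_map (free_space (keys p)) W (\<lambda>q. g (combination V f q))"
    by (rule linear_map_comp[OF V.linear_map_combination[OF assms(4)] assms(1)])
  from W.combination_unique[OF this, of p] have
    "g (combination V f p) = combination W (\<lambda>x. g (combination V f (basis x))) p" by simp
  also have "\<dots> = combination W (\<lambda>x. g (f x)) p"
  proof (rule W.combination_cong)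
    show *: "g (combination V f (basis x)) = g (f x)" if "x \<in> keys p" for x
      using that assms(4) V.combination_basis[of f x] by (auto simp: Pi_iff)
    show "(\<lambda>x. g (combination V f (basis x))) \<in> keys p \<rightarrow> carrier W"
      using * linear_mapD(1)[OF assms(1)] assms(4) by (auto simp: Pi_iff)
  qed
  finally show ?thesis .
qed

lemma linear_extension_eq_combination: "linear_extension F p = combination (free_space UNIV) F p"
proof -
  interpret complex_space "free_space UNIV" by (rule complex_space_free_space)
  have "finite S \<Longrightarrow> (\<Oplus>\<^bsub>free_space UNIV\<^esub>x\<in>S. h x) = (\<Sum>x\<in>S. h x)"
    for S and h :: "'b \<Rightarrow> 'a \<Rightarrow>\<^sub>0 complex"
    by (induction S rule: finite_induct) auto
  then show ?thesis by (simp add: linear_extension_def combination_def)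
qed

lemma linear_extension_add: "linear_extension F (p + q) = linear_extension F p + linear_extension F q"
  using complex_space.combination_add[OF complex_space_free_space, of F UNIV]
  by (simp add: linear_extension_eq_combination)

lemma linear_extension_scale: "linear_extension F (scale c p) = scale c (linear_extension F p)"
  using complex_space.combination_scale[OF complex_space_free_space, of F UNIV]
  by (simp add: linear_extension_eq_combination)

lemma linear_extension_zero [simp]: "linear_extension F 0 = 0"
  by (simp add: linear_extension_def)

lemma linear_extension_basis [simp]: "linear_extension F (basis x) = F x"
  by (simp add: linear_extension_def)

lemma linear_extension_single: "linear_extension F (Poly_Mapping.single x c) = scale c (F x)"
  by (metis linear_extension_basis linear_extension_scale scale_basis)

lemma linear_extension_minus: "linear_extension F (- p) = - linear_extension F p"
  by (metis linear_extension_scale scale_minus_one)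

lemma linear_extension_diff: "linear_extension F (p - q) = linear_extension F p - linear_extension F q"
  by (metis linear_extension_add linear_extension_minus uminus_add_conv_diff add.commute)

lemma linear_extension_sum: "linear_extension F (\<Sum>i\<in>S. p i) = (\<Sum>i\<in>S. linear_extension F (p i))"
  by (induction S rule: infinite_finite_induct) (auto simp: linear_extension_add)

lemma keys_linear_extension:
  "(\<And>x. x \<in> keys p \<Longrightarrow> keys (F x) \<subseteq> B) \<Longrightarrow>
    keys (linear_extension F p) \<subseteq> B"
  unfolding linear_extension_def by (intro keys_sum_subset keys_scale_subset) auto

lemma linear_extension_cong:
  "(\<And>x. x \<in> keys p \<Longrightarrow> F x = G x) \<Longrightarrow> linear_extension F p = linear_extension G p"
  by (auto simp: linear_extension_def)

lemma linear_map_linear_extension: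
  assumes "\<And>x. x \<in> B \<Longrightarrow> keys (F x) \<subseteq> C"
  shows "linear_map (free_space B) (free_space C) (linear_extension F)"
proof (rule linear_mapI)
  fix p assume "p \<in> carrier (free_space B)"
  then have "keys p \<subseteq> B" by simp
  then have "keys (linear_extension F p) \<subseteq> C" by (intro keys_linear_extension assms) blast
  then show "linear_extension F p \<in> carrier (free_space C)" by simp
qed (simp_all add: linear_extension_add linear_extension_scale)

lemma combination_linear_extension:
  assumes "complex_space V" "\<And>x. x \<in> keys p \<Longrightarrow> keys (F x) \<subseteq> C" "f \<in> C \<rightarrow> carrier V"
  shows "combination V f (linear_extension F p) = combination V (\<lambda>x. combination V f (F x)) p"
proof -
  interpret V: complex_space V by fact
  let ?B = "keys p"
  have "linear_map (free_space ?B) V (\<lambda>q. combination V f (linear_extension F q))"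
    by (rule linear_map_comp[OF linear_map_linear_extension V.linear_map_combination])
      (use assms in auto)
  from V.combination_unique[OF this, of p] show ?thesis by simp
qed

lemma linear_extension_linear_extension:
  "linear_extension F (linear_extension G p) = linear_extension (\<lambda>x. linear_extension F (G x)) p"
  using combination_linear_extension[OF complex_space_free_space, of p G UNIV F UNIV]
  by (simp add: linear_extension_eq_combination)

lemma linear_extension_id [simp]: "linear_extension basis p = p"
proof -
  have "keys p \<subseteq> UNIV" by simp
  then show ?thesis
    by (induction p rule: free_induct) (auto simp: linear_extension_add linear_extension_scale)
qed

lemma linear_extension_add_fun:
  "linear_extension (\<lambda>x. F x + G x) p = linear_extension F p + linear_extension G p"
  by (simp add: linear_extension_def fs.scale_right_distrib sum.distrib)

lemma linear_extension_scale_fun: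
  "linear_extension (\<lambda>x. scale c (F x)) p = scale c (linear_extension F p)"
  by (simp add: linear_extension_def fs.scale_sum_right mult.commute)

text \<open>
  A complement of the kernel of the evaluation map \<open>free_space (carrier V) \<rightarrow>
  V\<close> is a copy of \<open>V\<close>. This replaces an abstract space by vectors with complex
  coordinates: it provides enough functionals below, and later it lets a representation act on a
  free space.
\<close>

lemma exists_linear_section:
  assumes "complex_space V"
  shows "\<exists>j. linear_map V (free_space (carrier V)) j \<and>
    (\<forall>v\<in>carrier V. combination V (\<lambda>x. x) (j v) = v)"
proof -
  interpret V: complex_space V by fact
  interpret vp: vector_space_pair scale scale
    by unfold_locales
  let ?ev = "combination V (\<lambda>x. x)"
  let ?K = "{p. keys p \<subseteq> carrier V \<and> ?ev p = \<zero>\<^bsub>V\<^esub>}"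
  have id: "(\<lambda>x. x) \<in> carrier V \<rightarrow> carrier V" by simp
  note ev_add = V.combination_add[OF id] and ev_scale = V.combination_scale[OF id]
  have ev_closed: "keys p \<subseteq> carrier V \<Longrightarrow> ?ev p \<in> carrier V" for p by auto
  have K: "fs.subspace ?K"
    by (rule fs.subspaceI) (simp_all add: ev_add ev_scale)
  \<comment> \<open>\<open>f\<close> projects along the kernel: it kills a basis of the kernel and fixes the other basis vectors\<close>
  obtain A where A: "A \<subseteq> ?K" "fs.independent A" "?K \<subseteq> fs.span A"
    using fs.maximal_independent_subset[of ?K] by blast
  have spanA: "fs.span A = ?K" using A fs.span_minimal[OF A(1) K] by blast
  let ?E = "fs.extend_basis A"
  have E: "A \<subseteq> ?E" "fs.independent ?E" "fs.span ?E = UNIV"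
    using fs.extend_basis_superset fs.independent_extend_basis fs.span_extend_basis A(2) by auto
  define f where "f = vp.construct ?E (\<lambda>b. if b \<in> A then 0 else b)"
  have f: "Vector_Spaces.linear scale scale f"
    unfolding f_def by (rule vp.linear_construct[OF E(2)])
  interpret f: Vector_Spaces.linear scale scale f by (rule f)
  have fE: "f b = (if b \<in> A then 0 else b)" if "b \<in> ?E" for b
    unfolding f_def by (rule vp.construct_basis[OF E(2) that])
  have fK: "f p = 0" if "p \<in> ?K" for p
  proof -
    have "p \<in> fs.span A" using that spanA by simp
    then show ?thesis
      by (induction rule: fs.span_induct_alt) (use E fE in \<open>auto simp: f.add f.scale\<close>)
  qed
  have diff: "f p - p \<in> ?K" for p
  proof -
    have "p \<in> fs.span ?E" using E by simp
    then have "f p - p \<in> fs.span A"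
    proof (induction rule: fs.span_induct_alt)
      case base show ?case by (simp add: f.zero fs.span_zero)
    next
      case (step c b y)
      have *: "f b - b \<in> fs.span A"
        using fE[OF step(1)] by (auto simp: fs.span_zero fs.span_neg fs.span_base)
      have "scale c (f b - b) + (f y - y) \<in> fs.span A"
        by (intro fs.span_add fs.span_scale step(2) *)
      moreover have "scale c (f b - b) + (f y - y) = f (scale c b + y) - (scale c b + y)"
        unfolding f.add f.scale fs.scale_right_diff_distrib by (rule add_diff_add[symmetric])
      ultimately show ?case by argo
    qed
    then show ?thesis using spanA by simp
  qed
  have fkeys: "keys (f p) \<subseteq> carrier V" if "keys p \<subseteq> carrier V" for p
    using diff[of p] that keys_add_subset[of "f p - p" "carrier V" p] by simp
  have evf: "?ev (f p) = ?ev p" if "keys p \<subseteq> carrier V" for p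
  proof -
    have "?ev (f p) = ?ev ((f p - p) + p)" by simp
    also have "\<dots> = ?ev (f p - p) \<oplus>\<^bsub>V\<^esub> ?ev p" using diff[of p] that by (subst ev_add) auto
    finally show ?thesis using diff[of p] ev_closed[OF that] by simp
  qed
  define j where "j v = f (basis v)" for v
  have ker: "f p = f q" if "keys p \<subseteq> carrier V" "keys q \<subseteq> carrier V" "?ev p = ?ev q" for p q
  proof -
    have "?ev (p - q) = \<zero>\<^bsub>V\<^esub>" using that ev_closed[of q] by (simp add: V.combination_diff[OF id] a_minus_def V.M.r_neg)
    then have "f (p - q) = 0" using that by (intro fK) simp
    then show ?thesis by (simp add: f.diff)
  qed
  have "linear_map V (free_space (carrier V)) j"
  proof (rule linear_mapI)
    fix v v' assume v: "v \<in> carrier V" "v' \<in> carrier V"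
    have "f (basis (v \<oplus>\<^bsub>V\<^esub> v')) = f (basis v + basis v')"
      by (rule ker) (use v in \<open>simp_all add: ev_add\<close>)
    then show "j (v \<oplus>\<^bsub>V\<^esub> v') = j v \<oplus>\<^bsub>free_space (carrier V)\<^esub> j v'" by (simp add: j_def f.add)
  next
    fix c v assume v: "v \<in> carrier V"
    have "f (basis (c \<odot>\<^bsub>V\<^esub> v)) = f (scale c (basis v))"
      by (rule ker) (use v in \<open>simp_all add: ev_scale\<close>)
    then show "j (c \<odot>\<^bsub>V\<^esub> v) = c \<odot>\<^bsub>free_space (carrier V)\<^esub> j v" by (simp add: j_def f.scale)
  qed (use fkeys in \<open>auto simp: j_def\<close>)
  moreover have "\<forall>v\<in>carrier V. ?ev (j v) = v" by (auto simp: j_def evf)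
  ultimately show ?thesis by blast
qed

lemma functional_lookup: "functional (free_space B) (\<lambda>p. lookup p x)"
  by (rule linear_mapI) (auto simp: lookup_add)

text \<open>
  Identities between vectors are proved below by testing with functionals, which turns them into
  identities between complex numbers; coordinates of a linear section suffice as functionals.
\<close>

lemma functionals_separate:
  assumes "complex_space V" "v \<in> carrier V" "w \<in> carrier V"
    and "\<And>l. functional V l \<Longrightarrow> l v = l w"
  shows "v = w"
proof -
  obtain j where j: "linear_map V (free_space (carrier V)) j"
    "\<forall>v\<in>carrier V. combination V (\<lambda>x. x) (j v) = v"
    using exists_linear_section[OF assms(1)] by blast
  have "j v = j w"
    by (rule poly_mapping_eqI) (rule assms(4), rule linear_map_comp[OF j(1) functional_lookup])
  then show ?thesis using j(2) assms(2,3) by metis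
qed

section \<open>Spaces given by generators and relations\<close>

text \<open>
  The canonical projection onto the quotient, with the coset written out as an image.
\<close>

definition residue :: "'x set \<Rightarrow> ('x \<Rightarrow>\<^sub>0 complex) set \<Rightarrow> ('x \<Rightarrow>\<^sub>0 complex) \<Rightarrow> ('x \<Rightarrow>\<^sub>0 complex) set"
  where "residue B R p = (\<lambda>n. n + p) ` module_span (free_space B) R"

text \<open>
  Additive inverses are multiples by \<open>-1\<close>.
\<close>

lemma submodule_free_space_iff:
  "submodule W complex_ring (free_space B) \<longleftrightarrow>
    W \<subseteq> {p. keys p \<subseteq> B} \<and> 0 \<in> W \<and> (\<forall>p\<in>W. \<forall>q\<in>W. p + q \<in> W) \<and> (\<forall>c. \<forall>p\<in>W. scale c p \<in> W)"
  (is "?L \<longleftrightarrow> ?R")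
proof
  interpret complex_space "free_space B" by (rule complex_space_free_space)
  show ?R if ?L
  proof -
    interpret submodule W complex_ring "free_space B" by fact
    have "0 \<in> W" using one_closed by simp
    moreover have "p + q \<in> W" if "p \<in> W" "q \<in> W" for p q using m_closed that by simp
    moreover have "scale c p \<in> W" if "p \<in> W" for c p using smult_closed[of c p] that by simp
    ultimately show ?thesis using subset by auto
  qed
  show ?L if R: ?R
  proof (rule submoduleI)
    fix a assume a: "a \<in> W"
    then have "a \<in> carrier (free_space B)" using R by auto
    then have "\<ominus>\<^bsub>free_space B\<^esub> a = scale (-1) a" using minus_eq_smult[of a] by simp
    moreover have "scale (-1) a \<in> W" using R a by blast
    ultimately show "\<ominus>\<^bsub>free_space B\<^esub> a \<in> W" by metis
  qed (use R in auto)
qed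

lemma presented_module_simps:
  "\<zero>\<^bsub>presented_module B R F\<^esub> = module_span (free_space B) R"
  "carrier (presented_module B R F) = residue B R ` {p. keys p \<subseteq> B}"
  by (auto simp: presented_module_def Let_def A_RCOSETS_def' a_r_coset_def' residue_def)

locale presentation =
  fixes B :: "'x set" and R :: "('x \<Rightarrow>\<^sub>0 complex) set"
  assumes relations_keys: "r \<in> R \<Longrightarrow> keys r \<subseteq> B"
begin

abbreviation "N \<equiv> module_span (free_space B) R"

lemma N_induct [consumes 1, case_names rel zero add scale]:
  assumes "n \<in> N" "\<And>r. r \<in> R \<Longrightarrow> P r" "P 0" "\<And>p q. P p \<Longrightarrow> P q \<Longrightarrow> P (p + q)"
    "\<And>c p. P p \<Longrightarrow> P (scale c p)"
  shows "P n"
proof -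
  have "submodule {p. keys p \<subseteq> B \<and> P p} complex_ring (free_space B)"
    using assms(3-5) by (auto simp: submodule_free_space_iff subsetD[OF keys_add_subset] subsetD[OF keys_scale_subset])
  then have "N \<subseteq> {p. keys p \<subseteq> B \<and> P p}"
    unfolding module_span_def using assms(2) relations_keys by blast
  then show ?thesis using assms(1) by auto
qed

lemma N_rel: "r \<in> R \<Longrightarrow> r \<in> N"
  by (auto simp: module_span_def)

lemma N_zero [simp]: "0 \<in> N"
  and N_add: "p \<in> N \<Longrightarrow> q \<in> N \<Longrightarrow> p + q \<in> N"
  and N_scale: "p \<in> N \<Longrightarrow> scale c p \<in> N"
  by (auto simp: module_span_def submodule_free_space_iff)

lemma N_uminus: "p \<in> N \<Longrightarrow> - p \<in> N"
  using N_scale[of p "-1"] by (simp add: scale_minus_one)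

lemma N_diff: "p \<in> N \<Longrightarrow> q \<in> N \<Longrightarrow> p - q \<in> N"
  using N_add[of p "- q"] N_uminus by simp

lemma N_sum: "(\<And>i. i \<in> S \<Longrightarrow> f i \<in> N) \<Longrightarrow> (\<Sum>i\<in>S. f i) \<in> N"
  by (induction S rule: infinite_finite_induct) (auto intro: N_add)

lemma residue_eq_iff: "residue B R p = residue B R q \<longleftrightarrow> p - q \<in> N"
proof
  assume "residue B R p = residue B R q"
  then have "p \<in> residue B R q" unfolding residue_def by (metis N_zero add_0 image_iff)
  then obtain n where "n \<in> N" "p = n + q" unfolding residue_def by blast
  then show "p - q \<in> N" by simp
next
  assume pq: "p - q \<in> N"
  have "\<exists>m\<in>N. n + p = m + q" "\<exists>m\<in>N. n + q = m + p" if "n \<in> N" for n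
  proof -
    have "n + p = (n + (p - q)) + q" "n + q = (n - (p - q)) + p" by simp_all
    then show "\<exists>m\<in>N. n + p = m + q" "\<exists>m\<in>N. n + q = m + p"
      using N_add[OF that pq] N_diff[OF that pq] by blast+
  qed
  then show "residue B R p = residue B R q" unfolding residue_def by blast
qed

lemma residue_eq_zero: "n \<in> N \<Longrightarrow> residue B R n = residue B R 0"
  by (simp add: residue_eq_iff)

lemma residue_in_carrier [simp]: "keys p \<subseteq> B \<Longrightarrow> residue B R p \<in> carrier (presented_module B R F)"
  by (simp add: presented_module_simps)

lemma presented_zero: "\<zero>\<^bsub>presented_module B R F\<^esub> = residue B R 0"
  by (simp add: presented_module_simps residue_def)

lemma presented_add:
  "residue B R p \<oplus>\<^bsub>presented_module B R F\<^esub> residue B R q = residue B R (p + q)"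
proof -
  have "(\<exists>h\<in>N. \<exists>k\<in>N. x = h + p + (k + q)) \<longleftrightarrow> (\<exists>n\<in>N. x = n + (p + q))" for x
  proof
    assume "\<exists>h\<in>N. \<exists>k\<in>N. x = h + p + (k + q)"
    then obtain h k where "h \<in> N" "k \<in> N" "x = (h + k) + (p + q)" by (auto simp: algebra_simps)
    then show "\<exists>n\<in>N. x = n + (p + q)" using N_add by blast
  next
    assume "\<exists>n\<in>N. x = n + (p + q)"
    then obtain n where "n \<in> N" "x = n + p + (0 + q)" by (auto simp: algebra_simps)
    then show "\<exists>h\<in>N. \<exists>k\<in>N. x = h + p + (k + q)" using N_zero by blast
  qed
  then show ?thesis
    by (auto simp: presented_module_def Let_def residue_def set_add_def' set_eq_iff)
qed

text \<open>
  The operations of a presented module add the relation space to an image of a coset; for an additive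
  map preserving that space this yields again a coset.
\<close>

lemma span_add_image:
  assumes "\<And>p q. h (p + q) = h p + h q" "\<And>n. n \<in> N \<Longrightarrow> h n \<in> N"
  shows "N <+>\<^bsub>free_space B\<^esub> (h ` residue B R p) = residue B R (h p)"
proof -
  have "(\<exists>m\<in>N. \<exists>n\<in>N. x = m + h (n + p)) \<longleftrightarrow> (\<exists>n\<in>N. x = n + h p)" for x
  proof
    assume "\<exists>m\<in>N. \<exists>n\<in>N. x = m + h (n + p)"
    then obtain m n where "m \<in> N" "n \<in> N" "x = (m + h n) + h p" by (auto simp: assms(1) algebra_simps)
    then show "\<exists>n\<in>N. x = n + h p" using N_add assms(2) by blast
  next
    assume "\<exists>n\<in>N. x = n + h p"
    then obtain n where "n \<in> N" "x = n + h (0 + p)" by auto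
    then show "\<exists>m\<in>N. \<exists>n\<in>N. x = m + h (n + p)" using N_zero by blast
  qed
  then show ?thesis
    by (auto simp: residue_def set_add_def' set_eq_iff)
qed

lemma presented_smult:
  "c \<odot>\<^bsub>presented_module B R F\<^esub> residue B R p = residue B R (scale c p)"
  using span_add_image[of "scale c" p]
  by (simp add: fs.scale_right_distrib N_scale presented_module_def Let_def)

lemma presented_act:
  assumes "\<And>b. b \<in> B \<Longrightarrow> keys (F g b) \<subseteq> B" "\<And>r. r \<in> R \<Longrightarrow> linear_extension (F g) r \<in> N"
  shows "act (presented_module B R F) g (residue B R p) = residue B R (linear_extension (F g) p)"
proof -
  have "linear_extension (F g) n \<in> N" if "n \<in> N" for n
    using that by (induction rule: N_induct)
      (simp_all add: assms N_add N_scale linear_extension_add linear_extension_scale)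
  then show ?thesis
    using span_add_image[of "linear_extension (F g)" p]
    by (simp add: linear_extension_add presented_module_def Let_def)
qed

lemma carrier_cases:
  assumes "z \<in> carrier (presented_module B R F)"
  obtains p where "keys p \<subseteq> B" "z = residue B R p"
  using assms by (auto simp: presented_module_simps)

lemma complex_space_presented: "complex_space (presented_module B R F)"
proof (rule complex_spaceI)
  show "\<zero>\<^bsub>presented_module B R F\<^esub> \<in> carrier (presented_module B R F)"
    by (simp add: presented_zero)
qed (auto elim!: carrier_cases simp: presented_add presented_smult presented_zero
    fs.scale_left_distrib fs.scale_right_distrib algebra_simps)

lemma linear_map_residue: "linear_map (free_space B) (presented_module B R F) (residue B R)"
  by (rule linear_mapI) (simp_all add: presented_add presented_smult)

lemma presented_induct [consumes 1, case_names basis add zero scale]: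
  assumes "z \<in> carrier (presented_module B R F)"
    and "\<And>x. x \<in> B \<Longrightarrow> P (residue B R (basis x))"
    and "\<And>y z. y \<in> carrier (presented_module B R F) \<Longrightarrow> z \<in> carrier (presented_module B R F) \<Longrightarrow>
      P y \<Longrightarrow> P z \<Longrightarrow> P (y \<oplus>\<^bsub>presented_module B R F\<^esub> z)"
    and "P \<zero>\<^bsub>presented_module B R F\<^esub>"
    and "\<And>c z. z \<in> carrier (presented_module B R F) \<Longrightarrow> P z \<Longrightarrow> P (c \<odot>\<^bsub>presented_module B R F\<^esub> z)"
  shows "P z"
proof -
  obtain p where "keys p \<subseteq> B" and z: "z = residue B R p" using assms(1) by (rule carrier_cases)
  from this(1) have "P (residue B R p)"
  proof (induction p rule: free_induct)
    case (add p q)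
    then show ?case
      using assms(3)[of "residue B R p" "residue B R q"] by (simp add: presented_add)
  next
    case (scale c p)
    then show ?case
      using assms(5)[of "residue B R p" c] by (simp add: presented_smult)
  qed (use assms(2,4) in \<open>simp_all add: presented_zero\<close>)
  then show ?thesis using z by simp
qed

lemma linear_map_eqI:
  assumes "linear_map (presented_module B R F) V f" "linear_map (presented_module B R F) V g"
    and "complex_space V"
    and "\<And>b. b \<in> B \<Longrightarrow> f (residue B R (basis b)) = g (residue B R (basis b))"
    and "z \<in> carrier (presented_module B R F)"
  shows "f z = g z"
  using assms(5)
proof (induction rule: presented_induct)
  case zero
  show ?case
    using linear_map_zero[OF assms(1) complex_space_presented assms(3)]
      linear_map_zero[OF assms(2) complex_space_presented assms(3)] by simp
qed (use linear_mapD(2,3)[OF assms(1)] linear_mapD(2,3)[OF assms(2)] assms(4) in simp_all)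

text \<open>
  The universal property of a presentation: a map on generators that respects the relations kills
  their span, so its value does not depend on the representative, which may then be picked by
  choice.
\<close>

lemma exists_linear_map:
  assumes "complex_space V" "f \<in> B \<rightarrow> carrier V" "\<And>r. r \<in> R \<Longrightarrow> combination V f r = \<zero>\<^bsub>V\<^esub>"
  shows "\<exists>h. linear_map (presented_module B R F) V h \<and>
    (\<forall>p. keys p \<subseteq> B \<longrightarrow> h (residue B R p) = combination V f p)"
proof -
  interpret V: complex_space V by fact
  have N: "keys n \<subseteq> B \<and> combination V f n = \<zero>\<^bsub>V\<^esub>" if "n \<in> N" for n
    using that by (induction rule: N_induct)
      (simp_all add: assms(3) relations_keys V.combination_add[OF assms(2)] V.combination_scale[OF assms(2)])
  define h where "h z = combination V f (SOME p. keys p \<subseteq> B \<and> z = residue B R p)" for z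
  have h: "h (residue B R p) = combination V f p" if p: "keys p \<subseteq> B" for p
  proof -
    define q where "q = (SOME q. keys q \<subseteq> B \<and> residue B R p = residue B R q)"
    have q: "keys q \<subseteq> B" "residue B R p = residue B R q"
      using someI[of "\<lambda>q. keys q \<subseteq> B \<and> residue B R p = residue B R q" p] p by (auto simp: q_def)
    have "p = (p - q) + q" by simp
    then have "combination V f p = combination V f (p - q) \<oplus>\<^bsub>V\<^esub> combination V f q"
      using V.combination_add[OF assms(2), of "p - q" q] p q by simp
    also have "\<dots> = combination V f q"
      using N[of "p - q"] q V.combination_closed[OF V.subset_funcset[OF assms(2) q(1)]]
      by (simp add: residue_eq_iff)
    finally show ?thesis by (simp add: h_def q_def)
  qed
  have "linear_map (presented_module B R F) V h"
    by (rule linear_mapI; elim carrier_cases)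
      (simp_all add: h presented_add presented_smult V.combination_add[OF assms(2)] V.combination_scale[OF assms(2)]
        V.combination_closed[OF V.subset_funcset[OF assms(2)]])
  then show ?thesis using h by blast
qed

end

subsection \<open>Isomorphisms\<close>

lemma isomorphicI:
  assumes "linear_map V W f" "linear_map W V g"
    and "\<And>v. v \<in> carrier V \<Longrightarrow> g (f v) = v" "\<And>w. w \<in> carrier W \<Longrightarrow> f (g w) = w"
    and "\<And>x v. x \<in> carrier G \<Longrightarrow> v \<in> carrier V \<Longrightarrow> f (act V x v) = act W x (f v)"
  shows "lie_module_isomorphic G V W"
proof -
  have "bij_betw f (carrier V) (carrier W)"
    by (rule bij_betw_byWitness[of _ g])
      (use assms(3,4) linear_mapD(1)[OF assms(1)] linear_mapD(1)[OF assms(2)] in auto)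
  then show ?thesis
    unfolding lie_module_isomorphic_def using assms(1,5) by (auto simp: linear_map_def intro!: exI[of _ f])
qed

lemma isomorphicE:
  assumes "lie_module_isomorphic G V W"
    and "\<And>x v. x \<in> carrier G \<Longrightarrow> v \<in> carrier V \<Longrightarrow> act V x v \<in> carrier V"
    and "complex_space V"
  obtains f g where "linear_map V W f" "linear_map W V g"
    "\<And>v. v \<in> carrier V \<Longrightarrow> g (f v) = v" "\<And>w. w \<in> carrier W \<Longrightarrow> f (g w) = w"
    "\<And>x v. x \<in> carrier G \<Longrightarrow> v \<in> carrier V \<Longrightarrow> f (act V x v) = act W x (f v)"
    "\<And>x w. x \<in> carrier G \<Longrightarrow> w \<in> carrier W \<Longrightarrow> g (act W x w) = act V x (g w)"
proof -
  interpret V: complex_space V by fact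
  obtain f where f: "bij_betw f (carrier V) (carrier W)"
      "\<And>v v'. v \<in> carrier V \<Longrightarrow> v' \<in> carrier V \<Longrightarrow> f (v \<oplus>\<^bsub>V\<^esub> v') = f v \<oplus>\<^bsub>W\<^esub> f v'"
      "\<And>c v. v \<in> carrier V \<Longrightarrow> f (c \<odot>\<^bsub>V\<^esub> v) = c \<odot>\<^bsub>W\<^esub> f v"
      "\<And>x v. x \<in> carrier G \<Longrightarrow> v \<in> carrier V \<Longrightarrow> f (act V x v) = act W x (f v)"
    using assms(1) unfolding lie_module_isomorphic_def by blast
  define g where "g = inv_into (carrier V) f"
  have gc: "g w \<in> carrier V" "f (g w) = w" if "w \<in> carrier W" for w
    using f(1) that unfolding g_def by (auto simp: bij_betw_def inv_into_into f_inv_into_f)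
  have gf: "g (f v) = v" if "v \<in> carrier V" for v
    using f(1) that unfolding g_def by (auto simp: bij_betw_def)
  have fc: "f v \<in> carrier W" if "v \<in> carrier V" for v
    using f(1) that by (auto simp: bij_betw_def)
  show thesis
  proof (rule that[of f g])
    show "linear_map V W f" by (rule linear_mapI) (use f fc in auto)
    show "linear_map W V g"
    proof (rule linear_mapI)
      fix w w' assume w: "w \<in> carrier W" "w' \<in> carrier W"
      have "g (w \<oplus>\<^bsub>W\<^esub> w') = g (f (g w \<oplus>\<^bsub>V\<^esub> g w'))" using w f(2) gc by simp
      then show "g (w \<oplus>\<^bsub>W\<^esub> w') = g w \<oplus>\<^bsub>V\<^esub> g w'" using gf w gc by simp
    next
      fix c w assume w: "w \<in> carrier W"
      have "g (c \<odot>\<^bsub>W\<^esub> w) = g (f (c \<odot>\<^bsub>V\<^esub> g w))" using w f(3) gc by simp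
      then show "g (c \<odot>\<^bsub>W\<^esub> w) = c \<odot>\<^bsub>V\<^esub> g w" using gf w gc by simp
    qed (use gc in auto)
    fix x w assume x: "x \<in> carrier G" and w: "w \<in> carrier W"
    have "g (act W x w) = g (f (act V x (g w)))" using w x f(4) gc by simp
    then show "g (act W x w) = act V x (g w)" using gf gc x w assms(2) by simp
  qed (use f gc gf in auto)
qed

text \<open>
  The linear part of a module structure, which passes to presented modules, and so to tensor
  products, by inspection of the generators.
\<close>

definition acts_linearly :: "'g lie_algebra \<Rightarrow> ('g, 'v) lie_module \<Rightarrow> bool"
  where "acts_linearly G V \<longleftrightarrow> complex_space V \<and> (\<forall>x\<in>carrier G. linear_map V V (act V x))"

lemma acts_linearlyD:
  assumes "acts_linearly G V"
  shows "complex_space V" "x \<in> carrier G \<Longrightarrow> linear_map V V (act V x)"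
    and "x \<in> carrier G \<Longrightarrow> v \<in> carrier V \<Longrightarrow> act V x v \<in> carrier V"
  using assms by (auto simp: acts_linearly_def linear_map_def Pi_iff)

lemma isomorphic_inverse_maps:
  assumes "lie_module_isomorphic G V W" "acts_linearly G V"
  shows "\<exists>f g. linear_map V W f \<and> linear_map W V g \<and>
    (\<forall>v\<in>carrier V. g (f v) = v) \<and> (\<forall>w\<in>carrier W. f (g w) = w) \<and>
    (\<forall>x\<in>carrier G. \<forall>v\<in>carrier V. f (act V x v) = act W x (f v)) \<and>
    (\<forall>x\<in>carrier G. \<forall>w\<in>carrier W. g (act W x w) = act V x (g w))"
proof (rule isomorphicE[OF assms(1) _ acts_linearlyD(1)[OF assms(2)]])
  fix x v assume "x \<in> carrier G" "v \<in> carrier V"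
  then show "act V x v \<in> carrier V" by (rule acts_linearlyD(3)[OF assms(2)])
qed blast

lemma isomorphic_refl: "lie_module_isomorphic G V V"
  unfolding lie_module_isomorphic_def by (intro exI[of _ "\<lambda>v. v"]) (simp add: bij_betw_def inj_on_def)

lemma isomorphic_sym:
  assumes "acts_linearly G V" "lie_module_isomorphic G V W"
  shows "lie_module_isomorphic G W V"
proof -
  obtain f g where fg: "linear_map V W f" "linear_map W V g"
    "\<forall>z\<in>carrier V. g (f z) = z" "\<forall>z\<in>carrier W. f (g z) = z"
    "\<forall>x\<in>carrier G. \<forall>w\<in>carrier W. g (act W x w) = act V x (g w)"
    using isomorphic_inverse_maps[OF assms(2,1)] by (elim exE conjE) (rule that)
  show ?thesis by (rule isomorphicI[OF fg(2,1)]) (use fg in simp_all)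
qed

lemma isomorphic_trans:
  assumes "lie_module_isomorphic G U V" "lie_module_isomorphic G V W" "acts_linearly G U" "acts_linearly G V"
  shows "lie_module_isomorphic G U W"
proof -
  obtain f g where fg: "linear_map U V f" "linear_map V U g"
    "\<forall>z\<in>carrier U. g (f z) = z" "\<forall>z\<in>carrier V. f (g z) = z"
    "\<forall>x\<in>carrier G. \<forall>v\<in>carrier U. f (act U x v) = act V x (f v)"
    using isomorphic_inverse_maps[OF assms(1,3)] by (elim exE conjE) (rule that)
  obtain h k where hk: "linear_map V W h" "linear_map W V k"
    "\<forall>z\<in>carrier V. k (h z) = z" "\<forall>z\<in>carrier W. h (k z) = z"
    "\<forall>x\<in>carrier G. \<forall>v\<in>carrier V. h (act V x v) = act W x (h v)"
    using isomorphic_inverse_maps[OF assms(2,4)] by (elim exE conjE) (rule that)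
  show ?thesis
  proof (rule isomorphicI[OF linear_map_comp[OF fg(1) hk(1)] linear_map_comp[OF hk(2) fg(2)]])
    fix v assume v: "v \<in> carrier U"
    show "g (k (h (f v))) = v" using fg(3) hk(3) linear_mapD(1)[OF fg(1) v] v by simp
    fix x assume "x \<in> carrier G"
    then show "h (f (act U x v)) = act W x (h (f v))" using fg(5) hk(5) linear_mapD(1)[OF fg(1) v] v by simp
  next
    fix w assume w: "w \<in> carrier W"
    show "h (f (g (k w))) = w" using fg(4) hk(4) linear_mapD(1)[OF hk(2) w] w by simp
  qed
qed

text \<open>
  Mutually inverse maps between generators that respect the relations induce mutually inverse
  linear maps, which intertwine the actions as soon as they do so on generators.
\<close>

lemma presented_isomorphic:
  assumes "presentation B1 R1" "presentation B2 R2"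
    and "\<And>b. b \<in> B1 \<Longrightarrow> f b \<in> B2" "\<And>b. b \<in> B2 \<Longrightarrow> g b \<in> B1"
    and "\<And>b. b \<in> B1 \<Longrightarrow> g (f b) = b" "\<And>b. b \<in> B2 \<Longrightarrow> f (g b) = b"
    and "\<And>r. r \<in> R1 \<Longrightarrow> linear_extension (\<lambda>b. basis (f b)) r \<in> module_span (free_space B2) R2"
    and "\<And>r. r \<in> R2 \<Longrightarrow> linear_extension (\<lambda>b. basis (g b)) r \<in> module_span (free_space B1) R1"
    and "\<And>x b. x \<in> carrier G \<Longrightarrow> b \<in> B1 \<Longrightarrow> keys (F1 x b) \<subseteq> B1"
    and "\<And>x r. x \<in> carrier G \<Longrightarrow> r \<in> R1 \<Longrightarrow> linear_extension (F1 x) r \<in> module_span (free_space B1) R1"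
    and "\<And>x b. x \<in> carrier G \<Longrightarrow> b \<in> B2 \<Longrightarrow> keys (F2 x b) \<subseteq> B2"
    and "\<And>x r. x \<in> carrier G \<Longrightarrow> r \<in> R2 \<Longrightarrow> linear_extension (F2 x) r \<in> module_span (free_space B2) R2"
    and "\<And>x b. x \<in> carrier G \<Longrightarrow> b \<in> B1 \<Longrightarrow> linear_extension (\<lambda>b. basis (f b)) (F1 x b) = F2 x (f b)"
  shows "lie_module_isomorphic G (presented_module B1 R1 F1) (presented_module B2 R2 F2)"
proof -
  interpret P1: presentation B1 R1 by fact
  interpret P2: presentation B2 R2 by fact
  let ?P1 = "presented_module B1 R1 F1" and ?P2 = "presented_module B2 R2 F2"
  let ?f = "\<lambda>p. linear_extension (\<lambda>b. basis (f b)) p" and ?g = "\<lambda>p. linear_extension (\<lambda>b. basis (g b)) p"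
  have comb: "combination (presented_module B R F) (\<lambda>b. residue B R (basis (h b))) p =
      residue B R (linear_extension (\<lambda>b. basis (h b)) p)"
    if "presentation B R" "\<And>b. b \<in> A \<Longrightarrow> h b \<in> B" "keys p \<subseteq> A"
    for A :: "'y set" and B :: "'z set" and R h p and F :: "'w \<Rightarrow> 'z \<Rightarrow> 'z \<Rightarrow>\<^sub>0 complex"
  proof -
    interpret presentation B R by fact
    have "linear_map (free_space A) (presented_module B R F)
        (\<lambda>p. residue B R (linear_extension (\<lambda>b. basis (h b)) p))"
      by (rule linear_map_comp[OF linear_map_linear_extension linear_map_residue]) (use that in simp)
    from complex_space.combination_unique[OF complex_space_presented this that(3)]
    show ?thesis by simp
  qed
  have comb1: "combination ?P2 (\<lambda>b. residue B2 R2 (basis (f b))) p = residue B2 R2 (?f p)"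
    if "keys p \<subseteq> B1" for p
    by (rule comb[OF assms(2) assms(3) that])
  have comb2: "combination ?P1 (\<lambda>b. residue B1 R1 (basis (g b))) p = residue B1 R1 (?g p)"
    if "keys p \<subseteq> B2" for p
    by (rule comb[OF assms(1) assms(4) that])
  have ex: "\<exists>h. linear_map ?P1 ?P2 h \<and> (\<forall>p. keys p \<subseteq> B1 \<longrightarrow>
      h (residue B1 R1 p) = combination ?P2 (\<lambda>b. residue B2 R2 (basis (f b))) p)"
  proof (rule P1.exists_linear_map[OF P2.complex_space_presented])
    fix r assume "r \<in> R1"
    then show "combination ?P2 (\<lambda>b. residue B2 R2 (basis (f b))) r = \<zero>\<^bsub>?P2\<^esub>"
      using comb1[OF P1.relations_keys] assms(7)[of r] P2.residue_eq_zero
      by (simp only: P2.presented_zero)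
  qed (simp add: assms(3))
  have ex': "\<exists>h. linear_map ?P2 ?P1 h \<and> (\<forall>p. keys p \<subseteq> B2 \<longrightarrow>
      h (residue B2 R2 p) = combination ?P1 (\<lambda>b. residue B1 R1 (basis (g b))) p)"
  proof (rule P2.exists_linear_map[OF P1.complex_space_presented])
    fix r assume "r \<in> R2"
    then show "combination ?P1 (\<lambda>b. residue B1 R1 (basis (g b))) r = \<zero>\<^bsub>?P1\<^esub>"
      using comb2[OF P2.relations_keys] assms(8)[of r] P1.residue_eq_zero
      by (simp only: P1.presented_zero)
  qed (simp add: assms(4))
  obtain h where h: "linear_map ?P1 ?P2 h" "\<And>p. keys p \<subseteq> B1 \<Longrightarrow> h (residue B1 R1 p) = residue B2 R2 (?f p)"
    using ex comb1 by metis
  obtain k where k: "linear_map ?P2 ?P1 k" "\<And>p. keys p \<subseteq> B2 \<Longrightarrow> k (residue B2 R2 p) = residue B1 R1 (?g p)"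
    using ex' comb2 by metis
  have fk: "keys (?f p) \<subseteq> B2" if "keys p \<subseteq> B1" for p
    by (rule keys_linear_extension) (use that assms(3) in auto)
  have gk: "keys (?g p) \<subseteq> B1" if "keys p \<subseteq> B2" for p
    by (rule keys_linear_extension) (use that assms(4) in auto)
  have gf: "?g (?f p) = p" if "keys p \<subseteq> B1" for p
  proof -
    have "?g (?f p) = linear_extension basis p"
      unfolding linear_extension_linear_extension
      by (rule linear_extension_cong) (use that assms(5) in auto)
    then show ?thesis by simp
  qed
  have fg: "?f (?g p) = p" if "keys p \<subseteq> B2" for p
  proof -
    have "?f (?g p) = linear_extension basis p"
      unfolding linear_extension_linear_extension
      by (rule linear_extension_cong) (use that assms(6) in auto)
    then show ?thesis by simp
  qed
  show ?thesis
  proof (rule isomorphicI[OF h(1) k(1)])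
    fix v assume "v \<in> carrier ?P1"
    then show "k (h v) = v" by (elim P1.carrier_cases) (simp add: h k fk gf)
  next
    fix w assume "w \<in> carrier ?P2"
    then show "h (k w) = w" by (elim P2.carrier_cases) (simp add: h k gk fg)
  next
    fix x v assume x: "x \<in> carrier G" and "v \<in> carrier ?P1"
    then obtain p where p: "keys p \<subseteq> B1" "v = residue B1 R1 p" by (elim P1.carrier_cases)
    have "?f (linear_extension (F1 x) p) = linear_extension (F2 x) (?f p)"
      unfolding linear_extension_linear_extension
      by (rule linear_extension_cong) (use p assms(13)[OF x] in auto)
    moreover have "keys (linear_extension (F1 x) p) \<subseteq> B1"
      by (rule keys_linear_extension) (use p assms(9)[OF x] in auto)
    ultimately show "h (act ?P1 x v) = act ?P2 x (h v)"
      by (simp add: p h P1.presented_act[of F1 x, OF assms(9)[OF x] assms(10)[OF x]]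
          P2.presented_act[of F2 x, OF assms(11)[OF x] assms(12)[OF x]])
  qed
qed

section \<open>Exponential polynomials\<close>

text \<open>
  The operator sending a sequence \<open>f\<close> to \<open>f (k + 1) - \<nu>0 * f k\<close>
  lowers the degree of the polynomial factor at \<open>\<nu>0\<close> and sends no other nonzero
  factor to zero. Repeating it removes \<open>\<nu>0\<close>, which gives an induction on the set
  of frequencies.
\<close>

lemma exponential_polynomial_zero:
  fixes P :: "complex \<Rightarrow> complex poly"
  assumes "finite S" "0 \<notin> S" "\<And>k. k \<ge> K \<Longrightarrow> (\<Sum>\<nu>\<in>S. poly (P \<nu>) (of_nat k) * \<nu> ^ k) = 0" "\<nu> \<in> S"
  shows "P \<nu> = 0"
  using assms
proof (induction S arbitrary: P K \<nu> rule: finite_induct)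
  case (insert \<nu>0 S)
  have step: "\<forall>\<nu>\<in>insert \<nu>0 S. P \<nu> = 0"
    if "P \<nu>0 = 0 \<or> degree (P \<nu>0) < n"
      "\<And>k. k \<ge> K \<Longrightarrow> (\<Sum>\<nu>\<in>insert \<nu>0 S. poly (P \<nu>) (of_nat k) * \<nu> ^ k) = 0" for n P K
    using that
  proof (induction n arbitrary: P K)
    case 0
    then have "(\<Sum>\<nu>\<in>S. poly (P \<nu>) (of_nat k) * \<nu> ^ k) = 0" if "k \<ge> K" for k
      using that insert.hyps by simp
    then have "P \<nu> = 0" if "\<nu> \<in> S" for \<nu>
      using insert.IH[of K P \<nu>] that insert.prems(1) by blast
    then show ?case using 0 by auto
  next
    case (Suc n)
    \<comment> \<open>the factors after applying \<open>f \<mapsto> (\<lambda>k. f (k + 1) - \<nu>0 * f k)\<close>\<close>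
    define Q where "Q \<nu> = smult \<nu> (pcompose (P \<nu>) [:1, 1:]) - smult \<nu>0 (P \<nu>)" for \<nu>
    have lead: "coeff (Q \<nu>) (degree (P \<nu>)) = (\<nu> - \<nu>0) * lead_coeff (P \<nu>)" for \<nu>
      using lead_coeff_comp[of "[:1, 1::complex:]" "P \<nu>"] by (simp add: Q_def degree_pcompose left_diff_distrib)
    have deg: "degree (Q \<nu>) \<le> degree (P \<nu>)" for \<nu>
      unfolding Q_def by (rule degree_diff_le) (simp_all add: degree_smult_le degree_pcompose)
    have "\<forall>\<nu>\<in>insert \<nu>0 S. Q \<nu> = 0"
    proof (rule Suc.IH)
      show "Q \<nu>0 = 0 \<or> degree (Q \<nu>0) < n"
      proof (cases "P \<nu>0 = 0")
        case True
        then show ?thesis by (simp add: Q_def)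
      next
        case False
        have "Q \<nu>0 = 0 \<or> degree (Q \<nu>0) < degree (P \<nu>0)"
          by (rule eq_zero_or_degree_less[OF deg]) (simp add: lead)
        then show ?thesis using Suc.prems(1) False by linarith
      qed
      fix k assume k: "k \<ge> K"
      have "(\<Sum>\<nu>\<in>insert \<nu>0 S. poly (Q \<nu>) (of_nat k) * \<nu> ^ k) =
          (\<Sum>\<nu>\<in>insert \<nu>0 S. poly (P \<nu>) (of_nat (Suc k)) * \<nu> ^ Suc k - \<nu>0 * (poly (P \<nu>) (of_nat k) * \<nu> ^ k))"
        by (rule sum.cong) (simp_all add: Q_def poly_pcompose algebra_simps)
      also have "\<dots> = 0"
        using Suc.prems(2)[of k] Suc.prems(2)[of "Suc k"] k
        by (simp only: sum_subtractf sum_distrib_left[symmetric]) simp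
      finally show "(\<Sum>\<nu>\<in>insert \<nu>0 S. poly (Q \<nu>) (of_nat k) * \<nu> ^ k) = 0" .
    qed
    then have S: "P \<nu> = 0" if "\<nu> \<in> S" for \<nu>
      using lead[of \<nu>] that insert.hyps(2) by auto
    then have root: "poly (P \<nu>0) (of_nat k) = 0" if "k \<ge> K" for k
      using Suc.prems(2)[OF that] insert.hyps insert.prems(1) by simp
    have "P \<nu>0 = 0"
    proof (rule ccontr)
      assume "P \<nu>0 \<noteq> 0"
      then have "finite {x. poly (P \<nu>0) x = 0}" by (rule poly_roots_finite)
      then have "finite (of_nat ` {K..} :: complex set)"
        by (rule rev_finite_subset) (use root in auto)
      then have "finite {K..}" by (rule finite_imageD) (simp add: inj_on_def)
      then show False using infinite_Ici by blast
    qed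
    then show ?case using S by auto
  qed
  show ?case
    using step[of P "Suc (degree (P \<nu>0))" K] insert.prems by blast
qed simp

text \<open>
  The coefficients \<open>s \<nu> j\<close> are a function on all pairs, vanishing outside a
  finite set, so that expansions with different frequencies can be added and compared.
\<close>

definition exponential_expansion :: "(nat \<Rightarrow> complex) \<Rightarrow> (complex \<Rightarrow> nat \<Rightarrow> complex) \<Rightarrow> bool"
  where "exponential_expansion u s \<longleftrightarrow> (\<exists>K S D. finite S \<and> 0 \<notin> S \<and>
    (\<forall>\<nu> j. s \<nu> j \<noteq> 0 \<longrightarrow> \<nu> \<in> S \<and> j \<le> D) \<and>
    (\<forall>k\<ge>K. u k = (\<Sum>\<nu>\<in>S. \<Sum>j\<le>D. s \<nu> j * of_nat k ^ j * \<nu> ^ k)))"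

lemma exponential_sum_superset:
  fixes s :: "complex \<Rightarrow> nat \<Rightarrow> complex"
  assumes "finite S'" "S \<subseteq> S'" "D \<le> D'" "\<And>\<nu> j. s \<nu> j \<noteq> 0 \<Longrightarrow> \<nu> \<in> S \<and> j \<le> D"
  shows "(\<Sum>\<nu>\<in>S. \<Sum>j\<le>D. s \<nu> j * of_nat k ^ j * \<nu> ^ k) = (\<Sum>\<nu>\<in>S'. \<Sum>j\<le>D'. s \<nu> j * of_nat k ^ j * \<nu> ^ k)"
proof -
  have "(\<Sum>\<nu>\<in>S. \<Sum>j\<le>D. s \<nu> j * of_nat k ^ j * \<nu> ^ k) = (\<Sum>\<nu>\<in>S. \<Sum>j\<le>D'. s \<nu> j * of_nat k ^ j * \<nu> ^ k)"
    by (intro sum.cong sum.mono_neutral_left) (use assms in auto)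
  also have "\<dots> = (\<Sum>\<nu>\<in>S'. \<Sum>j\<le>D'. s \<nu> j * of_nat k ^ j * \<nu> ^ k)"
    by (rule sum.mono_neutral_left) (use assms in \<open>auto intro!: sum.neutral\<close>)
  finally show ?thesis .
qed

lemma exponential_expansion_add:
  assumes "exponential_expansion u s" "exponential_expansion u' s'"
  shows "exponential_expansion (\<lambda>k. u k + u' k) (\<lambda>\<nu> j. s \<nu> j + s' \<nu> j)"
proof -
  obtain K S D where 1: "finite S" "0 \<notin> S" "\<And>\<nu> j. s \<nu> j \<noteq> 0 \<Longrightarrow> \<nu> \<in> S \<and> j \<le> D"
      "\<And>k. k \<ge> K \<Longrightarrow> u k = (\<Sum>\<nu>\<in>S. \<Sum>j\<le>D. s \<nu> j * of_nat k ^ j * \<nu> ^ k)"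
    using assms(1) unfolding exponential_expansion_def by blast
  obtain K' S' D' where 2: "finite S'" "0 \<notin> S'" "\<And>\<nu> j. s' \<nu> j \<noteq> 0 \<Longrightarrow> \<nu> \<in> S' \<and> j \<le> D'"
      "\<And>k. k \<ge> K' \<Longrightarrow> u' k = (\<Sum>\<nu>\<in>S'. \<Sum>j\<le>D'. s' \<nu> j * of_nat k ^ j * \<nu> ^ k)"
    using assms(2) unfolding exponential_expansion_def by blast
  let ?S = "S \<union> S'" and ?D = "max D D'"
  have "u k + u' k = (\<Sum>\<nu>\<in>?S. \<Sum>j\<le>?D. (s \<nu> j + s' \<nu> j) * of_nat k ^ j * \<nu> ^ k)"
    if "k \<ge> max K K'" for k
  proof -
    have "u k = (\<Sum>\<nu>\<in>?S. \<Sum>j\<le>?D. s \<nu> j * of_nat k ^ j * \<nu> ^ k)"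
      using exponential_sum_superset[of ?S S D ?D s k] 1 2(1) that by auto
    moreover have "u' k = (\<Sum>\<nu>\<in>?S. \<Sum>j\<le>?D. s' \<nu> j * of_nat k ^ j * \<nu> ^ k)"
      using exponential_sum_superset[of ?S S' D' ?D s' k] 2 1(1) that by auto
    ultimately show ?thesis by (simp add: sum.distrib[symmetric] distrib_right)
  qed
  moreover have "\<nu> \<in> ?S \<and> j \<le> ?D" if "s \<nu> j + s' \<nu> j \<noteq> 0" for \<nu> j
    using 1(3)[of \<nu> j] 2(3)[of \<nu> j] that by fastforce
  moreover have "finite ?S" "0 \<notin> ?S" using 1 2 by auto
  ultimately show ?thesis unfolding exponential_expansion_def by blast
qed

lemma exponential_expansion_scale:
  assumes "exponential_expansion u s"
  shows "exponential_expansion (\<lambda>k. c * u k) (\<lambda>\<nu> j. c * s \<nu> j)"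
proof -
  obtain K S D where 1: "finite S" "0 \<notin> S" "\<And>\<nu> j. s \<nu> j \<noteq> 0 \<Longrightarrow> \<nu> \<in> S \<and> j \<le> D"
      "\<And>k. k \<ge> K \<Longrightarrow> u k = (\<Sum>\<nu>\<in>S. \<Sum>j\<le>D. s \<nu> j * of_nat k ^ j * \<nu> ^ k)"
    using assms(1) unfolding exponential_expansion_def by blast
  then show ?thesis unfolding exponential_expansion_def
    by (intro exI[of _ K] exI[of _ S] exI[of _ D]) (auto simp: sum_distrib_left algebra_simps)
qed

lemma exponential_expansion_eventually_zero:
  "(\<And>k. k \<ge> K \<Longrightarrow> u k = 0) \<Longrightarrow> exponential_expansion u (\<lambda>_ _. 0)"
  unfolding exponential_expansion_def by (rule exI[of _ K], rule exI[of _ "{}"]) auto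

lemma exponential_expansion_term:
  assumes "\<mu> \<noteq> 0" "\<And>j. j > D \<Longrightarrow> t j = 0"
  shows "exponential_expansion (\<lambda>k. \<mu> ^ k * (\<Sum>j\<le>D. of_nat k ^ j * t j)) (\<lambda>\<nu> j. if \<nu> = \<mu> then t j else 0)"
  unfolding exponential_expansion_def
  by (rule exI[of _ 0], rule exI[of _ "{\<mu>}"], rule exI[of _ D])
    (use assms in \<open>auto simp: sum_distrib_left algebra_simps intro: leI\<close>)

lemma exponential_expansion_sum:
  assumes "finite J" "\<And>i. i \<in> J \<Longrightarrow> exponential_expansion (u i) (s i)"
  shows "exponential_expansion (\<lambda>k. \<Sum>i\<in>J. u i k) (\<lambda>\<nu> j. \<Sum>i\<in>J. s i \<nu> j)"
  using assms
proof (induction J rule: finite_induct)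
  case empty
  show ?case using exponential_expansion_eventually_zero[of 0 "\<lambda>_. 0"] by simp
next
  case (insert i J)
  then show ?case using exponential_expansion_add[of "u i" "s i"] by simp
qed

lemma exponential_expansion_unique:
  assumes "exponential_expansion u s" "exponential_expansion u s'"
  shows "s = s'"
proof -
  have "exponential_expansion (\<lambda>k. u k + (-1) * u k) (\<lambda>\<nu> j. s \<nu> j + (-1) * s' \<nu> j)"
    by (intro exponential_expansion_add exponential_expansion_scale assms)
  then obtain K S D where 1: "finite S" "0 \<notin> S" "\<And>\<nu> j. s \<nu> j + (-1) * s' \<nu> j \<noteq> 0 \<Longrightarrow> \<nu> \<in> S \<and> j \<le> D"
      "\<And>k. k \<ge> K \<Longrightarrow> u k + (-1) * u k = (\<Sum>\<nu>\<in>S. \<Sum>j\<le>D. (s \<nu> j + (-1) * s' \<nu> j) * of_nat k ^ j * \<nu> ^ k)"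
    unfolding exponential_expansion_def by blast
  define t where "t \<nu> j = s \<nu> j + (-1) * s' \<nu> j" for \<nu> j
  have t: "\<nu> \<in> S \<and> j \<le> D" if "t \<nu> j \<noteq> 0" for \<nu> j using 1(3) that unfolding t_def by blast
  define P where "P \<nu> = (\<Sum>j\<le>D. monom (t \<nu> j) j)" for \<nu>
  have coeff_P: "coeff (P \<nu>) j = t \<nu> j" for \<nu> j
  proof -
    have "coeff (P \<nu>) j = (if j \<le> D then t \<nu> j else 0)"
      by (simp add: P_def coeff_sum)
    then show ?thesis using t[of \<nu> j] by auto
  qed
  have "P \<nu> = 0" if "\<nu> \<in> S" for \<nu>
  proof (rule exponential_polynomial_zero[OF 1(1,2) _ that, of K])
    fix k assume "k \<ge> K"
    then show "(\<Sum>\<nu>\<in>S. poly (P \<nu>) (of_nat k) * \<nu> ^ k) = 0"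
      using 1(4)[of k] by (simp add: P_def poly_sum poly_monom t_def sum_distrib_right)
  qed
  then have "t \<nu> j = 0" for \<nu> j
    using t[of \<nu> j] coeff_P[of \<nu> j] by (cases "\<nu> \<in> S") auto
  then show ?thesis by (intro ext) (simp add: t_def add_eq_0_iff)
qed

subsection \<open>Shifted polynomials\<close>

lemma smult_sum_right: "Polynomial.smult c (\<Sum>i\<in>S. f i) = (\<Sum>i\<in>S. Polynomial.smult c (f i))"
  by (induction S rule: infinite_finite_induct) (auto simp: smult_add_right)

text \<open>
  Taylor expansion; only the coefficients of \<open>k ^ 0\<close> and \<open>k ^ 1\<close> need to
  be known explicitly.
\<close>

lemma shift_expansion:
  fixes p :: "complex poly"
  shows "\<exists>D t. t 0 = p \<and> t 1 = - pderiv p \<and> (\<forall>j>D. t j = 0) \<and>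
    (\<forall>k. pcompose p [:- of_nat k, 1:] = (\<Sum>j\<le>D. Polynomial.smult (of_nat k ^ j) (t j)))"
proof (induction p rule: pCons_induct)
  case 0
  show ?case by (rule exI[of _ 0], rule exI[of _ "\<lambda>_. 0"]) simp
next
  case (pCons a p)
  then obtain D t where t: "t 0 = p" "t 1 = - pderiv p" "\<And>j. j > D \<Longrightarrow> t j = 0"
    "\<And>k. pcompose p [:- of_nat k, 1:] = (\<Sum>j\<le>D. Polynomial.smult (of_nat k ^ j) (t j))" by blast
  \<comment> \<open>from \<open>(pCons a p)(\<partial> - k) = a + (\<partial> - k) p(\<partial> - k)\<close>\<close>
  define t' where "t' j = (if j = 0 then [:a:] else 0) + pCons 0 (t j) - (if j = 0 then 0 else t (j - 1))" for j
  have "pcompose (pCons a p) [:- of_nat k, 1:] = (\<Sum>j\<le>Suc D. Polynomial.smult (of_nat k ^ j) (t' j))" for k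
  proof -
    have "(\<Sum>j\<le>Suc D. Polynomial.smult (of_nat k ^ j) (t' j)) =
       (\<Sum>j\<le>Suc D. if j = 0 then [:a:] else 0) + (\<Sum>j\<le>Suc D. pCons 0 (Polynomial.smult (of_nat k ^ j) (t j))) -
       (\<Sum>j\<le>Suc D. if j = 0 then 0 else Polynomial.smult (of_nat k ^ j) (t (j - 1)))"
      unfolding sum.distrib[symmetric] sum_subtractf[symmetric]
      by (rule sum.cong) (auto simp: t'_def smult_add_right smult_diff_right)
    also have "(\<Sum>j\<le>Suc D. if j = 0 then [:a:] else 0) = [:a:]" by simp
    also have "(\<Sum>j\<le>Suc D. pCons 0 (Polynomial.smult (of_nat k ^ j) (t j))) = 
        [:0, 1:] * (\<Sum>j\<le>D. Polynomial.smult (of_nat k ^ j) (t j))"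
      by (simp add: t(3) sum_distrib_left)
    also have "(\<Sum>j\<le>Suc D. if j = 0 then 0 else Polynomial.smult (of_nat k ^ j) (t (j - 1))) =
        Polynomial.smult (of_nat k) (\<Sum>j\<le>D. Polynomial.smult (of_nat k ^ j) (t j))"
      by (subst sum.atMost_Suc_shift) (simp add: smult_sum_right)
    finally show ?thesis
      by (simp add: pcompose_pCons t(4) left_diff_distrib algebra_simps)
  qed
  moreover have "t' 0 = pCons a p" by (simp add: t'_def t(1))
  moreover have "t' 1 = - pderiv (pCons a p)" using t(1,2) by (simp add: t'_def pderiv_pCons)
  moreover have "\<forall>j>Suc D. t' j = 0" using t(3) by (simp add: t'_def)
  ultimately show ?case by blast
qed

text \<open>
  The first two coefficients are multiplication by the variable and the shifted Euler operator,
  from which the parameters of \<open>\<Omega>\<close> will be read off.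
\<close>

lemma shift_expansion_twisted:
  fixes p :: "complex poly"
  shows "\<exists>D t. t 0 = [:0, 1:] * p \<and> t 1 = Polynomial.smult a p - [:0, 1:] * pderiv p \<and> (\<forall>j>D. t j = 0) \<and>
    (\<forall>k. [:of_nat k * a, 1:] * pcompose p [:- of_nat k, 1:] = (\<Sum>j\<le>D. Polynomial.smult (of_nat k ^ j) (t j)))"
proof -
  obtain D t where t: "t 0 = p" "t 1 = - pderiv p" "\<And>j. j > D \<Longrightarrow> t j = 0"
    "\<And>k. pcompose p [:- of_nat k, 1:] = (\<Sum>j\<le>D. Polynomial.smult (of_nat k ^ j) (t j))"
    using shift_expansion[of p] by blast
  define t' where "t' j = [:0, 1:] * t j + (if j = 0 then 0 else Polynomial.smult a (t (j - 1)))" for j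
  have "[:of_nat k * a, 1:] * pcompose p [:- of_nat k, 1:] = (\<Sum>j\<le>Suc D. Polynomial.smult (of_nat k ^ j) (t' j))" for k
  proof -
    have "(\<Sum>j\<le>Suc D. Polynomial.smult (of_nat k ^ j) (t' j)) =
        (\<Sum>j\<le>Suc D. [:0, 1:] * Polynomial.smult (of_nat k ^ j) (t j)) +
        (\<Sum>j\<le>Suc D. if j = 0 then 0 else Polynomial.smult (of_nat k ^ j * a) (t (j - 1)))"
      unfolding sum.distrib[symmetric] by (rule sum.cong) (auto simp: t'_def smult_add_right)
    also have "(\<Sum>j\<le>Suc D. [:0, 1:] * Polynomial.smult (of_nat k ^ j) (t j)) = 
        [:0, 1:] * (\<Sum>j\<le>D. Polynomial.smult (of_nat k ^ j) (t j))"
      by (simp add: t(3) sum_distrib_left)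
    also have "(\<Sum>j\<le>Suc D. if j = 0 then 0 else Polynomial.smult (of_nat k ^ j * a) (t (j - 1))) =
        Polynomial.smult (of_nat k * a) (\<Sum>j\<le>D. Polynomial.smult (of_nat k ^ j) (t j))"
      by (subst sum.atMost_Suc_shift) (simp add: smult_sum_right mult_ac)
    finally show ?thesis by (simp add: t(4) algebra_simps)
  qed
  moreover have "t' 0 = [:0, 1:] * p" by (simp add: t'_def t(1))
  moreover have "t' 1 = Polynomial.smult a p - [:0, 1:] * pderiv p" using t(1,2) by (simp add: t'_def)
  moreover have "\<forall>j>Suc D. t' j = 0" using t(3) by (simp add: t'_def)
  ultimately show ?thesis by blast
qed

section \<open>Tensor products\<close>

text \<open>
  It suffices to look at generators and defining relations, because the vectors that a linear map
  sends into the span of the relations form a subspace.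
\<close>

lemma (in presentation) acts_linearly_presented:
  assumes "\<And>x b. x \<in> carrier G \<Longrightarrow> b \<in> B \<Longrightarrow> keys (F x b) \<subseteq> B"
    and "\<And>x r. x \<in> carrier G \<Longrightarrow> r \<in> R \<Longrightarrow> linear_extension (F x) r \<in> N"
  shows "acts_linearly G (presented_module B R F)"
  unfolding acts_linearly_def
proof (intro conjI ballI complex_space_presented)
  fix x assume x: "x \<in> carrier G"
  note act = presented_act[of F x, OF assms(1)[OF x] assms(2)[OF x]]
  show "linear_map (presented_module B R F) (presented_module B R F) (act (presented_module B R F) x)"
  proof (rule linear_mapI)
    fix v assume "v \<in> carrier (presented_module B R F)"
    then obtain p where p: "keys p \<subseteq> B" "v = residue B R p" by (rule carrier_cases)
    have "keys (linear_extension (F x) p) \<subseteq> B"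
      by (rule keys_linear_extension) (use p assms(1)[OF x] in auto)
    then show "act (presented_module B R F) x v \<in> carrier (presented_module B R F)"
      using act p by simp
  qed (auto elim!: carrier_cases simp: act presented_add presented_smult
      linear_extension_add linear_extension_scale)
qed

subsection \<open>Two factors\<close>

abbreviation tensor_span where
  "tensor_span V W \<equiv> module_span (free_space (carrier V \<times> carrier W)) (tensor_relations V W)"

abbreviation pure_tensor where
  "pure_tensor V W v w \<equiv> residue (carrier V \<times> carrier W) (tensor_relations V W) (basis (v, w))"

lemma presentation_tensor:
  assumes "complex_space V" "complex_space W"
  shows "presentation (carrier V \<times> carrier W) (tensor_relations V W)"
proof -
  interpret V: complex_space V by fact
  interpret W: complex_space W by fact
  show ?thesis
    by unfold_locales (auto simp: tensor_relations_def split: if_splits dest!: keys_minus[THEN subsetD] keys_scale[THEN subsetD])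
qed

lemma tensor_relationsI:
  shows "v \<in> carrier V \<Longrightarrow> v' \<in> carrier V \<Longrightarrow> w \<in> carrier W \<Longrightarrow>
      basis (v \<oplus>\<^bsub>V\<^esub> v', w) - basis (v, w) - basis (v', w) \<in> tensor_relations V W"
    and "v \<in> carrier V \<Longrightarrow> w \<in> carrier W \<Longrightarrow> w' \<in> carrier W \<Longrightarrow>
      basis (v, w \<oplus>\<^bsub>W\<^esub> w') - basis (v, w) - basis (v, w') \<in> tensor_relations V W"
    and "v \<in> carrier V \<Longrightarrow> w \<in> carrier W \<Longrightarrow>
      basis (c \<odot>\<^bsub>V\<^esub> v, w) - scale c (basis (v, w)) \<in> tensor_relations V W"
    and "v \<in> carrier V \<Longrightarrow> w \<in> carrier W \<Longrightarrow>
      basis (v, c \<odot>\<^bsub>W\<^esub> w) - scale c (basis (v, w)) \<in> tensor_relations V W"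
  unfolding tensor_relations_def by blast+

lemma tensor_spanI:
  assumes "complex_space V" "complex_space W"
  shows "v \<in> carrier V \<Longrightarrow> v' \<in> carrier V \<Longrightarrow> w \<in> carrier W \<Longrightarrow>
      basis (v \<oplus>\<^bsub>V\<^esub> v', w) - basis (v, w) - basis (v', w) \<in> tensor_span V W"
    and "v \<in> carrier V \<Longrightarrow> w \<in> carrier W \<Longrightarrow> w' \<in> carrier W \<Longrightarrow>
      basis (v, w \<oplus>\<^bsub>W\<^esub> w') - basis (v, w) - basis (v, w') \<in> tensor_span V W"
    and "v \<in> carrier V \<Longrightarrow> w \<in> carrier W \<Longrightarrow>
      basis (c \<odot>\<^bsub>V\<^esub> v, w) - scale c (basis (v, w)) \<in> tensor_span V W"
    and "v \<in> carrier V \<Longrightarrow> w \<in> carrier W \<Longrightarrow>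
      basis (v, c \<odot>\<^bsub>W\<^esub> w) - scale c (basis (v, w)) \<in> tensor_span V W"
  by (rule presentation.N_rel[OF presentation_tensor[OF assms]], rule tensor_relationsI; assumption)+

lemma tensor_relations_cases:
  assumes "r \<in> tensor_relations V W"
  obtains v v' w where "r = basis (v \<oplus>\<^bsub>V\<^esub> v', w) - basis (v, w) - basis (v', w)"
      "v \<in> carrier V" "v' \<in> carrier V" "w \<in> carrier W"
    | v w w' where "r = basis (v, w \<oplus>\<^bsub>W\<^esub> w') - basis (v, w) - basis (v, w')"
      "v \<in> carrier V" "w \<in> carrier W" "w' \<in> carrier W"
    | c v w where "r = basis (c \<odot>\<^bsub>V\<^esub> v, w) - scale c (basis (v, w))" "v \<in> carrier V" "w \<in> carrier W"
    | c v w where "r = basis (v, c \<odot>\<^bsub>W\<^esub> w) - scale c (basis (v, w))" "v \<in> carrier V" "w \<in> carrier W"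
  using assms unfolding tensor_relations_def by blast

locale tensor_pair =
  fixes G :: "'g lie_algebra" and V :: "('g, 'v) lie_module" and W :: "('g, 'w) lie_module"
  assumes V: "acts_linearly G V" and W: "acts_linearly G W"
begin

sublocale V: complex_space V by (rule acts_linearlyD(1)[OF V])
sublocale W: complex_space W by (rule acts_linearlyD(1)[OF W])

lemmas complex_spaces = V.complex_space_axioms W.complex_space_axioms

sublocale presentation "carrier V \<times> carrier W" "tensor_relations V W"
  by (rule presentation_tensor[OF complex_spaces])

abbreviation "leibniz \<equiv> (\<lambda>x (v, w). basis (act V x v, w) + basis (v, act W x w))"

lemma keys_leibniz:
  assumes "x \<in> carrier G" "b \<in> carrier V \<times> carrier W"
  shows "keys (leibniz x b) \<subseteq> carrier V \<times> carrier W"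
proof -
  obtain v w where b: "b = (v, w)" "v \<in> carrier V" "w \<in> carrier W" using assms(2) by auto
  show ?thesis unfolding b(1) prod.case
    by (rule keys_add_subset) (simp_all add: assms(1) b acts_linearlyD(3)[OF V] acts_linearlyD(3)[OF W])
qed

lemma leibniz_relation:
  assumes x: "x \<in> carrier G" and r: "r \<in> tensor_relations V W"
  shows "linear_extension (leibniz x) r \<in> N"
proof -
  note LV = linear_mapD[OF acts_linearlyD(2)[OF V x]] and LW = linear_mapD[OF acts_linearlyD(2)[OF W x]]
  note ext = linear_extension_diff linear_extension_scale linear_extension_basis prod.case
  note sp = tensor_spanI[OF complex_spaces]
  from r show ?thesis
  proof (cases rule: tensor_relations_cases)
    case (1 v v' w)
    have "linear_extension (leibniz x) r =
       (basis (act V x v \<oplus>\<^bsub>V\<^esub> act V x v', w) - basis (act V x v, w) - basis (act V x v', w)) +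
       (basis (v \<oplus>\<^bsub>V\<^esub> v', act W x w) - basis (v, act W x w) - basis (v', act W x w))"
      unfolding 1(1) ext using 1 LV(2) by (simp add: algebra_simps)
    then show ?thesis using 1 LV(1) LW(1) sp(1) by (simp add: N_add)
  next
    case (2 v w w')
    have "linear_extension (leibniz x) r =
       (basis (v, act W x w \<oplus>\<^bsub>W\<^esub> act W x w') - basis (v, act W x w) - basis (v, act W x w')) +
       (basis (act V x v, w \<oplus>\<^bsub>W\<^esub> w') - basis (act V x v, w) - basis (act V x v, w'))"
      unfolding 2(1) ext using 2 LW(2) by (simp add: algebra_simps)
    then show ?thesis using 2 LV(1) LW(1) sp(2) by (simp add: N_add)
  next
    case (3 c v w)
    have "linear_extension (leibniz x) r =
       (basis (c \<odot>\<^bsub>V\<^esub> act V x v, w) - scale c (basis (act V x v, w))) +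
       (basis (c \<odot>\<^bsub>V\<^esub> v, act W x w) - scale c (basis (v, act W x w)))"
      unfolding 3(1) ext using 3 LV(3) by (simp add: algebra_simps fs.scale_right_distrib)
    then show ?thesis using 3 LV(1) LW(1) sp(3) by (simp add: N_add)
  next
    case (4 c v w)
    have "linear_extension (leibniz x) r =
       (basis (v, c \<odot>\<^bsub>W\<^esub> act W x w) - scale c (basis (v, act W x w))) +
       (basis (act V x v, c \<odot>\<^bsub>W\<^esub> w) - scale c (basis (act V x v, w)))"
      unfolding 4(1) ext using 4 LW(3) by (simp add: algebra_simps fs.scale_right_distrib)
    then show ?thesis using 4 LV(1) LW(1) sp(4) by (simp add: N_add)
  qed
qed

abbreviation "VW \<equiv> tensor_module V W"

lemma acts_linearly_tensor: "acts_linearly G VW"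
  unfolding tensor_module_def by (rule acts_linearly_presented[OF keys_leibniz leibniz_relation])

lemma pure_tensor_closed [simp]: "v \<in> carrier V \<Longrightarrow> w \<in> carrier W \<Longrightarrow> pure_tensor V W v w \<in> carrier VW"
  unfolding tensor_module_def by simp

lemma linear_map_pure_left:
  assumes "w \<in> carrier W"
  shows "linear_map V VW (\<lambda>v. pure_tensor V W v w)"
proof (rule linear_mapI)
  fix v v' assume v: "v \<in> carrier V" "v' \<in> carrier V"
  show "pure_tensor V W (v \<oplus>\<^bsub>V\<^esub> v') w = pure_tensor V W v w \<oplus>\<^bsub>VW\<^esub> pure_tensor V W v' w"
    unfolding tensor_module_def presented_add residue_eq_iff
    using tensor_spanI(1)[OF complex_spaces v assms] by (simp add: diff_diff_eq)
next
  fix c v assume v: "v \<in> carrier V"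
  show "pure_tensor V W (c \<odot>\<^bsub>V\<^esub> v) w = c \<odot>\<^bsub>VW\<^esub> pure_tensor V W v w"
    unfolding tensor_module_def presented_smult residue_eq_iff
    by (rule tensor_spanI(3)[OF complex_spaces v assms])
qed (use assms in simp)

lemma linear_map_pure_right:
  assumes "v \<in> carrier V"
  shows "linear_map W VW (\<lambda>w. pure_tensor V W v w)"
proof (rule linear_mapI)
  fix w w' assume w: "w \<in> carrier W" "w' \<in> carrier W"
  show "pure_tensor V W v (w \<oplus>\<^bsub>W\<^esub> w') = pure_tensor V W v w \<oplus>\<^bsub>VW\<^esub> pure_tensor V W v w'"
    unfolding tensor_module_def presented_add residue_eq_iff
    using tensor_spanI(2)[OF complex_spaces assms w] by (simp add: diff_diff_eq)
next
  fix c w assume w: "w \<in> carrier W"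
  show "pure_tensor V W v (c \<odot>\<^bsub>W\<^esub> w) = c \<odot>\<^bsub>VW\<^esub> pure_tensor V W v w"
    unfolding tensor_module_def presented_smult residue_eq_iff
    by (rule tensor_spanI(4)[OF complex_spaces assms w])
qed (use assms in simp)

lemma act_pure_tensor:
  assumes "x \<in> carrier G" "v \<in> carrier V" "w \<in> carrier W"
  shows "act VW x (pure_tensor V W v w) =
    pure_tensor V W (act V x v) w \<oplus>\<^bsub>VW\<^esub> pure_tensor V W v (act W x w)"
  using presented_act[of leibniz x, OF keys_leibniz[OF assms(1)] leibniz_relation[OF assms(1)], of "basis (v, w)"]
  unfolding tensor_module_def presented_add linear_extension_basis by simp

text \<open>
  A bilinear map kills each of the four families of tensor relations.
\<close>

lemma exists_linear_map_bilinear: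
  assumes "complex_space U"
    and "\<And>w. w \<in> carrier W \<Longrightarrow> linear_map V U (\<lambda>v. f v w)"
    and "\<And>v. v \<in> carrier V \<Longrightarrow> linear_map W U (\<lambda>w. f v w)"
  shows "\<exists>h. linear_map VW U h \<and> (\<forall>v\<in>carrier V. \<forall>w\<in>carrier W. h (pure_tensor V W v w) = f v w)"
proof -
  interpret U: complex_space U by fact
  let ?f = "\<lambda>(v, w). f v w"
  note L1 = linear_mapD[OF assms(2)] and L2 = linear_mapD[OF assms(3)]
  have f: "?f \<in> carrier V \<times> carrier W \<rightarrow> carrier U"
    using L1(1) by auto
  have fc: "f v w \<in> carrier U" if "v \<in> carrier V" "w \<in> carrier W" for v w
    using L1(1) that by auto
  note comb = U.combination_diff[OF f] U.combination_scale[OF f]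
  have rel: "combination U ?f r = \<zero>\<^bsub>U\<^esub>" if "r \<in> tensor_relations V W" for r
    using that
  proof (cases rule: tensor_relations_cases)
    case (1 v v' w)
    then show ?thesis
      by (simp add: comb fc L1(2)[of w v v'] a_minus_def U.M.minus_add U.M.a_ac U.M.r_neg U.M.r_neg1)
  next
    case (2 v w w')
    then show ?thesis
      by (simp add: comb fc L2(2)[of v w w'] a_minus_def U.M.minus_add U.M.a_ac U.M.r_neg U.M.r_neg1)
  next
    case (3 c v w)
    then show ?thesis
      by (simp add: comb fc L1(3)[of w v] a_minus_def U.M.r_neg del: scale_basis)
  next
    case (4 c v w)
    then show ?thesis
      by (simp add: comb fc L2(3)[of v w] a_minus_def U.M.r_neg del: scale_basis)
  qed
  obtain h where h: "linear_map VW U h"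
    "\<And>p. keys p \<subseteq> carrier V \<times> carrier W \<Longrightarrow> h (residue (carrier V \<times> carrier W) (tensor_relations V W) p) = combination U ?f p"
    using exists_linear_map[OF assms(1) f rel] unfolding tensor_module_def by blast
  have "h (pure_tensor V W v w) = f v w" if "v \<in> carrier V" "w \<in> carrier W" for v w
    using h(2)[of "basis (v, w)"] that fc by simp
  then show ?thesis using h(1) by blast
qed

end

text \<open>
  Functoriality: applying the two isomorphisms to the factors of a generator respects the tensor
  relations.
\<close>

lemma tensor_module_isomorphic:
  assumes "acts_linearly G V" "acts_linearly G V'" "acts_linearly G W" "acts_linearly G W'"
    and "lie_module_isomorphic G V V'" "lie_module_isomorphic G W W'"
  shows "lie_module_isomorphic G (tensor_module V W) (tensor_module V' W')"
proof -
  interpret A: tensor_pair G V W by unfold_locales fact+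
  interpret B: tensor_pair G V' W' by unfold_locales fact+
  obtain f g where fg: "linear_map V V' f" "linear_map V' V g"
    "\<And>v. v \<in> carrier V \<Longrightarrow> g (f v) = v" "\<And>w. w \<in> carrier V' \<Longrightarrow> f (g w) = w"
    "\<And>x v. x \<in> carrier G \<Longrightarrow> v \<in> carrier V \<Longrightarrow> f (act V x v) = act V' x (f v)"
    using isomorphicE[OF assms(5) acts_linearlyD(3)[OF assms(1)] acts_linearlyD(1)[OF assms(1)]] by metis
  obtain h k where hk: "linear_map W W' h" "linear_map W' W k"
    "\<And>v. v \<in> carrier W \<Longrightarrow> k (h v) = v" "\<And>w. w \<in> carrier W' \<Longrightarrow> h (k w) = w"
    "\<And>x v. x \<in> carrier G \<Longrightarrow> v \<in> carrier W \<Longrightarrow> h (act W x v) = act W' x (h v)"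
    using isomorphicE[OF assms(6) acts_linearlyD(3)[OF assms(3)] acts_linearlyD(1)[OF assms(3)]] by metis
  have rel: "linear_extension (\<lambda>b. basis (case b of (v, w) \<Rightarrow> (f v, h w))) r \<in> tensor_span V' W'"
    if "linear_map V V' f" "linear_map W W' h" "complex_space V'" "complex_space W'"
      "r \<in> tensor_relations V W"
    for V :: "('g, 'x) lie_module" and V' :: "('g, 'y) lie_module" and f
      and W :: "('g, 'u) lie_module" and W' :: "('g, 'z) lie_module" and h r
  proof -
    note F = linear_mapD[OF that(1)] and H = linear_mapD[OF that(2)]
    note ext = linear_extension_diff linear_extension_scale linear_extension_basis prod.case
    note sp = tensor_spanI[OF that(3,4)]
    from that(5) show ?thesis
      by (cases rule: tensor_relations_cases) (simp_all add: ext F H sp)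
  qed
  show ?thesis
    unfolding tensor_module_def
  proof (rule presented_isomorphic[where f = "\<lambda>(v, w). (f v, h w)" and g = "\<lambda>(v, w). (g v, k w)"])
    fix r assume "r \<in> tensor_relations V W"
    then show "linear_extension (\<lambda>b. basis (case b of (v, w) \<Rightarrow> (f v, h w))) r \<in> tensor_span V' W'"
      by (rule rel[OF fg(1) hk(1) B.complex_spaces])
  next
    fix r assume "r \<in> tensor_relations V' W'"
    then show "linear_extension (\<lambda>b. basis (case b of (v, w) \<Rightarrow> (g v, k w))) r \<in> tensor_span V W"
      by (rule rel[OF fg(2) hk(2) A.complex_spaces])
  next
    fix x b assume "x \<in> carrier G" "b \<in> carrier V \<times> carrier W"
    then show "linear_extension (\<lambda>b. basis (case b of (v, w) \<Rightarrow> (f v, h w))) (A.leibniz x b) =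
        B.leibniz x (case b of (v, w) \<Rightarrow> (f v, h w))"
      by (auto simp: linear_extension_add fg hk)
  qed (use A.presentation_axioms B.presentation_axioms fg hk linear_mapD(1)[OF fg(1)] linear_mapD(1)[OF fg(2)]
        linear_mapD(1)[OF hk(1)] linear_mapD(1)[OF hk(2)] A.keys_leibniz A.leibniz_relation
        B.keys_leibniz B.leibniz_relation in auto)
qed

subsection \<open>Families\<close>

abbreviation family_span where
  "family_span J V \<equiv> module_span (free_space (\<Pi>\<^sub>E j\<in>J. carrier (V j))) (tensor_family_relations J V)"

abbreviation pure_family where
  "pure_family J V f \<equiv> residue (\<Pi>\<^sub>E j\<in>J. carrier (V j)) (tensor_family_relations J V) (basis f)"

lemma family_relations_cases:
  assumes "r \<in> tensor_family_relations J V"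
  obtains f i v v' where "r = basis (f(i := v \<oplus>\<^bsub>V i\<^esub> v')) - basis (f(i := v)) - basis (f(i := v'))"
      "f \<in> (\<Pi>\<^sub>E j\<in>J. carrier (V j))" "i \<in> J" "v \<in> carrier (V i)" "v' \<in> carrier (V i)"
    | f i c v where "r = basis (f(i := c \<odot>\<^bsub>V i\<^esub> v)) - scale c (basis (f(i := v)))"
      "f \<in> (\<Pi>\<^sub>E j\<in>J. carrier (V j))" "i \<in> J" "v \<in> carrier (V i)"
  using assms unfolding tensor_family_relations_def by blast

lemma family_relationsI:
  assumes "f \<in> (\<Pi>\<^sub>E j\<in>J. carrier (V j))" "i \<in> J" "v \<in> carrier (V i)"
  shows "v' \<in> carrier (V i) \<Longrightarrow>
      basis (f(i := v \<oplus>\<^bsub>V i\<^esub> v')) - basis (f(i := v)) - basis (f(i := v')) \<in> tensor_family_relations J V"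
    and "basis (f(i := c \<odot>\<^bsub>V i\<^esub> v)) - scale c (basis (f(i := v))) \<in> tensor_family_relations J V"
  using assms unfolding tensor_family_relations_def by blast+

lemma PiE_upd: "f \<in> Pi\<^sub>E J A \<Longrightarrow> i \<in> J \<Longrightarrow> v \<in> A i \<Longrightarrow> f(i := v) \<in> Pi\<^sub>E J A"
  by (auto simp: PiE_iff extensional_def)

locale tensor_power =
  fixes G :: "'g lie_algebra" and J :: "'i set" and V :: "'i \<Rightarrow> ('g, 'v) lie_module"
  assumes V: "i \<in> J \<Longrightarrow> acts_linearly G (V i)"
begin

abbreviation "P \<equiv> (\<Pi>\<^sub>E j\<in>J. carrier (V j))"

lemma VC: "i \<in> J \<Longrightarrow> complex_space (V i)"
  using V by (simp add: acts_linearly_def)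

lemma V_closed: 
  assumes "i \<in> J" "v \<in> carrier (V i)"
  shows "v' \<in> carrier (V i) \<Longrightarrow> v \<oplus>\<^bsub>V i\<^esub> v' \<in> carrier (V i)" "c \<odot>\<^bsub>V i\<^esub> v \<in> carrier (V i)"
proof -
  interpret complex_space "V i" by (rule VC) fact
  show "v' \<in> carrier (V i) \<Longrightarrow> v \<oplus>\<^bsub>V i\<^esub> v' \<in> carrier (V i)" "c \<odot>\<^bsub>V i\<^esub> v \<in> carrier (V i)"
    using assms(2) by auto
qed

sublocale presentation P "tensor_family_relations J V"
proof
  fix r assume "r \<in> tensor_family_relations J V"
  then show "keys r \<subseteq> P"
    by (cases rule: family_relations_cases)
      (simp_all only:, (intro keys_diff_subset keys_scale_subset, simp_all only: keys_basis_subset, (intro PiE_upd V_closed; assumption)+)+)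
qed

lemma family_spanI:
  assumes "f \<in> P" "i \<in> J" "v \<in> carrier (V i)"
  shows "v' \<in> carrier (V i) \<Longrightarrow>
      basis (f(i := v \<oplus>\<^bsub>V i\<^esub> v')) - basis (f(i := v)) - basis (f(i := v')) \<in> N"
    and "basis (f(i := c \<odot>\<^bsub>V i\<^esub> v)) - scale c (basis (f(i := v))) \<in> N"
  by (rule N_rel, rule family_relationsI; (rule assms | assumption))+

lemma upd_act_closed:
  assumes "x \<in> carrier G" "f \<in> P" "j \<in> J"
  shows "f(j := act (V j) x (f j)) \<in> P"
  by (intro PiE_upd[OF assms(2,3)] acts_linearlyD(3)[OF V[OF assms(3)] assms(1)] PiE_mem[OF assms(2,3)])

abbreviation "leibniz \<equiv> (\<lambda>x f. \<Sum>i\<in>J. basis (f(i := act (V i) x (f i))))"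

lemma keys_leibniz:
  assumes "x \<in> carrier G" "f \<in> P"
  shows "keys (leibniz x f) \<subseteq> P"
  by (rule keys_sum_subset) (use assms upd_act_closed in simp)

lemma leibniz_relation:
  assumes x: "x \<in> carrier G" and r: "r \<in> tensor_family_relations J V"
  shows "linear_extension (leibniz x) r \<in> N"
proof -
  note L = linear_mapD[OF acts_linearlyD(2)[OF V x]]
  note ext = linear_extension_diff linear_extension_scale linear_extension_basis
  from r show ?thesis
  proof (cases rule: family_relations_cases)
    case (1 f i v v')
    let ?g = "\<lambda>j u. (f(i := u))(j := act (V j) x ((f(i := u)) j))"
    have "basis (?g j (v \<oplus>\<^bsub>V i\<^esub> v')) - basis (?g j v) - basis (?g j v') \<in> N" if j: "j \<in> J" for j
    proof (cases "j = i")
      case True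
      then show ?thesis
        using family_spanI(1)[OF 1(2,3), of "act (V i) x v" "act (V i) x v'"] 1 L by simp
    next
      case False
      have "f(j := act (V j) x (f j)) \<in> P" by (rule upd_act_closed[OF x 1(2) j])
      from family_spanI(1)[OF this 1(3,4,5)] show ?thesis
        using False by (simp add: fun_upd_twist[of j i])
    qed
    then show ?thesis unfolding 1(1) ext sum_subtractf[symmetric] by (rule N_sum)
  next
    case (2 f i c v)
    let ?g = "\<lambda>j u. (f(i := u))(j := act (V j) x ((f(i := u)) j))"
    have "basis (?g j (c \<odot>\<^bsub>V i\<^esub> v)) - scale c (basis (?g j v)) \<in> N" if j: "j \<in> J" for j
    proof (cases "j = i")
      case True
      then show ?thesis
        using family_spanI(2)[OF 2(2,3), of "act (V i) x v" c] 2 L by simp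
    next
      case False
      have "f(j := act (V j) x (f j)) \<in> P" by (rule upd_act_closed[OF x 2(2) j])
      from family_spanI(2)[OF this 2(3,4)] show ?thesis
        using False by (simp add: fun_upd_twist[of j i])
    qed
    then show ?thesis unfolding 2(1) ext fs.scale_sum_right sum_subtractf[symmetric] by (rule N_sum)
  qed
qed

abbreviation "T \<equiv> tensor_family J V"

lemma acts_linearly_family: "acts_linearly G T"
  unfolding tensor_family_def by (rule acts_linearly_presented[OF keys_leibniz leibniz_relation])

lemma pure_family_closed [simp]: "f \<in> P \<Longrightarrow> pure_family J V f \<in> carrier T"
  unfolding tensor_family_def by simp

lemma linear_map_pure_family:
  assumes "f \<in> P" "i \<in> J"
  shows "linear_map (V i) T (\<lambda>v. pure_family J V (f(i := v)))"
proof (rule linear_mapI)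
  fix v v' assume v: "v \<in> carrier (V i)" "v' \<in> carrier (V i)"
  show "pure_family J V (f(i := v \<oplus>\<^bsub>V i\<^esub> v')) = pure_family J V (f(i := v)) \<oplus>\<^bsub>T\<^esub> pure_family J V (f(i := v'))"
    unfolding tensor_family_def presented_add residue_eq_iff
    using family_spanI(1)[OF assms v] by (simp add: diff_diff_eq)
next
  fix c v assume v: "v \<in> carrier (V i)"
  show "pure_family J V (f(i := c \<odot>\<^bsub>V i\<^esub> v)) = c \<odot>\<^bsub>T\<^esub> pure_family J V (f(i := v))"
    unfolding tensor_family_def presented_smult residue_eq_iff
    by (rule family_spanI(2)[OF assms v])
qed (use PiE_upd[OF assms] in simp)

lemma act_pure_family:
  assumes "x \<in> carrier G" "f \<in> P"
  shows "act T x (pure_family J V f) = residue P (tensor_family_relations J V) (leibniz x f)"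
  using presented_act[of leibniz x, OF keys_leibniz[OF assms(1)] leibniz_relation[OF assms(1)], of "basis f"]
  unfolding tensor_family_def linear_extension_basis by simp

lemma exists_linear_map_multilinear:
  assumes "complex_space U" "\<And>f. f \<in> P \<Longrightarrow> h f \<in> carrier U"
    and "\<And>f i. f \<in> P \<Longrightarrow> i \<in> J \<Longrightarrow> linear_map (V i) U (\<lambda>v. h (f(i := v)))"
  shows "\<exists>k. linear_map T U k \<and> (\<forall>f\<in>P. k (pure_family J V f) = h f)"
proof -
  interpret U: complex_space U by fact
  have h: "h \<in> P \<rightarrow> carrier U" using assms(2) by auto
  note L = linear_mapD[OF assms(3)]
  note comb = U.combination_diff[OF h] U.combination_scale[OF h]
  have rel: "combination U h r = \<zero>\<^bsub>U\<^esub>" if "r \<in> tensor_family_relations J V" for r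
    using that
  proof (cases rule: family_relations_cases)
    case (1 f i v v')
    then show ?thesis
      by (simp add: comb L PiE_upd V_closed assms(2) a_minus_def U.M.minus_add U.M.a_ac U.M.r_neg U.M.r_neg1)
  next
    case (2 f i c v)
    then show ?thesis
      by (simp add: comb L PiE_upd V_closed assms(2) a_minus_def U.M.r_neg)
  qed
  obtain k where k: "linear_map T U k"
    "\<And>p. keys p \<subseteq> P \<Longrightarrow> k (residue P (tensor_family_relations J V) p) = combination U h p"
    using exists_linear_map[OF assms(1) h rel] unfolding tensor_family_def by blast
  have "k (pure_family J V f) = h f" if "f \<in> P" for f
    using k(2)[of "basis f"] that assms(2) by simp
  then show ?thesis using k(1) by blast
qed

end

text \<open>
  A bijection of the index sets permutes the positions of the factors of each generator, hence the
  defining relations; the sum in the Leibniz rule is reindexed accordingly.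
\<close>

lemma tensor_family_reindex:
  fixes V :: "'i \<Rightarrow> ('g, 'v) lie_module" and V' :: "'j \<Rightarrow> ('g, 'v) lie_module"
  assumes \<sigma>: "bij_betw \<sigma> J J'" and "\<And>i. i \<in> J \<Longrightarrow> V i = V' (\<sigma> i)"
    and V': "\<And>i. i \<in> J' \<Longrightarrow> acts_linearly G (V' i)"
  shows "lie_module_isomorphic G (tensor_family J V) (tensor_family J' V')"
proof -
  have V: "acts_linearly G (V i)" if "i \<in> J" for i
    using assms that by (auto simp: bij_betw_def)
  interpret A: tensor_power G J V by unfold_locales (rule V)
  interpret B: tensor_power G J' V' by unfold_locales (rule V')
  define \<rho> where "\<rho> = inv_into J \<sigma>"
  have \<sigma>1: "\<sigma> i \<in> J'" "\<rho> (\<sigma> i) = i" if "i \<in> J" for i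
    using \<sigma> that by (auto simp: bij_betw_def \<rho>_def)
  have \<rho>1: "\<rho> i \<in> J" "\<sigma> (\<rho> i) = i" if "i \<in> J'" for i
    using \<sigma> that by (auto simp: bij_betw_def \<rho>_def inv_into_into f_inv_into_f)
  have VV: "V' i = V (\<rho> i)" if "i \<in> J'" for i using assms(2) \<rho>1 that by simp
  define F where "F f = restrict (\<lambda>j. f (\<rho> j)) J'" for f :: "'i \<Rightarrow> 'v"
  define H where "H f = restrict (\<lambda>j. f (\<sigma> j)) J" for f :: "'j \<Rightarrow> 'v"
  have Fupd: "F (f(i := v)) = (F f)(\<sigma> i := v)" if "i \<in> J" for f i v
    using that \<sigma>1 \<rho>1 by (auto simp: F_def restrict_def fun_eq_iff)
  have Hupd: "H (f(i := v)) = (H f)(\<rho> i := v)" if "i \<in> J'" for f i v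
    using that \<sigma>1 \<rho>1 by (auto simp: H_def restrict_def fun_eq_iff)
  have FP: "F f \<in> B.P" if "f \<in> A.P" for f using that \<rho>1 VV by (auto simp: F_def PiE_iff)
  have HP: "H f \<in> A.P" if "f \<in> B.P" for f using that \<sigma>1 assms(2) by (auto simp: H_def PiE_iff)
  note ext = linear_extension_diff linear_extension_scale linear_extension_basis
  show ?thesis
    unfolding tensor_family_def
  proof (rule presented_isomorphic[where f = F and g = H])
    show "H (F f) = f" if "f \<in> A.P" for f
      using that \<sigma>1 by (auto simp: F_def H_def PiE_iff extensional_def fun_eq_iff)
    show "F (H f) = f" if "f \<in> B.P" for f
      using that \<rho>1 by (auto simp: F_def H_def PiE_iff extensional_def fun_eq_iff)
    show "linear_extension (\<lambda>b. basis (F b)) r \<in> B.N" if "r \<in> tensor_family_relations J V" for r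
      using that
    proof (cases rule: family_relations_cases)
      case (1 f i v v')
      then show ?thesis
        using B.family_spanI(1)[of "F f" "\<sigma> i" v v'] FP \<sigma>1(1) assms(2)[of i] by (simp add: ext Fupd)
    next
      case (2 f i c v)
      then show ?thesis
        using B.family_spanI(2)[of "F f" "\<sigma> i" v c] FP \<sigma>1(1) assms(2)[of i] by (simp add: ext Fupd)
    qed
    show "linear_extension (\<lambda>b. basis (H b)) r \<in> A.N" if "r \<in> tensor_family_relations J' V'" for r
      using that
    proof (cases rule: family_relations_cases)
      case (1 f i v v')
      then show ?thesis
        using A.family_spanI(1)[of "H f" "\<rho> i" v v'] HP \<rho>1(1) VV[of i] by (simp add: ext Hupd)
    next
      case (2 f i c v)
      then show ?thesis
        using A.family_spanI(2)[of "H f" "\<rho> i" v c] HP \<rho>1(1) VV[of i] by (simp add: ext Hupd)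
    qed
    show "linear_extension (\<lambda>b. basis (F b)) (A.leibniz x f) = B.leibniz x (F f)"
      if "x \<in> carrier G" "f \<in> A.P" for x f
    proof -
      have "linear_extension (\<lambda>b. basis (F b)) (A.leibniz x f) =
          (\<Sum>i\<in>J. basis ((F f)(\<sigma> i := act (V i) x (f i))))"
        by (simp add: linear_extension_sum Fupd)
      also have "\<dots> = (\<Sum>i\<in>J. basis ((F f)(\<sigma> i := act (V' (\<sigma> i)) x (F f (\<sigma> i)))))"
        by (rule sum.cong) (use \<sigma>1 assms(2) in \<open>simp_all add: F_def\<close>)
      also have "\<dots> = B.leibniz x (F f)"
        by (rule sum.reindex_bij_betw[OF \<sigma>])
      finally show ?thesis .
    qed
  qed (use A.presentation_axioms B.presentation_axioms FP HP A.keys_leibniz A.leibniz_relation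
        B.keys_leibniz B.leibniz_relation in auto)
qed

section \<open>Coefficients of the action\<close>

text \<open>
  For \<open>g k = L k\<close> or \<open>g k = I k\<close> with large \<open>k\<close>, the vector
  \<open>g k \<cdot> v\<close> is an exponential polynomial in \<open>k\<close> with vector
  coefficients \<open>r \<nu> j\<close>. Testing with functionals expresses this through sequences
  of complex numbers, without sums in \<open>V\<close>.
\<close>

definition action_expansion ::
    "('g, 'v) lie_module \<Rightarrow> (nat \<Rightarrow> 'g) \<Rightarrow> 'v \<Rightarrow> (complex \<Rightarrow> nat \<Rightarrow> 'v) \<Rightarrow> bool"
  where "action_expansion V g v r \<longleftrightarrow> (\<forall>\<nu> j. r \<nu> j \<in> carrier V) \<and>
    (\<forall>l. functional V l \<longrightarrow> exponential_expansion (\<lambda>k. l (act V (g k) v)) (\<lambda>\<nu> j. l (r \<nu> j)))"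

text \<open>
  Each functional determines its own coefficients by uniqueness of exponential expansions, and
  functionals separate points. Hence the coefficients are invariants of the action.
\<close>

lemma action_expansion_unique:
  assumes "complex_space V" "action_expansion V g v r" "action_expansion V g v r'"
  shows "r = r'"
proof (intro ext)
  fix \<nu> j
  show "r \<nu> j = r' \<nu> j"
  proof (rule functionals_separate[OF assms(1)])
    fix l assume l: "functional V l"
    have "(\<lambda>\<nu> j. l (r \<nu> j)) = (\<lambda>\<nu> j. l (r' \<nu> j))"
      by (rule exponential_expansion_unique[of "\<lambda>k. l (act V (g k) v)"])
        (use assms(2,3) l in \<open>simp_all add: action_expansion_def\<close>)
    then show "l (r \<nu> j) = l (r' \<nu> j)" by meson
  qed (use assms in \<open>auto simp: action_expansion_def\<close>)
qed

lemma action_expansion_add: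
  assumes "acts_linearly G V" "\<And>k. g k \<in> carrier G" "v \<in> carrier V" "v' \<in> carrier V"
    and "action_expansion V g v r" "action_expansion V g v' r'"
  shows "action_expansion V g (v \<oplus>\<^bsub>V\<^esub> v') (\<lambda>\<nu> j. r \<nu> j \<oplus>\<^bsub>V\<^esub> r' \<nu> j)"
proof -
  interpret V: complex_space V by (rule acts_linearlyD(1)[OF assms(1)])
  have "exponential_expansion (\<lambda>k. l (act V (g k) (v \<oplus>\<^bsub>V\<^esub> v'))) (\<lambda>\<nu> j. l (r \<nu> j \<oplus>\<^bsub>V\<^esub> r' \<nu> j))"
    if l: "functional V l" for l
  proof -
    have "l (act V (g k) (v \<oplus>\<^bsub>V\<^esub> v')) = l (act V (g k) v) + l (act V (g k) v')" for k
      using linear_mapD[OF acts_linearlyD(2)[OF assms(1,2)]] linear_mapD(2)[OF l] assms(3,4) by simp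
    moreover have "l (r \<nu> j \<oplus>\<^bsub>V\<^esub> r' \<nu> j) = l (r \<nu> j) + l (r' \<nu> j)" for \<nu> j
      using linear_mapD(2)[OF l] assms(5,6) by (simp add: action_expansion_def)
    ultimately show ?thesis
      using exponential_expansion_add assms(5,6) l by (simp add: action_expansion_def)
  qed
  then show ?thesis using assms(5,6) by (simp add: action_expansion_def)
qed

lemma action_expansion_scale:
  assumes "acts_linearly G V" "\<And>k. g k \<in> carrier G" "v \<in> carrier V" "action_expansion V g v r"
  shows "action_expansion V g (c \<odot>\<^bsub>V\<^esub> v) (\<lambda>\<nu> j. c \<odot>\<^bsub>V\<^esub> r \<nu> j)"
proof -
  interpret V: complex_space V by (rule acts_linearlyD(1)[OF assms(1)])
  have "exponential_expansion (\<lambda>k. l (act V (g k) (c \<odot>\<^bsub>V\<^esub> v))) (\<lambda>\<nu> j. l (c \<odot>\<^bsub>V\<^esub> r \<nu> j))"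
    if l: "functional V l" for l
  proof -
    have "l (act V (g k) (c \<odot>\<^bsub>V\<^esub> v)) = c * l (act V (g k) v)" for k
      using linear_mapD[OF acts_linearlyD(2)[OF assms(1,2)]] linear_mapD(3)[OF l] assms(3) by simp
    moreover have "l (c \<odot>\<^bsub>V\<^esub> r \<nu> j) = c * l (r \<nu> j)" for \<nu> j
      using linear_mapD(3)[OF l] assms(4) by (simp add: action_expansion_def)
    ultimately show ?thesis
      using exponential_expansion_scale assms(4) l by (simp add: action_expansion_def)
  qed
  then show ?thesis using assms(4) by (simp add: action_expansion_def)
qed

lemma action_expansion_zero:
  assumes "acts_linearly G V" "\<And>k. g k \<in> carrier G"
  shows "action_expansion V g \<zero>\<^bsub>V\<^esub> (\<lambda>\<nu> j. \<zero>\<^bsub>V\<^esub>)"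
proof -
  note C = acts_linearlyD(1)[OF assms(1)]
  interpret V: complex_space V by (rule C)
  have "exponential_expansion (\<lambda>k. l (act V (g k) \<zero>\<^bsub>V\<^esub>)) (\<lambda>\<nu> j. l \<zero>\<^bsub>V\<^esub>)" if l: "functional V l" for l
    using exponential_expansion_eventually_zero[of 0 "\<lambda>_. 0"]
    by (simp add: functional_zero[OF l C] linear_map_zero[OF acts_linearlyD(2)[OF assms] C C])
  then show ?thesis by (simp add: action_expansion_def)
qed

text \<open>
  A functional on the target composed with \<open>f\<close> is a functional on the source.
  Together with uniqueness this says that module homomorphisms commute with the coefficient
  operators.
\<close>

lemma action_expansion_transport:
  assumes "linear_map V W f" "\<And>x v. x \<in> carrier G \<Longrightarrow> v \<in> carrier V \<Longrightarrow> f (act V x v) = act W x (f v)"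
    and "\<And>k. g k \<in> carrier G" "v \<in> carrier V" "action_expansion V g v r"
  shows "action_expansion W g (f v) (\<lambda>\<nu> j. f (r \<nu> j))"
proof -
  have "exponential_expansion (\<lambda>k. l (act W (g k) (f v))) (\<lambda>\<nu> j. l (f (r \<nu> j)))" if l: "functional W l" for l
  proof -
    have "exponential_expansion (\<lambda>k. l (f (act V (g k) v))) (\<lambda>\<nu> j. l (f (r \<nu> j)))"
      using assms(5) linear_map_comp[OF assms(1) l] unfolding action_expansion_def by blast
    then show ?thesis by (simp add: assms(2-4))
  qed
  moreover have "f (r \<nu> j) \<in> carrier W" for \<nu> j
    using assms(5) linear_mapD(1)[OF assms(1)] by (simp add: action_expansion_def)
  ultimately show ?thesis by (simp add: action_expansion_def)
qed

section \<open>The modules \<open>\<Omega>\<close>\<close>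

lemma Omega_simps [simp]:
  "carrier (Omega l a b) = UNIV" "p \<oplus>\<^bsub>Omega l a b\<^esub> q = p + q" "\<zero>\<^bsub>Omega l a b\<^esub> = 0"
  "c \<odot>\<^bsub>Omega l a b\<^esub> p = Polynomial.smult c p"
  by (simp_all add: Omega_def)

lemma HV_simps [simp]:
  "carrier HV = UNIV" "x \<oplus>\<^bsub>HV\<^esub> y = x + y" "\<zero>\<^bsub>HV\<^esub> = 0" "c \<odot>\<^bsub>HV\<^esub> x = scale c x" "bracket HV = hv_bracket"
  by (simp_all add: HV_def)

lemma Omega_act_basis_linear:
  "Omega_act_basis l a b h (p + q) = Omega_act_basis l a b h p + Omega_act_basis l a b h q"
  "Omega_act_basis l a b h (Polynomial.smult c p) = Polynomial.smult c (Omega_act_basis l a b h p)"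
  by (cases h; simp add: pcompose_add pcompose_smult smult_add_right algebra_simps)+

lemma act_Omega_basis [simp]: "act (Omega l a b) (basis h) p = Omega_act_basis l a b h p"
  by (simp add: Omega_def)

lemma acts_linearly_Omega: "acts_linearly HV (Omega l a b)"
proof -
  have "complex_space (Omega l a b)"
    by (rule complex_spaceI) (auto simp: smult_add_left smult_add_right algebra_simps)
  moreover have "linear_map (Omega l a b) (Omega l a b) (act (Omega l a b) x)" for x
    by (rule linear_mapI)
      (simp_all add: Omega_def Omega_act_basis_linear smult_add_right sum.distrib smult_sum_right mult.commute)
  ultimately show ?thesis by (simp add: acts_linearly_def)
qed

text \<open>
  By linearity it is enough to check the basis of the algebra, where the constant polynomial is
  sent to a polynomial of degree at most one.
\<close>

lemma act_Omega_one: "\<exists>s t. act (Omega l a b) x 1 = [:s, t:]"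
proof -
  have "degree (Omega_act_basis l a b h 1) \<le> 1" for h
    by (cases h) (auto simp: pcompose_1 intro!: order.trans[OF degree_smult_le])
  then have "degree (act (Omega l a b) x 1) \<le> 1"
    by (auto simp: Omega_def intro!: degree_sum_le order.trans[OF degree_smult_le])
  then have "act (Omega l a b) x 1 = [:coeff (act (Omega l a b) x 1) 0, coeff (act (Omega l a b) x 1) 1:]"
    by (auto simp: poly_eq_iff coeff_pCons coeff_eq_0 split: nat.split)
  then show ?thesis by blast
qed

abbreviation "L_seq \<equiv> (\<lambda>k. basis (L (int k)))"
abbreviation "I_seq \<equiv> (\<lambda>k. basis (I (int k)))"

definition eventually_killed :: "(hv, 'v) lie_module \<Rightarrow> 'v \<Rightarrow> bool"
  where "eventually_killed V v \<longleftrightarrow> (\<exists>K. \<forall>k\<ge>K. act V (L_seq k) v = \<zero>\<^bsub>V\<^esub> \<and> act V (I_seq k) v = \<zero>\<^bsub>V\<^esub>)"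

definition restricted :: "(hv, 'v) lie_module \<Rightarrow> bool"
  where "restricted V \<longleftrightarrow> (\<forall>v\<in>carrier V. eventually_killed V v)"

lemma functional_sum:
  assumes "functional (free_space B) l" "\<And>i. i \<in> S \<Longrightarrow> keys (p i) \<subseteq> B"
  shows "l (\<Sum>i\<in>S. p i) = (\<Sum>i\<in>S. l (p i))"
proof -
  have l0: "l 0 = 0" using functional_zero[OF assms(1) complex_space_free_space] by simp
  from assms(2) show ?thesis
  proof (induction S rule: infinite_finite_induct)
    case (insert x F)
    then show ?case
      using linear_mapD(2)[OF assms(1), of "p x" "\<Sum>i\<in>F. p i"] keys_sum_subset[of F p B] by simp
  qed (simp_all add: l0)
qed

lemmas (in tensor_pair) tensor_induct [consumes 1, case_names basis add zero scale] =
  presented_induct[where F = leibniz, folded tensor_module_def]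

lemmas (in tensor_power) family_induct [consumes 1, case_names basis add zero scale] =
  presented_induct[where F = leibniz, folded tensor_family_def]

text \<open>
  A tensor product of modules \<open>\<Omega>\<close> with pairwise distinct nonzero frequencies
  \<open>lam i\<close> and a further factor \<open>V\<close>, on every vector of which \<open>L
  k\<close> and \<open>I k\<close> vanish for large \<open>k\<close>. For large \<open>k\<close>,
  these operators therefore see only the polynomial factors.
\<close>

locale omega_tensor =
  fixes J :: "'i set" and lam alpha beta :: "'i \<Rightarrow> complex" and V :: "(hv, 'v) lie_module"
  assumes finite_J: "finite J" and inj_lam: "inj_on lam J"
    and lam_nonzero: "i \<in> J \<Longrightarrow> lam i \<noteq> 0"
    and acts_V: "acts_linearly HV V" and restricted_V: "restricted V"
begin

abbreviation "Om \<equiv> (\<lambda>i. Omega (lam i) (alpha i) (beta i))"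

sublocale T: tensor_power HV J Om
  by unfold_locales (rule acts_linearly_Omega)

sublocale Z: tensor_pair HV T.T V
  by unfold_locales (rule T.acts_linearly_family, rule acts_V)

abbreviation "Z \<equiv> tensor_module T.T V"
text \<open>
  The decomposable tensor with polynomial factors \<open>f i\<close> and last factor
  \<open>v\<close>. It is a constant rather than an abbreviation because the domain of the
  families, a product of copies of the universe, would otherwise be rewritten inside the cosets.
\<close>

definition tau where "tau f v = pure_tensor T.T V (pure_family J Om f) v"

lemma complex_space_Z: "complex_space Z"
  using Z.acts_linearly_tensor by (simp add: acts_linearly_def)

sublocale ZC: complex_space Z
  by (rule complex_space_Z)

lemma tau_closed [simp]: "f \<in> extensional J \<Longrightarrow> v \<in> carrier V \<Longrightarrow> tau f v \<in> carrier Z"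
  unfolding tau_def by (intro Z.pure_tensor_closed T.pure_family_closed) (simp_all add: PiE_def)

lemma ext_upd [simp]: "f \<in> extensional J \<Longrightarrow> i \<in> J \<Longrightarrow> f(i := p) \<in> extensional J"
  by (auto simp: extensional_def)

lemma linear_map_tau_slot:
  assumes "f \<in> extensional J" "i \<in> J" "v \<in> carrier V"
  shows "linear_map (Om i) Z (\<lambda>p. tau (f(i := p)) v)"
  unfolding tau_def by (rule linear_map_comp[OF T.linear_map_pure_family Z.linear_map_pure_left])
    (use assms in \<open>simp_all add: PiE_def\<close>)

lemma linear_map_tau:
  assumes "f \<in> extensional J"
  shows "linear_map V Z (\<lambda>v. tau f v)"
  unfolding tau_def
  by (rule Z.linear_map_pure_right[OF T.pure_family_closed]) (use assms in \<open>simp add: PiE_def\<close>)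

lemma functional_act_tau:
  assumes l: "functional Z l" and f: "f \<in> extensional J" and v: "v \<in> carrier V"
  shows "l (act Z x (tau f v)) =
    (\<Sum>i\<in>J. l (tau (f(i := act (Om i) x (f i))) v)) + l (tau f (act V x v))"
proof -
  have fP: "f \<in> T.P" using f by (simp add: PiE_def)
  define t where "t = pure_family J Om f"
  define R where "R p = residue T.P (tensor_family_relations J Om) p" for p
  have tau_t: "tau f w = pure_tensor T.T V t w" for w by (simp only: tau_def t_def)
  have R: "R (basis g) = pure_family J Om g" for g by (simp only: R_def)
  have t: "t \<in> carrier T.T" unfolding t_def by (rule T.pure_family_closed[OF fP])
  have xt: "act T.T x t \<in> carrier T.T" using acts_linearlyD(3)[OF T.acts_linearly_family] t by simp
  have "act T.T x t = R (\<Sum>i\<in>J. basis (f(i := act (Om i) x (f i))))"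
    unfolding t_def R_def by (rule T.act_pure_family[OF _ fP]) simp
  moreover have "l (act Z x (tau f v)) = l (pure_tensor T.T V (act T.T x t) v) + l (tau f (act V x v))"
    using Z.act_pure_tensor[OF _ t v, of x] linear_mapD(2)[OF l] xt t v
      acts_linearlyD(3)[OF acts_V, of x v] by (simp add: tau_t)
  moreover have "l (pure_tensor T.T V (R (\<Sum>i\<in>J. basis (f(i := act (Om i) x (f i))))) v) =
      (\<Sum>i\<in>J. l (pure_tensor T.T V (R (basis (f(i := act (Om i) x (f i))))) v))"
  proof (rule functional_sum)
    have "linear_map (free_space T.P) T.T R"
      unfolding tensor_family_def R_def by (rule T.linear_map_residue)
    from linear_map_comp[OF linear_map_comp[OF this Z.linear_map_pure_left[OF v]] l]
    show "functional (free_space T.P) (\<lambda>p. l (pure_tensor T.T V (R p) v))" .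
  qed (use f in \<open>simp add: PiE_def\<close>)
  ultimately show ?thesis unfolding R tau_def[symmetric] by simp
qed

subsection \<open>Coefficient maps\<close>

text \<open>
  The product of the coefficients of the polynomials \<open>f i\<close> is multilinear in
  \<open>f\<close>, and scaling \<open>v\<close> by it is bilinear.
\<close>

lemma exists_coefficient:
  "\<exists>q. linear_map Z V q \<and> (\<forall>f\<in>extensional J. \<forall>v\<in>carrier V.
    q (tau f v) = (\<Prod>i\<in>J. coeff (f i) (a i)) \<odot>\<^bsub>V\<^esub> v)"
proof -
  have "linear_map (Om i) scalars (\<lambda>p. \<Prod>j\<in>J. coeff ((f(i := p)) j) (a j))" if "i \<in> J" for f i
  proof -
    have "(\<Prod>j\<in>J. coeff ((f(i := p)) j) (a j)) = coeff p (a i) * (\<Prod>j\<in>J - {i}. coeff (f j) (a j))" for p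
      by (subst prod.remove[OF finite_J that]) (auto intro!: prod.cong)
    then show ?thesis by (auto intro!: linear_mapI simp: algebra_simps)
  qed
  then have "\<exists>k. functional T.T k \<and> (\<forall>f\<in>T.P. k (pure_family J Om f) = (\<Prod>i\<in>J. coeff (f i) (a i)))"
    by (intro T.exists_linear_map_multilinear[OF complex_space_scalars]) simp_all
  then obtain k where k: "functional T.T k" "\<And>f. f \<in> T.P \<Longrightarrow> k (pure_family J Om f) = (\<Prod>i\<in>J. coeff (f i) (a i))"
    by blast
  have "\<exists>q. linear_map Z V q \<and> (\<forall>t\<in>carrier T.T. \<forall>v\<in>carrier V. q (pure_tensor T.T V t v) = k t \<odot>\<^bsub>V\<^esub> v)"
  proof (rule Z.exists_linear_map_bilinear[OF Z.W.complex_space_axioms])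
    fix v assume v: "v \<in> carrier V"
    show "linear_map T.T V (\<lambda>t. k t \<odot>\<^bsub>V\<^esub> v)"
      using linear_mapD[OF k(1)] v by (auto intro!: linear_mapI simp: Z.W.smult_plus Z.W.smult_smult)
  next
    fix t
    show "linear_map V V (\<lambda>v. k t \<odot>\<^bsub>V\<^esub> v)"
      by (auto intro!: linear_mapI simp: Z.W.smult_oplus Z.W.smult_smult mult.commute)
  qed
  then obtain q where q: "linear_map Z V q"
    "\<And>t v. t \<in> carrier T.T \<Longrightarrow> v \<in> carrier V \<Longrightarrow> q (pure_tensor T.T V t v) = k t \<odot>\<^bsub>V\<^esub> v" by blast
  have "q (tau f v) = (\<Prod>i\<in>J. coeff (f i) (a i)) \<odot>\<^bsub>V\<^esub> v" if "f \<in> extensional J" "v \<in> carrier V" for f v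
  proof -
    have f: "f \<in> T.P" using that(1) by (simp add: PiE_def)
    show ?thesis unfolding tau_def q(2)[OF T.pure_family_closed[OF f] that(2)] k(2)[OF f] ..
  qed
  then show ?thesis using q(1) by blast
qed

text \<open>
  The coefficient in \<open>V\<close> of the monomial with exponents \<open>a\<close>, when the
  tensor product is viewed as the space of polynomials with coefficients in \<open>V\<close>.
\<close>

definition coefficient :: "('i \<Rightarrow> nat) \<Rightarrow> _"
  where "coefficient a = (SOME q. linear_map Z V q \<and> (\<forall>f\<in>extensional J. \<forall>v\<in>carrier V.
    q (tau f v) = (\<Prod>i\<in>J. coeff (f i) (a i)) \<odot>\<^bsub>V\<^esub> v))"

lemma linear_coefficient: "linear_map Z V (coefficient a)"
  and coefficient_tau: "f \<in> extensional J \<Longrightarrow> v \<in> carrier V \<Longrightarrow>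
    coefficient a (tau f v) = (\<Prod>i\<in>J. coeff (f i) (a i)) \<odot>\<^bsub>V\<^esub> v"
  using someI_ex[OF exists_coefficient[of a]] unfolding coefficient_def[symmetric] by blast+

abbreviation "monomial a \<equiv> restrict (\<lambda>i. monom (1::complex) (a i)) J"

text \<open>
  Starting from an arbitrary decomposable tensor, its polynomials are expanded into monomials one
  position at a time; \<open>K\<close> is the set of positions still to be expanded.
\<close>

lemma monomial_induct [consumes 1, case_names monomial add zero scale]:
  assumes "z \<in> carrier Z"
    and mono: "\<And>a v. v \<in> carrier V \<Longrightarrow> P (tau (monomial a) v)"
    and add: "\<And>y z. y \<in> carrier Z \<Longrightarrow> z \<in> carrier Z \<Longrightarrow> P y \<Longrightarrow> P z \<Longrightarrow> P (y \<oplus>\<^bsub>Z\<^esub> z)"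
    and zero: "P \<zero>\<^bsub>Z\<^esub>"
    and scale: "\<And>c z. z \<in> carrier Z \<Longrightarrow> P z \<Longrightarrow> P (c \<odot>\<^bsub>Z\<^esub> z)"
  shows "P z"
proof -
  have tau: "P (tau f v)" if "K \<subseteq> J" "finite K" "f \<in> extensional J" "v \<in> carrier V"
    "\<forall>i\<in>J - K. \<exists>n. f i = monom 1 n" for K f v
    using that(2,1,3,4,5)
  proof (induction K arbitrary: f rule: finite_induct)
    case empty
    then have "\<forall>i. \<exists>n. i \<in> J \<longrightarrow> f i = monom 1 n" by auto
    then obtain a where "\<And>i. i \<in> J \<Longrightarrow> f i = monom 1 (a i)" by metis
    then have f: "f = monomial a" using empty by (intro ext) (auto simp: extensional_def)
    show ?case unfolding f by (rule mono) fact
  next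
    case (insert k K)
    then have k: "k \<in> J" by simp
    note lin = linear_map_tau_slot[OF insert.prems(2) k insert.prems(3)]
    have m: "P (tau (f(k := monom 1 n)) v)" for n
    proof (rule insert.IH[OF _ ext_upd[OF insert.prems(2) k] insert.prems(3)])
      show "\<forall>i\<in>J - K. \<exists>m. (f(k := monom 1 n)) i = monom 1 m"
        using insert.prems(4) by (auto simp del: fun_upd_apply simp: fun_upd_def)
    qed (use insert.prems(1) in simp)
    have m': "P (tau (f(k := monom c n)) v)" for c n
    proof -
      have "tau (f(k := monom c n)) v = c \<odot>\<^bsub>Z\<^esub> tau (f(k := monom 1 n)) v"
        using linear_mapD(3)[OF lin, of "monom 1 n" c] by (simp only: Omega_simps smult_monom mult_1_right UNIV_I)
      then show ?thesis using scale[OF tau_closed m] insert.prems k by (simp only: ext_upd)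
    qed
    have "P (tau (f(k := (\<Sum>i\<le>n. monom (c i) i))) v)" for c n
    proof (induction n)
      case 0
      have "(\<Sum>i\<le>0. monom (c i) i) = monom (c 0) 0" by simp
      then show ?case using m'[of "c 0" 0] by (simp only:)
    next
      case (Suc n)
      have "tau (f(k := (\<Sum>i\<le>Suc n. monom (c i) i))) v =
          tau (f(k := (\<Sum>i\<le>n. monom (c i) i))) v \<oplus>\<^bsub>Z\<^esub> tau (f(k := monom (c (Suc n)) (Suc n))) v"
        using linear_mapD(2)[OF lin, of "\<Sum>i\<le>n. monom (c i) i" "monom (c (Suc n)) (Suc n)"]
        by (simp only: Omega_simps sum.atMost_Suc UNIV_I)
      then show ?case using add[OF tau_closed tau_closed Suc m'] insert.prems k by (simp only: ext_upd)
    qed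
    from this[of "coeff (f k)" "degree (f k)"] show ?case by (simp add: poly_as_sum_of_monoms)
  qed
  have pure: "P (pure_tensor T.T V t v)" if "t \<in> carrier T.T" "v \<in> carrier V" for t v
    using that(1)
  proof (induction t rule: T.family_induct)
    case (basis f)
    then have "f \<in> extensional J" by (simp add: PiE_def)
    from tau[OF subset_refl finite_J this that(2)] show ?case by (simp only: tau_def Diff_cancel ball_empty)
  next
    case (add y z)
    show ?case
      unfolding linear_mapD(2)[OF Z.linear_map_pure_left[OF that(2)] add(1,2)]
      by (rule assms(3)[OF Z.pure_tensor_closed Z.pure_tensor_closed add(3,4)]) (rule add that(2))+
  next
    case zero
    show ?case
      unfolding linear_map_zero[OF Z.linear_map_pure_left[OF that(2)] Z.complex_spaces(1) complex_space_Z]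
      by (rule assms(4))
  next
    case (scale c z)
    show ?case
      unfolding linear_mapD(3)[OF Z.linear_map_pure_left[OF that(2)] scale(1)]
      by (rule assms(5)[OF Z.pure_tensor_closed scale(2)]) (rule scale that(2))+
  qed
  from assms(1) show ?thesis
  proof (induction z rule: Z.tensor_induct)
    case (basis x)
    then show ?case using pure by auto
  qed (use add zero scale in simp_all)
qed

text \<open>
  Every functional satisfies \<open>l z = (\<Sum>a\<in>A'. l (tau (monomial a) (coefficient a
  z)))\<close> for each sufficiently large finite set \<open>A'\<close> of exponents. This holds
  for monomials and survives linear combinations, and its right side depends only on the
  coefficients of \<open>z\<close>. Exponents are restricted to extensional functions so that
  distinct indices give distinct monomials.
\<close>

lemma coefficients_separate:
  assumes "z \<in> carrier Z" "z' \<in> carrier Z"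
    and "\<And>a. a \<in> extensional J \<Longrightarrow> coefficient a z = coefficient a z'"
  shows "z = z'"
proof -
  note Q = linear_mapD[OF linear_coefficient]
  let ?good = "\<lambda>z. \<exists>A. finite A \<and> (\<forall>A' l. finite A' \<longrightarrow> A \<subseteq> A' \<longrightarrow> A' \<subseteq> extensional J \<longrightarrow> functional Z l \<longrightarrow>
    l z = (\<Sum>a\<in>A'. l (tau (monomial a) (coefficient a z)))) \<and> A \<subseteq> extensional J"
  have lin: "functional V (\<lambda>v. l (tau (monomial a) v))" if "functional Z l" for a l
    by (rule linear_map_comp[OF linear_map_tau that]) simp
  have good: "?good z" if "z \<in> carrier Z" for z
    using that
  proof (induction z rule: monomial_induct)
    case (monomial a v)
    \<comment> \<open>the exponents outside \<open>J\<close> are arbitrary in the induction rule\<close>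
    define b where "b = restrict a J"
    have mb: "monomial b = monomial a" by (auto simp: b_def)
    have q: "coefficient a' (tau (monomial a) v) = (if a' = b then v else \<zero>\<^bsub>V\<^esub>)" if "a' \<in> extensional J" for a'
    proof -
      have "(\<Prod>i\<in>J. coeff (monomial a i) (a' i)) = (if a' = b then 1 else 0)"
      proof (cases "a' = b")
        case False
        have "\<exists>i\<in>J. a' i \<noteq> a i"
        proof (rule ccontr)
          assume "\<not> (\<exists>i\<in>J. a' i \<noteq> a i)"
          then have "a' = b" using that by (intro ext) (auto simp: b_def extensional_def)
          then show False using False by contradiction
        qed
        then obtain i where i: "i \<in> J" "a' i \<noteq> a i" by blast
        then have "coeff (monomial a i) (a' i) = 0" by simp
        then have "\<exists>i\<in>J. coeff (monomial a i) (a' i) = 0" using i(1) by (rule bexI)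
        then show ?thesis using prod_zero[OF finite_J] False by simp
      qed (simp add: b_def)
      then show ?thesis using monomial by (simp add: coefficient_tau)
    qed
    have main: "l (tau (monomial a) v) = (\<Sum>a'\<in>A'. l (tau (monomial a') (coefficient a' (tau (monomial a) v))))"
      if A': "finite A'" "{b} \<subseteq> A'" "A' \<subseteq> extensional J" and l: "functional Z l" for A' l
    proof -
      have "(\<Sum>a'\<in>A'. l (tau (monomial a') (coefficient a' (tau (monomial a) v)))) =
          (\<Sum>a'\<in>A'. if a' = b then l (tau (monomial b) v) else 0)"
      proof (rule sum.cong)
        fix a' assume "a' \<in> A'"
        then have "coefficient a' (tau (monomial a) v) = (if a' = b then v else \<zero>\<^bsub>V\<^esub>)"
          using q A' by blast
        then show "l (tau (monomial a') (coefficient a' (tau (monomial a) v))) =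
          (if a' = b then l (tau (monomial b) v) else 0)"
          using functional_zero[OF lin[OF l] Z.W.complex_space_axioms] by simp
      qed simp
      then show ?thesis using A' mb by simp
    qed
    show ?case
    proof (intro exI[of _ "{b}"] conjI allI impI)
      fix A' l assume "finite A'" "{b} \<subseteq> A'" "A' \<subseteq> extensional J" "functional Z l"
      then show "l (tau (monomial a) v) = (\<Sum>a'\<in>A'. l (tau (monomial a') (coefficient a' (tau (monomial a) v))))"
        by (rule main)
    qed (simp_all add: b_def)
  next
    case (add y z)
    obtain A where A: "finite A" "A \<subseteq> extensional J" "\<And>A' l. finite A' \<Longrightarrow> A \<subseteq> A' \<Longrightarrow> A' \<subseteq> extensional J \<Longrightarrow> functional Z l \<Longrightarrow>
      l y = (\<Sum>a\<in>A'. l (tau (monomial a) (coefficient a y)))" using add(3) by blast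
    obtain B where B: "finite B" "B \<subseteq> extensional J" "\<And>A' l. finite A' \<Longrightarrow> B \<subseteq> A' \<Longrightarrow> A' \<subseteq> extensional J \<Longrightarrow> functional Z l \<Longrightarrow>
      l z = (\<Sum>a\<in>A'. l (tau (monomial a) (coefficient a z)))" using add(4) by blast
    show ?case
    proof (intro exI[of _ "A \<union> B"] conjI allI impI)
      fix A' l assume *: "finite A'" "A \<union> B \<subseteq> A'" "A' \<subseteq> extensional J" "functional Z l"
      have "l (y \<oplus>\<^bsub>Z\<^esub> z) = l y + l z" using linear_mapD(2)[OF *(4) add(1,2)] by simp
      also have "\<dots> = (\<Sum>a\<in>A'. l (tau (monomial a) (coefficient a y)) + l (tau (monomial a) (coefficient a z)))"
        using A(3)[of A' l] B(3)[of A' l] * by (simp add: sum.distrib)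
      also have "\<dots> = (\<Sum>a\<in>A'. l (tau (monomial a) (coefficient a (y \<oplus>\<^bsub>Z\<^esub> z))))"
        using linear_mapD(2)[OF lin[OF *(4)]] Q add by (intro sum.cong) simp_all
      finally show "l (y \<oplus>\<^bsub>Z\<^esub> z) = (\<Sum>a\<in>A'. l (tau (monomial a) (coefficient a (y \<oplus>\<^bsub>Z\<^esub> z))))" .
    qed (use A B in auto)
  next
    case zero
    show ?case
    proof (intro exI[of _ "{}"] conjI allI impI)
      fix A' l assume l: "functional Z l"
      show "l \<zero>\<^bsub>Z\<^esub> = (\<Sum>a\<in>A'. l (tau (monomial a) (coefficient a \<zero>\<^bsub>Z\<^esub>)))"
        by (simp add: functional_zero[OF l complex_space_Z] functional_zero[OF lin[OF l] Z.W.complex_space_axioms]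
          linear_map_zero[OF linear_coefficient complex_space_Z Z.W.complex_space_axioms])
    qed simp_all
  next
    case (scale c z)
    obtain A where A: "finite A" "A \<subseteq> extensional J" "\<And>A' l. finite A' \<Longrightarrow> A \<subseteq> A' \<Longrightarrow> A' \<subseteq> extensional J \<Longrightarrow> functional Z l \<Longrightarrow>
      l z = (\<Sum>a\<in>A'. l (tau (monomial a) (coefficient a z)))" using scale(2) by blast
    show ?case
    proof (intro exI[of _ A] conjI allI impI)
      fix A' l assume *: "finite A'" "A \<subseteq> A'" "A' \<subseteq> extensional J" "functional Z l"
      have "l (c \<odot>\<^bsub>Z\<^esub> z) = c * l z" using linear_mapD(3)[OF *(4) scale(1)] by simp
      also have "\<dots> = (\<Sum>a\<in>A'. c * l (tau (monomial a) (coefficient a z)))"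
        using A(3)[of A' l] * by (simp add: sum_distrib_left)
      also have "\<dots> = (\<Sum>a\<in>A'. l (tau (monomial a) (coefficient a (c \<odot>\<^bsub>Z\<^esub> z))))"
        using linear_mapD(3)[OF lin[OF *(4)]] Q scale by (intro sum.cong) simp_all
      finally show "l (c \<odot>\<^bsub>Z\<^esub> z) = (\<Sum>a\<in>A'. l (tau (monomial a) (coefficient a (c \<odot>\<^bsub>Z\<^esub> z))))" .
    qed (use A in auto)
  qed
  obtain A where A: "finite A" "A \<subseteq> extensional J" "\<And>A' l. finite A' \<Longrightarrow> A \<subseteq> A' \<Longrightarrow> A' \<subseteq> extensional J \<Longrightarrow> functional Z l \<Longrightarrow>
      l z = (\<Sum>a\<in>A'. l (tau (monomial a) (coefficient a z)))" using good[OF assms(1)] by blast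
  obtain B where B: "finite B" "B \<subseteq> extensional J" "\<And>A' l. finite A' \<Longrightarrow> B \<subseteq> A' \<Longrightarrow> A' \<subseteq> extensional J \<Longrightarrow> functional Z l \<Longrightarrow>
      l z' = (\<Sum>a\<in>A'. l (tau (monomial a) (coefficient a z')))" using good[OF assms(2)] by blast
  show ?thesis
  proof (rule functionals_separate[OF complex_space_Z assms(1,2)])
    fix l assume l: "functional Z l"
    have "(\<Sum>a\<in>A \<union> B. l (tau (monomial a) (coefficient a z))) = (\<Sum>a\<in>A \<union> B. l (tau (monomial a) (coefficient a z')))"
      by (rule sum.cong) (use assms(3) A B in auto)
    then show "l z = l z'" using A(3)[of "A \<union> B" l] B(3)[of "A \<union> B" l] A(1,2) B(1,2) l by simp
  qed
qed

end

context omega_tensor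
begin

text \<open>
  The coefficient at the leading exponents is a nonzero multiple of \<open>v\<close>.
\<close>

lemma tau_nonzero:
  assumes "f \<in> extensional J" "v \<in> carrier V" "v \<noteq> \<zero>\<^bsub>V\<^esub>" "\<And>i. i \<in> J \<Longrightarrow> f i \<noteq> 0"
  shows "tau f v \<noteq> \<zero>\<^bsub>Z\<^esub>"
proof
  assume *: "tau f v = \<zero>\<^bsub>Z\<^esub>"
  let ?a = "\<lambda>i. degree (f i)" and ?c = "\<Prod>i\<in>J. lead_coeff (f i)"
  have c: "?c \<noteq> 0" using assms(4) finite_J by simp
  have "?c \<odot>\<^bsub>V\<^esub> v = \<zero>\<^bsub>V\<^esub>"
    using coefficient_tau[OF assms(1,2), of ?a] *
      linear_map_zero[OF linear_coefficient complex_space_Z Z.W.complex_space_axioms] by simp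
  then have "inverse ?c \<odot>\<^bsub>V\<^esub> (?c \<odot>\<^bsub>V\<^esub> v) = \<zero>\<^bsub>V\<^esub>" by simp
  then show False using assms(2,3) c by (simp add: Z.W.smult_smult)
qed

subsection \<open>Expansions of the action on the tensor product\<close>

text \<open>
  By the Leibniz rule the action on a decomposable tensor is a sum over the positions, and the
  position \<open>i\<close> contributes the frequency \<open>lam i\<close>; the last factor
  contributes nothing once \<open>k\<close> is large. As the frequencies are distinct, the
  contributions do not mix.
\<close>

lemma tau_expansion:
  assumes f: "f \<in> extensional J" and v: "v \<in> carrier V"
    and g: "\<And>i k. i \<in> J \<Longrightarrow>
      act (Om i) (g k) (f i) = Polynomial.smult (lam i ^ k) (\<Sum>j\<le>D i. Polynomial.smult (of_nat k ^ j) (t i j))"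
    and t: "\<And>i j. i \<in> J \<Longrightarrow> j > D i \<Longrightarrow> t i j = 0"
    and K: "\<And>k. k \<ge> K \<Longrightarrow> act V (g k) v = \<zero>\<^bsub>V\<^esub>"
  shows "action_expansion Z g (tau f v)
    (\<lambda>\<nu> j. if \<nu> \<in> lam ` J then tau (f(inv_into J lam \<nu> := t (inv_into J lam \<nu>) j)) v else \<zero>\<^bsub>Z\<^esub>)"
  (is "action_expansion Z g _ ?r")
proof -
  have "?r \<nu> j \<in> carrier Z" for \<nu> j
    using f v inj_lam by (auto intro!: tau_closed ext_upd)
  moreover have "exponential_expansion (\<lambda>k. l (act Z (g k) (tau f v))) (\<lambda>\<nu> j. l (?r \<nu> j))" if l: "functional Z l" for l
  proof -
    define h where "h i p = l (tau (f(i := p)) v)" for i p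
    have h: "functional (Om i) (h i)" if "i \<in> J" for i
      unfolding h_def by (rule linear_map_comp[OF linear_map_tau_slot[OF f that v] l])
    have hz: "h i 0 = 0" if "i \<in> J" for i
      using functional_zero[OF h[OF that] acts_linearlyD(1)[OF acts_linearly_Omega]] by simp
    have hsum: "h i (\<Sum>j\<in>S. p j) = (\<Sum>j\<in>S. h i (p j))" if "i \<in> J" for i p and S :: "nat set"
      by (induction S rule: infinite_finite_induct)
        (use hz[OF that] linear_mapD(2)[OF h[OF that]] in simp_all)
    have slot: "h i (act (Om i) (g k) (f i)) = lam i ^ k * (\<Sum>j\<le>D i. of_nat k ^ j * h i (t i j))" if "i \<in> J" for i k
      using linear_mapD(3)[OF h[OF that]] by (simp add: g[OF that] hsum[OF that])
    have "exponential_expansion (\<lambda>k. \<Sum>i\<in>J. lam i ^ k * (\<Sum>j\<le>D i. of_nat k ^ j * h i (t i j)))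
        (\<lambda>\<nu> j. \<Sum>i\<in>J. if \<nu> = lam i then h i (t i j) else 0)"
      by (intro exponential_expansion_sum[OF finite_J] exponential_expansion_term lam_nonzero)
        (simp_all add: t hz)
    moreover have "exponential_expansion (\<lambda>k. l (tau f (act V (g k) v))) (\<lambda>_ _. 0)"
      using functional_zero[OF linear_map_comp[OF linear_map_tau[OF f] l] Z.W.complex_space_axioms] K
      by (intro exponential_expansion_eventually_zero[of K]) simp
    ultimately have *: "exponential_expansion
        (\<lambda>k. (\<Sum>i\<in>J. lam i ^ k * (\<Sum>j\<le>D i. of_nat k ^ j * h i (t i j))) + l (tau f (act V (g k) v)))
        (\<lambda>\<nu> j. (\<Sum>i\<in>J. if \<nu> = lam i then h i (t i j) else 0) + 0)"
      by (rule exponential_expansion_add)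
    have "l (act Z (g k) (tau f v)) =
        (\<Sum>i\<in>J. lam i ^ k * (\<Sum>j\<le>D i. of_nat k ^ j * h i (t i j))) + l (tau f (act V (g k) v))" for k
      using slot by (simp add: functional_act_tau[OF l f v] h_def)
    moreover have "(\<Sum>i\<in>J. if \<nu> = lam i then h i (t i j) else 0) + 0 = l (?r \<nu> j)" for \<nu> j
    proof (cases "\<nu> \<in> lam ` J")
      case True
      then obtain i where i: "i \<in> J" "\<nu> = lam i" by auto
      have "(\<Sum>i'\<in>J. if \<nu> = lam i' then h i' (t i' j) else 0) = (\<Sum>i'\<in>J. if i' = i then h i (t i j) else 0)"
        by (rule sum.cong) (use i inj_lam in \<open>auto simp: inj_on_def\<close>)
      then show ?thesis using i finite_J inj_lam by (simp add: h_def)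
    next
      case False
      have "(\<Sum>i\<in>J. if \<nu> = lam i then h i (t i j) else 0) = 0"
        by (rule sum.neutral) (use False in auto)
      then show ?thesis using functional_zero[OF l complex_space_Z] False by simp
    qed
    ultimately show ?thesis using * by simp
  qed
  ultimately show ?thesis unfolding action_expansion_def by blast
qed

lemma tau_expansion_L:
  assumes f: "f \<in> extensional J" and v: "v \<in> carrier V"
  shows "\<exists>r. action_expansion Z L_seq (tau f v) r \<and>
    (\<forall>i\<in>J. r (lam i) 0 = tau (f(i := [:0, 1:] * f i)) v \<and>
      r (lam i) 1 = tau (f(i := Polynomial.smult (alpha i) (f i) - [:0, 1:] * pderiv (f i))) v) \<and>
    (\<forall>\<nu> j. \<nu> \<notin> lam ` J \<longrightarrow> r \<nu> j = \<zero>\<^bsub>Z\<^esub>)"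
proof -
  have "\<exists>D t. t 0 = [:0, 1:] * f i \<and> t 1 = Polynomial.smult (alpha i) (f i) - [:0, 1:] * pderiv (f i) \<and> (\<forall>j>D. t j = 0) \<and>
    (\<forall>k. [:of_nat k * alpha i, 1:] * pcompose (f i) [:- of_nat k, 1:] = (\<Sum>j\<le>D. Polynomial.smult (of_nat k ^ j) (t j)))" for i
    by (rule shift_expansion_twisted)
  then obtain D t where t: "\<And>i. t i 0 = [:0, 1:] * f i"
      "\<And>i. t i 1 = Polynomial.smult (alpha i) (f i) - [:0, 1:] * pderiv (f i)"
      "\<And>i j. j > D i \<Longrightarrow> t i j = 0"
      "\<And>i k. [:of_nat k * alpha i, 1:] * pcompose (f i) [:- of_nat k, 1:] =
        (\<Sum>j\<le>D i. Polynomial.smult (of_nat k ^ j) (t i j))"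
    by metis
  have act: "act (Om i) (L_seq k) (f i) =
      Polynomial.smult (lam i ^ k) (\<Sum>j\<le>D i. Polynomial.smult (of_nat k ^ j) (t i j))" for i k
    unfolding t(4)[symmetric] by (simp del: mult_pCons_left)
  obtain K where "\<And>k. k \<ge> K \<Longrightarrow> act V (L_seq k) v = \<zero>\<^bsub>V\<^esub>"
    using restricted_V v unfolding restricted_def eventually_killed_def by blast
  note E = tau_expansion[OF f v act t(3) this]
  show ?thesis
    by (rule exI, rule conjI, rule E) (use inj_lam t(1,2) in auto)
qed

lemma tau_expansion_I:
  assumes f: "f \<in> extensional J" and v: "v \<in> carrier V"
  shows "\<exists>r. action_expansion Z I_seq (tau f v) r \<and>
    (\<forall>i\<in>J. r (lam i) 0 = beta i \<odot>\<^bsub>Z\<^esub> tau f v)"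
proof -
  have "\<exists>D t. t 0 = f i \<and> t 1 = - pderiv (f i) \<and> (\<forall>j>D. t j = 0) \<and>
    (\<forall>k. pcompose (f i) [:- of_nat k, 1:] = (\<Sum>j\<le>D. Polynomial.smult (of_nat k ^ j) (t j)))" for i
    by (rule shift_expansion)
  then obtain D t where t: "\<And>i. t i 0 = f i" "\<And>i j. j > D i \<Longrightarrow> t i j = 0"
      "\<And>i k. pcompose (f i) [:- of_nat k, 1:] = (\<Sum>j\<le>D i. Polynomial.smult (of_nat k ^ j) (t i j))"
    by metis
  have act: "act (Om i) (I_seq k) (f i) =
      Polynomial.smult (lam i ^ k) (\<Sum>j\<le>D i. Polynomial.smult (of_nat k ^ j) (Polynomial.smult (beta i) (t i j)))" for i k
  proof -
    have "(\<Sum>j\<le>D i. Polynomial.smult (of_nat k ^ j) (Polynomial.smult (beta i) (t i j))) =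
        Polynomial.smult (beta i) (pcompose (f i) [:- of_nat k, 1:])"
      by (simp add: t(3) smult_sum_right mult.commute)
    then show ?thesis by simp
  qed
  obtain K where "\<And>k. k \<ge> K \<Longrightarrow> act V (I_seq k) v = \<zero>\<^bsub>V\<^esub>"
    using restricted_V v unfolding restricted_def eventually_killed_def by blast
  moreover have "Polynomial.smult (beta i) (t i j) = 0" if "j > D i" for i j
    using t(2)[OF that] by simp
  ultimately have E: "action_expansion Z I_seq (tau f v) (\<lambda>\<nu> j. if \<nu> \<in> lam ` J
      then tau (f(inv_into J lam \<nu> := Polynomial.smult (beta (inv_into J lam \<nu>)) (t (inv_into J lam \<nu>) j))) v
      else \<zero>\<^bsub>Z\<^esub>)"
    by (intro tau_expansion[OF f v act])
  have "tau (f(i := Polynomial.smult (beta i) (f i))) v = beta i \<odot>\<^bsub>Z\<^esub> tau f v" if "i \<in> J" for i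
    using linear_mapD(3)[OF linear_map_tau_slot[OF f that v], of "f i" "beta i"] by simp
  then show ?thesis
    using E by - (rule exI, rule conjI, assumption, use inj_lam t(1,2) in auto)
qed

text \<open>
  The operator in the \<open>i\<close>-th variable has the monomials as eigenvectors, with
  eigenvalues \<open>alpha i - of_nat (a i)\<close>.
\<close>

lemma coefficient_euler:
  assumes f: "f \<in> extensional J" and v: "v \<in> carrier V" and i: "i \<in> J"
  shows "coefficient a (tau (f(i := Polynomial.smult (alpha i) (f i) - [:0, 1:] * pderiv (f i))) v) =
    (alpha i - of_nat (a i)) \<odot>\<^bsub>V\<^esub> coefficient a (tau f v)"
proof -
  let ?p = "Polynomial.smult (alpha i) (f i) - [:0, 1:] * pderiv (f i)"
  have "coeff ([:0, 1:] * pderiv (f i)) n = of_nat n * coeff (f i) n" for n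
    by (cases n) (simp_all add: coeff_pCons coeff_pderiv)
  then have p: "coeff ?p (a i) = (alpha i - of_nat (a i)) * coeff (f i) (a i)"
    by (simp add: left_diff_distrib)
  have "(\<Prod>j\<in>J. coeff ((f(i := ?p)) j) (a j)) = coeff ?p (a i) * (\<Prod>j\<in>J - {i}. coeff (f j) (a j))"
    by (subst prod.remove[OF finite_J i]) (auto intro!: prod.cong)
  also have "\<dots> = (alpha i - of_nat (a i)) * (\<Prod>j\<in>J. coeff (f j) (a j))"
    using prod.remove[OF finite_J i, of "\<lambda>j. coeff (f j) (a j)"] p by simp
  finally show ?thesis using f v i by (simp add: coefficient_tau Z.W.smult_smult del: fun_upd_apply)
qed

text \<open>
  On all of \<open>Z\<close>, the coefficient of \<open>k * lam i ^ k\<close> acts diagonally on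
  the monomials, and no frequency other than the \<open>lam i\<close> occurs.
\<close>

lemma expansion_L:
  assumes "z \<in> carrier Z"
  shows "\<exists>r. action_expansion Z L_seq z r \<and>
    (\<forall>i\<in>J. \<forall>a. coefficient a (r (lam i) 1) = (alpha i - of_nat (a i)) \<odot>\<^bsub>V\<^esub> coefficient a z) \<and>
    (\<forall>\<nu> j. \<nu> \<notin> lam ` J \<longrightarrow> r \<nu> j = \<zero>\<^bsub>Z\<^esub>)"
  using assms
proof (induction z rule: monomial_induct)
  case (monomial a v)
  have f: "monomial a \<in> extensional J" by simp
  obtain r where r: "action_expansion Z L_seq (tau (monomial a) v) r"
    "\<forall>i\<in>J. r (lam i) 1 = tau ((monomial a)(i := Polynomial.smult (alpha i) (monomial a i) -
      [:0, 1:] * pderiv (monomial a i))) v"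
    "\<forall>\<nu> j. \<nu> \<notin> lam ` J \<longrightarrow> r \<nu> j = \<zero>\<^bsub>Z\<^esub>"
    using tau_expansion_L[OF f monomial] by blast
  have "\<forall>i\<in>J. \<forall>b. coefficient b (r (lam i) 1) =
      (alpha i - of_nat (b i)) \<odot>\<^bsub>V\<^esub> coefficient b (tau (monomial a) v)"
    using r(2) coefficient_euler[OF f monomial] by metis
  then show ?case using r(1,3) by blast
next
  case (add y z)
  obtain r where r: "action_expansion Z L_seq y r"
    "\<And>i a. i \<in> J \<Longrightarrow> coefficient a (r (lam i) 1) = (alpha i - of_nat (a i)) \<odot>\<^bsub>V\<^esub> coefficient a y"
    "\<And>\<nu> j. \<nu> \<notin> lam ` J \<Longrightarrow> r \<nu> j = \<zero>\<^bsub>Z\<^esub>" using add(3) by blast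
  obtain s where s: "action_expansion Z L_seq z s"
    "\<And>i a. i \<in> J \<Longrightarrow> coefficient a (s (lam i) 1) = (alpha i - of_nat (a i)) \<odot>\<^bsub>V\<^esub> coefficient a z"
    "\<And>\<nu> j. \<nu> \<notin> lam ` J \<Longrightarrow> s \<nu> j = \<zero>\<^bsub>Z\<^esub>" using add(4) by blast
  have c: "r \<nu> j \<in> carrier Z" "s \<nu> j \<in> carrier Z" for \<nu> j
    using r(1) s(1) by (auto simp: action_expansion_def)
  show ?case
  proof (intro exI conjI ballI allI impI)
    show "action_expansion Z L_seq (y \<oplus>\<^bsub>Z\<^esub> z) (\<lambda>\<nu> j. r \<nu> j \<oplus>\<^bsub>Z\<^esub> s \<nu> j)"
      by (rule action_expansion_add[OF Z.acts_linearly_tensor]) (use add r s in simp_all)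
    show "coefficient a (r (lam i) 1 \<oplus>\<^bsub>Z\<^esub> s (lam i) 1) = (alpha i - of_nat (a i)) \<odot>\<^bsub>V\<^esub> coefficient a (y \<oplus>\<^bsub>Z\<^esub> z)"
      if "i \<in> J" for i a
      using r(2)[OF that] s(2)[OF that] c linear_mapD(1,2)[OF linear_coefficient] add(1,2)
      by (simp add: Z.W.smult_oplus)
    show "r \<nu> j \<oplus>\<^bsub>Z\<^esub> s \<nu> j = \<zero>\<^bsub>Z\<^esub>" if "\<nu> \<notin> lam ` J" for \<nu> j
      using r(3)[OF that] s(3)[OF that] by simp
  qed
next
  case zero
  have "coefficient a \<zero>\<^bsub>Z\<^esub> = \<zero>\<^bsub>V\<^esub>" for a
    by (rule linear_map_zero[OF linear_coefficient complex_space_Z Z.W.complex_space_axioms])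
  then show ?case
    by (intro exI[of _ "\<lambda>_ _. \<zero>\<^bsub>Z\<^esub>"] conjI action_expansion_zero[OF Z.acts_linearly_tensor]) simp_all
next
  case (scale c z)
  obtain s where s: "action_expansion Z L_seq z s"
    "\<And>i a. i \<in> J \<Longrightarrow> coefficient a (s (lam i) 1) = (alpha i - of_nat (a i)) \<odot>\<^bsub>V\<^esub> coefficient a z"
    "\<And>\<nu> j. \<nu> \<notin> lam ` J \<Longrightarrow> s \<nu> j = \<zero>\<^bsub>Z\<^esub>" using scale(2) by blast
  have c: "s \<nu> j \<in> carrier Z" for \<nu> j
    using s(1) by (auto simp: action_expansion_def)
  show ?case
  proof (intro exI conjI ballI allI impI)
    show "action_expansion Z L_seq (c \<odot>\<^bsub>Z\<^esub> z) (\<lambda>\<nu> j. c \<odot>\<^bsub>Z\<^esub> s \<nu> j)"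
      by (rule action_expansion_scale[OF Z.acts_linearly_tensor]) (use scale s in simp_all)
    show "coefficient a (c \<odot>\<^bsub>Z\<^esub> s (lam i) 1) = (alpha i - of_nat (a i)) \<odot>\<^bsub>V\<^esub> coefficient a (c \<odot>\<^bsub>Z\<^esub> z)"
      if "i \<in> J" for i a
      using s(2)[OF that] c linear_mapD(1,3)[OF linear_coefficient] scale(1)
      by (simp add: Z.W.smult_smult mult.commute)
    show "c \<odot>\<^bsub>Z\<^esub> s \<nu> j = \<zero>\<^bsub>Z\<^esub>" if "\<nu> \<notin> lam ` J" for \<nu> j
      using s(3)[OF that] by simp
  qed
qed

lemma expansion_I:
  assumes "z \<in> carrier Z"
  shows "\<exists>r. action_expansion Z I_seq z r \<and> (\<forall>i\<in>J. r (lam i) 0 = beta i \<odot>\<^bsub>Z\<^esub> z)"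
  using assms
proof (induction z rule: monomial_induct)
  case (monomial a v)
  show ?case by (rule tau_expansion_I) (use monomial in simp_all)
next
  case (add y z)
  obtain r where r: "action_expansion Z I_seq y r" "\<forall>i\<in>J. r (lam i) 0 = beta i \<odot>\<^bsub>Z\<^esub> y" using add(3) by blast
  obtain s where s: "action_expansion Z I_seq z s" "\<forall>i\<in>J. s (lam i) 0 = beta i \<odot>\<^bsub>Z\<^esub> z" using add(4) by blast
  have "action_expansion Z I_seq (y \<oplus>\<^bsub>Z\<^esub> z) (\<lambda>\<nu> j. r \<nu> j \<oplus>\<^bsub>Z\<^esub> s \<nu> j)"
    by (rule action_expansion_add[OF Z.acts_linearly_tensor]) (use add r s in simp_all)
  then show ?case using r(2) s(2) add(1,2) by (intro exI conjI) (assumption, simp add: ZC.smult_oplus)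
next
  case zero
  show ?case
    by (intro exI[of _ "\<lambda>_ _. \<zero>\<^bsub>Z\<^esub>"] conjI action_expansion_zero[OF Z.acts_linearly_tensor]) simp_all
next
  case (scale c z)
  obtain s where s: "action_expansion Z I_seq z s" "\<forall>i\<in>J. s (lam i) 0 = beta i \<odot>\<^bsub>Z\<^esub> z" using scale(2) by blast
  have "action_expansion Z I_seq (c \<odot>\<^bsub>Z\<^esub> z) (\<lambda>\<nu> j. c \<odot>\<^bsub>Z\<^esub> s \<nu> j)"
    by (rule action_expansion_scale[OF Z.acts_linearly_tensor]) (use scale s in simp_all)
  then show ?case using s(2) scale(1)
    by (intro exI conjI) (assumption, simp add: ZC.smult_smult mult.commute)
qed

abbreviation "one_family \<equiv> restrict (\<lambda>_. 1 :: complex poly) J"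

lemma tau_affine:
  assumes i: "i \<in> J" and v: "v \<in> carrier V"
  shows "tau (one_family(i := [:s, t:])) v =
    s \<odot>\<^bsub>Z\<^esub> tau one_family v \<oplus>\<^bsub>Z\<^esub> t \<odot>\<^bsub>Z\<^esub> tau (one_family(i := [:0, 1:])) v"
proof -
  have p: "[:s, t:] = Polynomial.smult s 1 + Polynomial.smult t [:0, 1:]" by simp
  have one: "one_family(i := 1) = one_family" using i by (simp add: fun_upd_idem)
  note lin = linear_mapD[OF linear_map_tau_slot[OF restrict_extensional i v], simplified Omega_simps, OF UNIV_I]
  have "tau (one_family(i := [:s, t:])) v = tau (one_family(i := Polynomial.smult s 1)) v \<oplus>\<^bsub>Z\<^esub>
      tau (one_family(i := Polynomial.smult t [:0, 1:])) v"
    unfolding p by (rule lin(2)) (rule UNIV_I)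
  then show ?thesis by (simp only: lin(3) one)
qed

end

section \<open>Recovering the parameters and the tensor factor\<close>

text \<open>
  The isomorphism \<open>\<phi>\<close> commutes with all coefficient operators; they are compared
  on the image of \<open>1 \<otimes> v\<close>. The coefficient of \<open>lam i ^ k\<close> in the
  action of \<open>L k\<close> is multiplication by the \<open>i\<close>-th variable, which is not
  zero, so the frequency must occur on the other side. In the action of \<open>I k\<close> the
  coefficient is the scalar \<open>beta i\<close>. Finally \<open>1 \<otimes> v\<close> is an
  eigenvector of the coefficient of \<open>k * lam i ^ k\<close> with eigenvalue \<open>alpha
  i\<close>, which on the other side must be one of the eigenvalues \<open>c j - of_nat n\<close>.
  Applied in both directions, this forces \<open>n = 0\<close>.
\<close>

lemma parameters_recovered:
  fixes J :: "'i set" and J' :: "'j set" and lam alpha beta :: "'i \<Rightarrow> complex" and mu c d :: "'j \<Rightarrow> complex"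
    and V :: "(hv, 'v) lie_module" and W :: "(hv, 'w) lie_module"
  assumes O1: "omega_tensor J lam V" and O2: "omega_tensor J' mu W"
  defines "Z1 \<equiv> tensor_module (tensor_family J (\<lambda>i. Omega (lam i) (alpha i) (beta i))) V"
    and "Z2 \<equiv> tensor_module (tensor_family J' (\<lambda>i. Omega (mu i) (c i) (d i))) W"
  assumes phi: "linear_map Z1 Z2 \<phi>"
    and psi: "linear_map Z2 Z1 \<psi>" "\<And>z. z \<in> carrier Z1 \<Longrightarrow> \<psi> (\<phi> z) = z"
    and act: "\<And>x z. z \<in> carrier Z1 \<Longrightarrow> \<phi> (act Z1 x z) = act Z2 x (\<phi> z)"
    and v: "v \<in> carrier V" "v \<noteq> \<zero>\<^bsub>V\<^esub>" and i: "i \<in> J"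
  shows "\<exists>j\<in>J'. mu j = lam i \<and> d j = beta i \<and> (\<exists>n. alpha i = c j - of_nat n)"
proof -
  interpret A: omega_tensor J lam alpha beta V by fact
  interpret B: omega_tensor J' mu c d W by fact
  let ?Z = A.Z and ?Z' = B.Z
  note phi = phi[unfolded Z1_def Z2_def] and psi = psi[unfolded Z1_def Z2_def] and act = act[unfolded Z1_def Z2_def]
  let ?z = "A.tau A.one_family v"
  have z: "?z \<in> carrier ?Z" using v by simp
  have nz: "?z \<noteq> \<zero>\<^bsub>?Z\<^esub>" by (rule A.tau_nonzero) (use v in simp_all)
  have inj: "\<phi> y \<noteq> \<zero>\<^bsub>?Z'\<^esub>" if "y \<in> carrier ?Z" "y \<noteq> \<zero>\<^bsub>?Z\<^esub>" for y
    using psi(2)[OF that(1)] linear_map_zero[OF psi(1) B.complex_space_Z A.complex_space_Z] that(2) by auto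
  have transport: "action_expansion ?Z' g (\<phi> ?z) (\<lambda>\<nu> j. \<phi> (r \<nu> j))" if "action_expansion ?Z g ?z r" for g r
    by (rule action_expansion_transport[of ?Z ?Z' \<phi> HV]) (use phi act z that in simp_all)
  note unique = action_expansion_unique[OF B.complex_space_Z]
  have \<phi>z: "\<phi> ?z \<in> carrier ?Z'" using linear_mapD(1)[OF phi z] .
  obtain r where r: "action_expansion ?Z L_seq ?z r"
    "\<And>i. i \<in> J \<Longrightarrow> r (lam i) 0 = A.tau (A.one_family(i := [:0, 1:] * A.one_family i)) v"
    "\<And>i. i \<in> J \<Longrightarrow> r (lam i) 1 = A.tau (A.one_family(i := Polynomial.smult (alpha i) (A.one_family i) - [:0, 1:] * pderiv (A.one_family i))) v"
    using A.tau_expansion_L[of A.one_family v] v by auto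
  obtain s where s: "action_expansion ?Z' L_seq (\<phi> ?z) s"
    "\<And>i a. i \<in> J' \<Longrightarrow> B.coefficient a (s (mu i) 1) = (c i - of_nat (a i)) \<odot>\<^bsub>W\<^esub> B.coefficient a (\<phi> ?z)"
    "\<And>\<nu> j. \<nu> \<notin> mu ` J' \<Longrightarrow> s \<nu> j = \<zero>\<^bsub>?Z'\<^esub>"
    using B.expansion_L[OF \<phi>z] by blast
  have rs: "s \<nu> j = \<phi> (r \<nu> j)" for \<nu> j
    using unique[OF s(1) transport[OF r(1)]] by (simp add: fun_eq_iff)
  have "r (lam i) 0 \<in> carrier ?Z" "r (lam i) 0 \<noteq> \<zero>\<^bsub>?Z\<^esub>"
    unfolding r(2)[OF i] by (rule A.tau_closed A.tau_nonzero; use v i in simp)+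
  then have "s (lam i) 0 \<noteq> \<zero>\<^bsub>?Z'\<^esub>" unfolding rs by (rule inj)
  then have "lam i \<in> mu ` J'" using s(3) by blast
  then obtain j where j: "j \<in> J'" "mu j = lam i" by auto
  obtain p where p: "action_expansion ?Z I_seq ?z p" "\<And>i. i \<in> J \<Longrightarrow> p (lam i) 0 = beta i \<odot>\<^bsub>?Z\<^esub> ?z"
    using A.expansion_I[OF z] by blast
  obtain q where q: "action_expansion ?Z' I_seq (\<phi> ?z) q" "\<And>i. i \<in> J' \<Longrightarrow> q (mu i) 0 = d i \<odot>\<^bsub>?Z'\<^esub> \<phi> ?z"
    using B.expansion_I[OF \<phi>z] by blast
  have "q (mu j) 0 = \<phi> (p (lam i) 0)"
    using unique[OF q(1) transport[OF p(1)]] j(2) by (simp add: fun_eq_iff)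
  then have "d j \<odot>\<^bsub>?Z'\<^esub> \<phi> ?z = beta i \<odot>\<^bsub>?Z'\<^esub> \<phi> ?z"
    using q(2)[OF j(1)] p(2)[OF i] linear_mapD(3)[OF phi z] by simp
  then have d: "d j = beta i" by (rule smult_cancel[OF B.complex_space_Z \<phi>z inj[OF z nz]])
  have "r (lam i) 1 = alpha i \<odot>\<^bsub>?Z\<^esub> ?z"
    unfolding r(3)[OF i]
    using linear_mapD(3)[OF A.linear_map_tau_slot[OF _ i v(1)], of A.one_family 1 "alpha i"] i
    by (simp add: pderiv_1 fun_upd_idem)
  then have s1: "s (mu j) 1 = alpha i \<odot>\<^bsub>?Z'\<^esub> \<phi> ?z"
    using linear_mapD(3)[OF phi z] by (simp add: rs j)
  obtain a where a: "B.coefficient a (\<phi> ?z) \<noteq> \<zero>\<^bsub>W\<^esub>"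
  proof -
    have "\<exists>a. B.coefficient a (\<phi> ?z) \<noteq> B.coefficient a \<zero>\<^bsub>?Z'\<^esub>"
      using B.coefficients_separate[OF \<phi>z, of "\<zero>\<^bsub>?Z'\<^esub>"] inj[OF z nz] by auto
    then show ?thesis
      using that linear_map_zero[OF B.linear_coefficient B.complex_space_Z B.Z.W.complex_space_axioms] by auto
  qed
  have "(c j - of_nat (a j)) \<odot>\<^bsub>W\<^esub> B.coefficient a (\<phi> ?z) = alpha i \<odot>\<^bsub>W\<^esub> B.coefficient a (\<phi> ?z)"
    using s(2)[OF j(1), of a] s1 linear_mapD(3)[OF B.linear_coefficient \<phi>z] by simp
  then have "c j - of_nat (a j) = alpha i"
    by (rule smult_cancel[OF B.Z.W.complex_space_axioms linear_mapD(1)[OF B.linear_coefficient \<phi>z] a])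
  then show ?thesis using j d by metis
qed

text \<open>
  The vectors \<open>1 \<otimes> v\<close> are the joint eigenvectors, with eigenvalues
  \<open>alpha i\<close>, of the coefficients of \<open>k * lam i ^ k\<close>; so
  \<open>\<phi>\<close> sends them to vectors of the same form. Moreover \<open>\<phi>\<close>
  commutes with multiplication by each variable, and \<open>x \<cdot> (1 \<otimes> v) - 1
  \<otimes> x \<cdot> v\<close> involves only polynomials of degree at most one in a single
  variable. Subtracting these terms shows that the induced map of the last factors is a
  homomorphism.
\<close>

lemma vacuum_preserved:
  fixes J :: "'i set" and lam alpha beta :: "'i \<Rightarrow> complex"
    and V :: "(hv, 'v) lie_module" and W :: "(hv, 'w) lie_module"
  assumes O1: "omega_tensor J lam V" and O2: "omega_tensor J lam W"
  defines "Z1 \<equiv> tensor_module (tensor_family J (\<lambda>i. Omega (lam i) (alpha i) (beta i))) V"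
    and "Z2 \<equiv> tensor_module (tensor_family J (\<lambda>i. Omega (lam i) (alpha i) (beta i))) W"
  assumes phi: "linear_map Z1 Z2 \<phi>"
    and act: "\<And>x z. z \<in> carrier Z1 \<Longrightarrow> \<phi> (act Z1 x z) = act Z2 x (\<phi> z)"
  shows "\<exists>\<psi>. linear_map V W \<psi> \<and> (\<forall>v\<in>carrier V.
    \<phi> (omega_tensor.tau J lam alpha beta V (restrict (\<lambda>_. 1) J) v) =
    omega_tensor.tau J lam alpha beta W (restrict (\<lambda>_. 1) J) (\<psi> v) \<and>
    (\<forall>x. \<psi> (act V x v) = act W x (\<psi> v)))"
proof -
  interpret A: omega_tensor J lam alpha beta V by fact
  interpret B: omega_tensor J lam alpha beta W by fact
  let ?Z = A.Z and ?Z' = B.Z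
  note phi = phi[unfolded Z1_def Z2_def] and act = act[unfolded Z1_def Z2_def]
  let ?one = "A.one_family"
  define \<psi> where "\<psi> v = B.coefficient (restrict (\<lambda>_. 0) J) (\<phi> (A.tau ?one v))" for v
  have lin: "linear_map V W \<psi>"
    unfolding \<psi>_def
    by (rule linear_map_comp[OF linear_map_comp[OF A.linear_map_tau phi] B.linear_coefficient]) simp
  note \<psi>_closed = linear_mapD(1)[OF lin]
  have transport: "action_expansion ?Z' g (\<phi> z) (\<lambda>\<nu> j. \<phi> (r \<nu> j))" if "z \<in> carrier ?Z" "action_expansion ?Z g z r" for g z r
    by (rule action_expansion_transport[of ?Z ?Z' \<phi> HV]) (use phi act that in simp_all)
  note unique = action_expansion_unique[OF B.complex_space_Z]
  have coeff_one: "B.coefficient (restrict (\<lambda>_. 0) J) (B.tau ?one w) = w" if "w \<in> carrier W" for w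
    using that by (simp add: B.coefficient_tau)
  have vac: "\<phi> (A.tau ?one v) = B.tau ?one (\<psi> v)" if v: "v \<in> carrier V" for v
  proof (rule B.coefficients_separate)
    let ?z = "A.tau ?one v"
    have z: "?z \<in> carrier ?Z" using v by simp
    show \<phi>z: "\<phi> ?z \<in> carrier ?Z'" by (rule linear_mapD(1)[OF phi z])
    show "B.tau ?one (\<psi> v) \<in> carrier ?Z'" using \<psi>_closed[OF v] by simp
    fix a :: "'i \<Rightarrow> nat" assume a: "a \<in> extensional J"
    show "B.coefficient a (\<phi> ?z) = B.coefficient a (B.tau ?one (\<psi> v))"
    proof (cases "\<forall>i\<in>J. a i = 0")
      case True
      then have "a = restrict (\<lambda>_. 0) J" using a by (auto simp: extensional_def fun_eq_iff)
      then show ?thesis using coeff_one[OF \<psi>_closed[OF v]] by (simp add: \<psi>_def)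
    next
      case False
      then obtain i where i: "i \<in> J" "a i \<noteq> 0" by auto
      obtain r where r: "action_expansion ?Z L_seq ?z r"
        "r (lam i) 1 = A.tau (?one(i := Polynomial.smult (alpha i) (?one i) - [:0, 1:] * pderiv (?one i))) v"
        using A.tau_expansion_L[of ?one v] v i by auto
      obtain s where s: "action_expansion ?Z' L_seq (\<phi> ?z) s"
        "B.coefficient a (s (lam i) 1) = (alpha i - of_nat (a i)) \<odot>\<^bsub>W\<^esub> B.coefficient a (\<phi> ?z)"
        using B.expansion_L[OF \<phi>z] i by blast
      have "r (lam i) 1 = alpha i \<odot>\<^bsub>?Z\<^esub> ?z"
        unfolding r(2)
        using linear_mapD(3)[OF A.linear_map_tau_slot[OF _ i(1) v], of ?one 1 "alpha i"] i
        by (simp add: pderiv_1 fun_upd_idem)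
      then have "s (lam i) 1 = alpha i \<odot>\<^bsub>?Z'\<^esub> \<phi> ?z"
        using unique[OF s(1) transport[OF z r(1)]] linear_mapD(3)[OF phi z] by simp
      then have "(alpha i - of_nat (a i)) \<odot>\<^bsub>W\<^esub> B.coefficient a (\<phi> ?z) = alpha i \<odot>\<^bsub>W\<^esub> B.coefficient a (\<phi> ?z)"
        using s(2) linear_mapD(3)[OF B.linear_coefficient \<phi>z] by simp
      then have "B.coefficient a (\<phi> ?z) = \<zero>\<^bsub>W\<^esub>"
        using smult_cancel[OF B.Z.W.complex_space_axioms linear_mapD(1)[OF B.linear_coefficient \<phi>z], of a "alpha i - of_nat (a i)" "alpha i"] i
        by auto
      moreover have "(\<Prod>j\<in>J. coeff (?one j) (a j)) = 0"
        by (rule prod_zero[OF A.finite_J], rule bexI[of _ i]) (use i in \<open>simp_all add: coeff_1\<close>)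
      ultimately show ?thesis using \<psi>_closed[OF v] by (simp add: B.coefficient_tau)
    qed
  qed
  have vacX: "\<phi> (A.tau (?one(i := [:0, 1:])) v) = B.tau (?one(i := [:0, 1:])) (\<psi> v)"
    if v: "v \<in> carrier V" and i: "i \<in> J" for v i
  proof -
    obtain r where r: "action_expansion ?Z L_seq (A.tau ?one v) r"
      "r (lam i) 0 = A.tau (?one(i := [:0, 1:] * ?one i)) v"
      using A.tau_expansion_L[of ?one v] v i by auto
    obtain s where s: "action_expansion ?Z' L_seq (B.tau ?one (\<psi> v)) s"
      "s (lam i) 0 = B.tau (?one(i := [:0, 1:] * ?one i)) (\<psi> v)"
      using B.tau_expansion_L[of ?one "\<psi> v"] \<psi>_closed[OF v] i by auto
    have "s (lam i) 0 = \<phi> (r (lam i) 0)"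
      using unique[OF s(1), of "\<lambda>\<nu> j. \<phi> (r \<nu> j)"] transport[OF _ r(1)] v by (simp add: vac)
    then show ?thesis using r(2) s(2) i by simp
  qed
  have equiv: "\<psi> (act V x v) = act W x (\<psi> v)" if v: "v \<in> carrier V" for x v
  proof -
    have xv: "act V x v \<in> carrier V" "act W x (\<psi> v) \<in> carrier W"
      using acts_linearlyD(3)[OF A.acts_V] acts_linearlyD(3)[OF B.acts_V] v \<psi>_closed by simp_all
    have slot: "\<phi> (A.tau (?one(i := act (A.Om i) x 1)) v) = B.tau (?one(i := act (A.Om i) x 1)) (\<psi> v)" if i: "i \<in> J" for i
    proof -
      obtain s t where st: "act (A.Om i) x 1 = [:s, t:]"
        using act_Omega_one by blast
      show ?thesis
        unfolding st A.tau_affine[OF i v, of s t] B.tau_affine[OF i \<psi>_closed[OF v], of s t]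
          vac[OF v, symmetric] vacX[OF v i, symmetric]
        by (rule linear_map_affine[OF phi A.complex_space_Z]) (use v i in simp_all)
    qed
    have "B.tau ?one (\<psi> (act V x v)) = B.tau ?one (act W x (\<psi> v))"
    proof (rule functionals_separate[OF B.complex_space_Z])
      fix l assume l: "functional ?Z' l"
      have l': "functional ?Z (\<lambda>z. l (\<phi> z))" by (rule linear_map_comp[OF phi l])
      have "l (\<phi> (act ?Z x (A.tau ?one v))) = l (act ?Z' x (B.tau ?one (\<psi> v)))"
        using act v vac by simp
      moreover have "l (\<phi> (act ?Z x (A.tau ?one v))) =
          (\<Sum>i\<in>J. l (\<phi> (A.tau (?one(i := act (A.Om i) x (?one i))) v))) + l (\<phi> (A.tau ?one (act V x v)))"
        using A.functional_act_tau[OF l' _ v] by simp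
      moreover have "l (act ?Z' x (B.tau ?one (\<psi> v))) =
          (\<Sum>i\<in>J. l (B.tau (?one(i := act (A.Om i) x (?one i))) (\<psi> v))) + l (B.tau ?one (act W x (\<psi> v)))"
        using B.functional_act_tau[OF l _ \<psi>_closed[OF v]] by simp
      moreover have "(\<Sum>i\<in>J. l (\<phi> (A.tau (?one(i := act (A.Om i) x (?one i))) v))) =
          (\<Sum>i\<in>J. l (B.tau (?one(i := act (A.Om i) x (?one i))) (\<psi> v)))"
        by (rule sum.cong) (use slot in simp_all)
      ultimately show "l (B.tau ?one (\<psi> (act V x v))) = l (B.tau ?one (act W x (\<psi> v)))"
        using vac[OF xv(1)] by simp
    qed (use xv \<psi>_closed in simp_all)
    then show ?thesis using coeff_one[OF \<psi>_closed[OF xv(1)]] coeff_one[OF xv(2)] by metis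
  qed
  show ?thesis using lin vac equiv by blast
qed

lemma tensor_cancel:
  assumes O1: "omega_tensor J lam V" and O2: "omega_tensor J lam W"
    and iso: "lie_module_isomorphic HV
      (tensor_module (tensor_family J (\<lambda>i. Omega (lam i) (alpha i) (beta i))) V)
      (tensor_module (tensor_family J (\<lambda>i. Omega (lam i) (alpha i) (beta i))) W)"
  shows "lie_module_isomorphic HV V W"
proof -
  interpret A: omega_tensor J lam alpha beta V by fact
  interpret B: omega_tensor J lam alpha beta W by fact
  obtain f g where fg: "linear_map A.Z B.Z f" "linear_map B.Z A.Z g"
    "\<forall>z\<in>carrier A.Z. g (f z) = z" "\<forall>z\<in>carrier B.Z. f (g z) = z"
    "\<forall>x\<in>carrier HV. \<forall>z\<in>carrier A.Z. f (act A.Z x z) = act B.Z x (f z)"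
    "\<forall>x\<in>carrier HV. \<forall>z\<in>carrier B.Z. g (act B.Z x z) = act A.Z x (g z)"
    using isomorphic_inverse_maps[OF iso A.Z.acts_linearly_tensor]
    by (elim exE conjE) (rule that)
  have fact: "f (act A.Z x z) = act B.Z x (f z)" if "z \<in> carrier A.Z" for x z
    by (rule fg(5)[rule_format, OF _ that]) simp
  have gact: "g (act B.Z x z) = act A.Z x (g z)" if "z \<in> carrier B.Z" for x z
    by (rule fg(6)[rule_format, OF _ that]) simp
  obtain F where F: "linear_map V W F" "\<And>v. v \<in> carrier V \<Longrightarrow> f (A.tau A.one_family v) = B.tau A.one_family (F v)"
    "\<And>v x. v \<in> carrier V \<Longrightarrow> F (act V x v) = act W x (F v)"
    using vacuum_preserved[OF O1 O2 fg(1) fact] by blast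
  obtain G where G: "linear_map W V G" "\<And>v. v \<in> carrier W \<Longrightarrow> g (B.tau A.one_family v) = A.tau A.one_family (G v)"
    using vacuum_preserved[OF O2 O1 fg(2) gact] by blast
  note Fc = linear_mapD(1)[OF F(1)] and Gc = linear_mapD(1)[OF G(1)]
  have cA: "A.coefficient (\<lambda>_. 0) (A.tau A.one_family v) = v" if "v \<in> carrier V" for v
    using that by (simp add: A.coefficient_tau)
  have cB: "B.coefficient (\<lambda>_. 0) (B.tau A.one_family v) = v" if "v \<in> carrier W" for v
    using that by (simp add: B.coefficient_tau)
  show ?thesis
  proof (rule isomorphicI[OF F(1) G(1)])
    fix v assume v: "v \<in> carrier V"
    have "A.tau A.one_family (G (F v)) = g (f (A.tau A.one_family v))" using F(2)[OF v] G(2)[OF Fc[OF v]] by metis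
    also have "\<dots> = A.tau A.one_family v" using fg(3) v by simp
    finally show "G (F v) = v" using cA[OF Gc[OF Fc[OF v]]] cA[OF v] by metis
  next
    fix w assume w: "w \<in> carrier W"
    have "B.tau A.one_family (F (G w)) = f (g (B.tau A.one_family w))" using F(2)[OF Gc[OF w]] G(2)[OF w] by metis
    also have "\<dots> = B.tau A.one_family w" using fg(4) w by simp
    finally show "F (G w) = w" using cB[OF Fc[OF Gc[OF w]]] cB[OF w] by metis
  qed (use F in simp)
qed

section \<open>Universal enveloping algebras and induced modules\<close>

text \<open>
  The product of the free algebra, concatenation of words, as a bilinear extension.
\<close>

definition word_mult :: "('x list \<Rightarrow>\<^sub>0 complex) \<Rightarrow> ('x list \<Rightarrow>\<^sub>0 complex) \<Rightarrow> 'x list \<Rightarrow>\<^sub>0 complex"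
  where "word_mult p q = linear_extension (\<lambda>u. linear_extension (\<lambda>v. basis (u @ v)) q) p"

lemma scale_single: "scale c (Poly_Mapping.single x d) = Poly_Mapping.single x (c * d)"
  by (rule poly_mapping_eqI) (simp add: lookup_single when_def)

lemma free_algebra_simps [simp]:
  "carrier (free_algebra B) = {p. keys p \<subseteq> lists B}"
  "p \<otimes>\<^bsub>free_algebra B\<^esub> q = word_mult p q" "\<one>\<^bsub>free_algebra B\<^esub> = basis []"
  "\<zero>\<^bsub>free_algebra B\<^esub> = 0" "p \<oplus>\<^bsub>free_algebra B\<^esub> q = p + q"
  by (simp_all add: free_algebra_def word_mult_def linear_extension_def fs.scale_sum_right scale_single)

lemma word_mult_add_left: "word_mult (p + p') q = word_mult p q + word_mult p' q"
  and word_mult_scale_left: "word_mult (scale c p) q = scale c (word_mult p q)"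
  and word_mult_zero_left [simp]: "word_mult 0 q = 0"
  and word_mult_diff_left: "word_mult (p - p') q = word_mult p q - word_mult p' q"
  by (simp_all add: word_mult_def linear_extension_add linear_extension_scale linear_extension_diff)

lemma word_mult_add_right: "word_mult p (q + q') = word_mult p q + word_mult p q'"
  and word_mult_scale_right: "word_mult p (scale c q) = scale c (word_mult p q)"
  and word_mult_zero_right [simp]: "word_mult p 0 = 0"
  by (simp_all add: word_mult_def linear_extension_add linear_extension_scale
      linear_extension_add_fun linear_extension_scale_fun) (simp add: linear_extension_def)

lemma word_mult_basis [simp]: "word_mult (basis u) (basis v) = basis (u @ v)"
  by (simp add: word_mult_def)

lemma keys_word_mult:
  "keys p \<subseteq> lists B \<Longrightarrow> keys q \<subseteq> lists B \<Longrightarrow> keys (word_mult p q) \<subseteq> lists B"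
  unfolding word_mult_def by (intro keys_linear_extension) auto

lemma word_mult_one [simp]: "word_mult (basis []) p = p" "word_mult p (basis []) = p"
  by (simp_all add: word_mult_def)

lemma word_mult_assoc: "word_mult (word_mult p q) r = word_mult p (word_mult q r)"
proof -
  have p: "keys p \<subseteq> UNIV" and q: "keys q \<subseteq> UNIV" and r: "keys r \<subseteq> UNIV" by auto
  have 1: "word_mult (word_mult (basis u) (basis v)) r = word_mult (basis u) (word_mult (basis v) r)" for u v
    using r by (induction r rule: free_induct) (simp_all add: word_mult_add_right word_mult_scale_right)
  have 2: "word_mult (word_mult (basis u) q) r = word_mult (basis u) (word_mult q r)" for u
    using q by (induction q rule: free_induct)
      (simp_all add: 1 word_mult_add_right word_mult_scale_right word_mult_add_left word_mult_scale_left del: word_mult_basis)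
  show ?thesis
    using p by (induction p rule: free_induct)
      (simp_all add: 2 word_mult_add_left word_mult_scale_left)
qed

lemma ring_free_algebra: "ring (free_algebra B)"
proof (rule ringI)
  show "abelian_group (free_algebra B)"
  proof (rule abelian_groupI)
    fix p assume "p \<in> carrier (free_algebra B)"
    then show "\<exists>q\<in>carrier (free_algebra B). q \<oplus>\<^bsub>free_algebra B\<^esub> p = \<zero>\<^bsub>free_algebra B\<^esub>"
      by (intro bexI[of _ "- p"]) simp_all
  qed (simp_all add: algebra_simps)
  show "Group.monoid (free_algebra B)"
    by (rule monoidI) (simp_all add: keys_word_mult word_mult_assoc)
qed (simp_all add: word_mult_add_left word_mult_add_right)

text \<open>
  Scalars are multiples of the empty word, so closure under products contains closure under
  additive inverses.
\<close>

lemma ideal_free_algebraI: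
  assumes "A \<subseteq> {p. keys p \<subseteq> lists B}" "0 \<in> A"
    and "\<And>p q. p \<in> A \<Longrightarrow> q \<in> A \<Longrightarrow> p + q \<in> A"
    and "\<And>p q. p \<in> A \<Longrightarrow> keys q \<subseteq> lists B \<Longrightarrow> word_mult q p \<in> A"
    and "\<And>p q. p \<in> A \<Longrightarrow> keys q \<subseteq> lists B \<Longrightarrow> word_mult p q \<in> A"
  shows "ideal A (free_algebra B)"
proof (rule idealI)
  interpret ring "free_algebra B" by (rule ring_free_algebra)
  show "subgroup A (add_monoid (free_algebra B))"
  proof (rule add.subgroupI)
    fix p assume p: "p \<in> A"
    have "word_mult (scale (-1) (basis [])) p \<in> A" by (rule assms(4)[OF p]) (simp add: keys_scale_subset)
    then have mp: "- p \<in> A" by (metis word_mult_scale_left word_mult_one(1) scale_minus_one)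
    have "\<ominus>\<^bsub>free_algebra B\<^esub> p = - p"
      by (rule minus_equality) (use p mp assms(1) in auto)
    then show "\<ominus>\<^bsub>free_algebra B\<^esub> p \<in> A" using mp by simp
  qed (use assms in auto)
qed (use assms ring_free_algebra in auto)

text \<open>
  Closure of the carrier puts the relations of the enveloping algebra into the free algebra on the
  carrier, where they generate an ideal.
\<close>

locale closed_algebra =
  fixes G :: "'g lie_algebra"
  assumes add_closed: "x \<in> carrier G \<Longrightarrow> y \<in> carrier G \<Longrightarrow> x \<oplus>\<^bsub>G\<^esub> y \<in> carrier G"
    and smult_closed: "x \<in> carrier G \<Longrightarrow> c \<odot>\<^bsub>G\<^esub> x \<in> carrier G"
    and bracket_closed: "x \<in> carrier G \<Longrightarrow> y \<in> carrier G \<Longrightarrow> bracket G x y \<in> carrier G"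
begin

abbreviation "FA \<equiv> free_algebra (carrier G)"
abbreviation "W \<equiv> {p. keys p \<subseteq> lists (carrier G)}"

definition uea_relations :: "('g list \<Rightarrow>\<^sub>0 complex) set"
  where "uea_relations =
    {basis [x \<oplus>\<^bsub>G\<^esub> y] - basis [x] - basis [y] | x y. x \<in> carrier G \<and> y \<in> carrier G} \<union>
     {basis [c \<odot>\<^bsub>G\<^esub> x] - scale c (basis [x]) | c x. x \<in> carrier G} \<union>
     {basis [x, y] - basis [y, x] - basis [bracket G x y] | x y. x \<in> carrier G \<and> y \<in> carrier G}"

lemma uea_relations_cases:
  assumes "r \<in> uea_relations"
  obtains x y where "r = basis [x \<oplus>\<^bsub>G\<^esub> y] - basis [x] - basis [y]" "x \<in> carrier G" "y \<in> carrier G"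
    | c x where "r = basis [c \<odot>\<^bsub>G\<^esub> x] - scale c (basis [x])" "x \<in> carrier G"
    | x y where "r = basis [x, y] - basis [y, x] - basis [bracket G x y]" "x \<in> carrier G" "y \<in> carrier G"
  using assms unfolding uea_relations_def by blast

lemma uea_relations_subset: "uea_relations \<subseteq> carrier FA"
proof
  fix r assume "r \<in> uea_relations"
  then have "keys r \<subseteq> lists (carrier G)"
    by (cases rule: uea_relations_cases)
      (simp_all only:, (intro keys_diff_subset keys_scale_subset;
        simp add: add_closed smult_closed bracket_closed)+)
  then show "r \<in> carrier FA" by simp
qed

abbreviation "UI \<equiv> uea_ideal G"

lemma uea_ideal_eq: "UI = Idl\<^bsub>FA\<^esub> uea_relations"
  by (simp add: uea_ideal_def uea_relations_def)

lemma ideal_UI: "ideal UI FA"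
  unfolding uea_ideal_eq by (rule ring.genideal_ideal[OF ring_free_algebra uea_relations_subset])

sublocale UI: ideal UI FA
  by (rule ideal_UI)

lemma UI_relations: "r \<in> uea_relations \<Longrightarrow> r \<in> UI"
  unfolding uea_ideal_eq using ring.genideal_self[OF ring_free_algebra uea_relations_subset] by blast

lemma UI_minimal: "ideal J FA \<Longrightarrow> uea_relations \<subseteq> J \<Longrightarrow> UI \<subseteq> J"
  unfolding uea_ideal_eq by (rule ring.genideal_minimal[OF ring_free_algebra])

lemma UI_add: "p \<in> UI \<Longrightarrow> q \<in> UI \<Longrightarrow> p + q \<in> UI"
  using additive_subgroup.a_closed[OF UI.is_additive_subgroup, of p q] by simp

lemma UI_zero: "0 \<in> UI"
  using additive_subgroup.zero_closed[OF UI.is_additive_subgroup] by simp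

lemma UI_scale: "p \<in> UI \<Longrightarrow> scale c p \<in> UI"
  using UI.I_l_closed[of p "scale c (basis [])"] by (simp add: word_mult_scale_left keys_scale_subset del: scale_basis)

lemma UI_diff: "p \<in> UI \<Longrightarrow> q \<in> UI \<Longrightarrow> p - q \<in> UI"
  using UI_add[of p "scale (-1) q"] UI_scale[of q "-1"] by simp

lemma UI_mult_left: "p \<in> UI \<Longrightarrow> keys q \<subseteq> lists (carrier G) \<Longrightarrow> word_mult q p \<in> UI"
  using UI.I_l_closed[of p q] by simp

lemma UI_mult_right: "p \<in> UI \<Longrightarrow> keys q \<subseteq> lists (carrier G) \<Longrightarrow> word_mult p q \<in> UI"
  using UI.I_r_closed[of p q] by simp

lemma UI_keys: "p \<in> UI \<Longrightarrow> keys p \<subseteq> lists (carrier G)"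
  using UI.Icarr[of p] by simp

abbreviation "cls \<equiv> uea_class G"

lemma cls_image: "cls p = (\<lambda>i. i + p) ` UI"
  by (auto simp: uea_class_def a_r_coset_def')

lemma cls_eq_iff: "cls p = cls q \<longleftrightarrow> p - q \<in> UI"
proof
  assume "cls p = cls q"
  then have "p \<in> cls q" unfolding cls_image using UI_zero by (metis add_0 image_iff)
  then obtain i where "i \<in> UI" "p = i + q" unfolding cls_image by blast
  then show "p - q \<in> UI" by simp
next
  assume pq: "p - q \<in> UI"
  have "\<exists>m\<in>UI. n + p = m + q" "\<exists>m\<in>UI. n + q = m + p" if "n \<in> UI" for n
  proof -
    have "n + p = (n + (p - q)) + q" "n + q = (n - (p - q)) + p" by simp_all
    then show "\<exists>m\<in>UI. n + p = m + q" "\<exists>m\<in>UI. n + q = m + p"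
      using UI_add[OF that pq] UI_diff[OF that pq] by blast+
  qed
  then show "cls p = cls q" unfolding cls_image by blast
qed

lemma uea_simps:
  "carrier (uea G) = cls ` W"
  "p \<in> W \<Longrightarrow> q \<in> W \<Longrightarrow> cls p \<otimes>\<^bsub>uea G\<^esub> cls q = cls (word_mult p q)"
  "p \<in> W \<Longrightarrow> q \<in> W \<Longrightarrow> cls p \<oplus>\<^bsub>uea G\<^esub> cls q = cls (p + q)"
  "\<zero>\<^bsub>uea G\<^esub> = cls 0"
proof -
  show "carrier (uea G) = cls ` W"
    by (auto simp: uea_def Let_def ring.defs module.defs FactRing_def A_RCOSETS_def' uea_class_def a_r_coset_def')
  show "cls p \<otimes>\<^bsub>uea G\<^esub> cls q = cls (word_mult p q)" if "p \<in> W" "q \<in> W"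
    using UI.rcoset_mult_add[of p q] that
    by (simp add: uea_def Let_def ring.defs module.defs FactRing_def uea_class_def)
  show "cls p \<oplus>\<^bsub>uea G\<^esub> cls q = cls (p + q)" if "p \<in> W" "q \<in> W"
    using UI.a_rcos_sum[of p q] that
    by (simp add: uea_def Let_def ring.defs module.defs FactRing_def uea_class_def)
  show "\<zero>\<^bsub>uea G\<^esub> = cls 0"
    by (simp add: cls_image uea_def Let_def ring.defs module.defs FactRing_def)
qed

lemma uea_smult:
  assumes "p \<in> W"
  shows "c \<odot>\<^bsub>uea G\<^esub> cls p = cls (scale c p)"
proof -
  have "c \<odot>\<^bsub>uea G\<^esub> cls p = cls (scale c (basis [])) \<otimes>\<^bsub>uea G\<^esub> cls p"
    by (simp add: uea_def Let_def ring.defs module.defs scale_basis)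
  also have "\<dots> = cls (scale c p)"
    using assms by (subst uea_simps(2)) (simp_all add: keys_scale_subset word_mult_scale_left del: scale_basis)
  finally show ?thesis .
qed

lemma complex_space_uea: "complex_space (uea G)"
proof (rule complex_spaceI)
  show "\<zero>\<^bsub>uea G\<^esub> \<in> carrier (uea G)" unfolding uea_simps by auto
qed (auto simp: uea_simps uea_smult keys_add_subset keys_scale_subset fs.scale_left_distrib
      fs.scale_right_distrib algebra_simps)

lemma uea_cases:
  assumes "u \<in> carrier (uea G)"
  obtains p where "p \<in> W" "u = cls p"
  using assms by (auto simp: uea_simps)

lemma cls_in_uea [simp]: "p \<in> W \<Longrightarrow> cls p \<in> carrier (uea G)"
  by (auto simp: uea_simps)

end

subsection \<open>The action of the free algebra on a module\<close>

lemma is_lie_moduleD: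
  assumes "is_lie_module G M"
  shows "complex_space M" "acts_linearly G M"
    and "x \<in> carrier G \<Longrightarrow> y \<in> carrier G \<Longrightarrow> v \<in> carrier M \<Longrightarrow>
      act M (x \<oplus>\<^bsub>G\<^esub> y) v = act M x v \<oplus>\<^bsub>M\<^esub> act M y v"
    and "x \<in> carrier G \<Longrightarrow> v \<in> carrier M \<Longrightarrow> act M (c \<odot>\<^bsub>G\<^esub> x) v = c \<odot>\<^bsub>M\<^esub> act M x v"
    and "x \<in> carrier G \<Longrightarrow> y \<in> carrier G \<Longrightarrow> v \<in> carrier M \<Longrightarrow>
      act M (bracket G x y) v = act M x (act M y v) \<oplus>\<^bsub>M\<^esub> (-1) \<odot>\<^bsub>M\<^esub> act M y (act M x v)"
proof -
  show C: "complex_space M" using assms by (intro complex_space.intro) (simp add: is_lie_module_def)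
  then show A: "acts_linearly G M" using assms by (auto simp: is_lie_module_def acts_linearly_def linear_map_def)
  interpret complex_space M by (rule C)
  show "act M (bracket G x y) v = act M x (act M y v) \<oplus>\<^bsub>M\<^esub> (-1) \<odot>\<^bsub>M\<^esub> act M y (act M x v)"
    if "x \<in> carrier G" "y \<in> carrier G" "v \<in> carrier M"
    using assms that acts_linearlyD(3)[OF A] by (simp add: is_lie_module_def diff_eq_smult)
qed (use assms in \<open>simp_all add: is_lie_module_def\<close>)

lemma is_lie_moduleI:
  assumes "acts_linearly G M"
    and "\<And>x y v. x \<in> carrier G \<Longrightarrow> y \<in> carrier G \<Longrightarrow> v \<in> carrier M \<Longrightarrow>
      act M (x \<oplus>\<^bsub>G\<^esub> y) v = act M x v \<oplus>\<^bsub>M\<^esub> act M y v"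
    and "\<And>c x v. x \<in> carrier G \<Longrightarrow> v \<in> carrier M \<Longrightarrow> act M (c \<odot>\<^bsub>G\<^esub> x) v = c \<odot>\<^bsub>M\<^esub> act M x v"
    and "\<And>x y v. x \<in> carrier G \<Longrightarrow> y \<in> carrier G \<Longrightarrow> v \<in> carrier M \<Longrightarrow>
      act M (bracket G x y) v = act M x (act M y v) \<oplus>\<^bsub>M\<^esub> (-1) \<odot>\<^bsub>M\<^esub> act M y (act M x v)"
  shows "is_lie_module G M"
proof -
  note C = acts_linearlyD(1)[OF assms(1)] and L = linear_mapD[OF acts_linearlyD(2)[OF assms(1)]]
  interpret complex_space M by (rule C)
  show ?thesis
    unfolding is_lie_module_def
    using assms(2-4) L module_complex by (auto simp: diff_eq_smult)
qed

locale lie_representation = closed_algebra H for H :: "'g lie_algebra" +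
  fixes M :: "('g, 'v) lie_module"
  assumes rep: "is_lie_module H M"
begin

sublocale M: complex_space M by (rule is_lie_moduleD(1)[OF rep])

lemmas rep_acts = is_lie_moduleD(2)[OF rep]
lemmas act_linear = linear_mapD[OF acts_linearlyD(2)[OF rep_acts]]

abbreviation "word w v \<equiv> foldr (act M) w v"

lemma word_closed: "w \<in> lists (carrier H) \<Longrightarrow> v \<in> carrier M \<Longrightarrow> word w v \<in> carrier M"
  by (induction w) (use act_linear(1) in auto)

lemma linear_word: "w \<in> lists (carrier H) \<Longrightarrow> linear_map M M (word w)"
proof (induction w)
  case Nil
  show ?case by (rule linear_mapI) simp_all
next
  case (Cons x w)
  then have 1: "linear_map M M (word w)" and x: "x \<in> carrier H" by auto
  from linear_map_comp[OF 1 acts_linearlyD(2)[OF rep_acts x]]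
  show ?case by (simp add: comp_def)
qed

lemma word_act_combination: "word_act M p v = combination M (\<lambda>w. word w v) p"
  by (simp add: word_act_def combination_def)

lemma word_fun: "v \<in> carrier M \<Longrightarrow> (\<lambda>w. word w v) \<in> lists (carrier H) \<rightarrow> carrier M"
  using word_closed by auto

lemma word_act_closed: "p \<in> W \<Longrightarrow> v \<in> carrier M \<Longrightarrow> word_act M p v \<in> carrier M"
  unfolding word_act_combination
  by (rule M.combination_closed) (rule M.subset_funcset[OF word_fun], auto)

lemma linear_word_act_left: "v \<in> carrier M \<Longrightarrow> linear_map (free_space (lists (carrier H))) M (\<lambda>p. word_act M p v)"
  unfolding word_act_combination by (rule M.linear_map_combination[OF word_fun])

lemmas word_act_add = linear_mapD(2)[OF linear_word_act_left, unfolded free_space_simps]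
  and word_act_scale = linear_mapD(3)[OF linear_word_act_left, unfolded free_space_simps]

lemma word_act_zero [simp]: "word_act M 0 v = \<zero>\<^bsub>M\<^esub>"
  by (simp add: word_act_def)

lemma word_act_diff:
  assumes "p \<in> W" "q \<in> W" "v \<in> carrier M"
  shows "word_act M (p - q) v = word_act M p v \<oplus>\<^bsub>M\<^esub> (-1) \<odot>\<^bsub>M\<^esub> word_act M q v"
proof -
  have "scale (-1) q \<in> W" using assms(2) keys_scale_subset by blast
  then show ?thesis
    using word_act_add[OF assms(3,1), of "scale (-1) q"] word_act_scale[OF assms(3,2), of "-1"] by simp
qed

lemma word_act_basis: "w \<in> lists (carrier H) \<Longrightarrow> v \<in> carrier M \<Longrightarrow> word_act M (basis w) v = word w v"
  unfolding word_act_combination using word_closed by (intro M.combination_basis) auto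

lemma linear_word_act_right:
  assumes "p \<in> W"
  shows "linear_map M M (word_act M p)"
proof -
  have "keys p \<subseteq> lists (carrier H)" using assms by simp
  then have "linear_map M M (\<lambda>v. word_act M p v)"
  proof (induction p rule: free_induct)
    case (basis w)
    have "word_act M (basis w) v = word w v" if "v \<in> carrier M" for v
      using word_act_basis[OF basis that] .
    then show ?case using linear_word[OF basis] unfolding linear_map_def by (simp add: Pi_iff)
  next
    case (add p q)
    have "word_act M (p + q) v = word_act M p v \<oplus>\<^bsub>M\<^esub> word_act M q v" if "v \<in> carrier M" for v
      using word_act_add[OF that] add by simp
    then show ?case
      using linear_mapD[OF add(3)] linear_mapD[OF add(4)]
      by (intro linear_mapI) (simp_all add: M.smult_oplus M.M.a_ac)
  next
    case zero
    show ?case by (rule linear_mapI) simp_all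
  next
    case (scale c p)
    have "word_act M (scale c p) v = c \<odot>\<^bsub>M\<^esub> word_act M p v" if "v \<in> carrier M" for v
      using word_act_scale[OF that] scale by simp
    then show ?case
      using linear_mapD[OF scale(2)]
      by (intro linear_mapI) (simp_all add: M.smult_oplus M.smult_smult mult.commute)
  qed
  then show ?thesis by simp
qed

lemma word_act_mult:
  assumes "p \<in> W" "q \<in> W" "v \<in> carrier M"
  shows "word_act M (word_mult p q) v = word_act M p (word_act M q v)"
proof -
  have p: "keys p \<subseteq> lists (carrier H)" and q: "keys q \<subseteq> lists (carrier H)" using assms by simp_all
  note c = word_act_closed[OF _ assms(3)]
  have 1: "word_act M (word_mult (basis u) q) v = word_act M (basis u) (word_act M q v)" if u: "u \<in> lists (carrier H)" for u
    using q
  proof (induction q rule: free_induct)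
    case (basis w)
    then show ?case using u assms(3) word_closed by (simp add: word_act_basis)
  next
    case (add q q')
    then show ?case
      using linear_mapD(2)[OF linear_word_act_right[of "basis u"]] u assms(3) c
      by (simp add: word_mult_add_right word_act_add keys_word_mult)
  next
    case zero
    show ?case using linear_map_zero[OF linear_word_act_right[of "basis u"] M.complex_space_axioms M.complex_space_axioms] u by simp
  next
    case (scale c q)
    then show ?case
      using linear_mapD(3)[OF linear_word_act_right[of "basis u"]] u assms(3) word_act_closed[of q v]
      by (simp add: word_mult_scale_right word_act_scale keys_word_mult)
  qed
  have qv: "word_act M q v \<in> carrier M" using word_act_closed assms by simp
  show ?thesis
    using p
  proof (induction p rule: free_induct)
    case (basis u)
    then show ?case by (rule 1)
  qed (use q qv assms(3) in \<open>simp_all add: word_mult_add_left word_mult_scale_left word_act_add word_act_scale keys_word_mult\<close>)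
qed

text \<open>
  The elements of the free algebra acting by zero form an ideal, which contains the defining
  relations of the enveloping algebra by the axioms of a module.
\<close>

lemma word_act_UI:
  assumes "p \<in> UI" "v \<in> carrier M"
  shows "word_act M p v = \<zero>\<^bsub>M\<^esub>"
proof -
  let ?J = "{p \<in> W. \<forall>v\<in>carrier M. word_act M p v = \<zero>\<^bsub>M\<^esub>}"
  have zero: "word_act M q \<zero>\<^bsub>M\<^esub> = \<zero>\<^bsub>M\<^esub>" if "q \<in> W" for q
    by (rule linear_map_zero[OF linear_word_act_right[OF that] M.complex_space_axioms M.complex_space_axioms])
  have "ideal ?J FA"
    by (rule ideal_free_algebraI)
      (auto simp: word_act_add word_act_mult zero word_act_closed dest: subsetD[OF keys_word_mult]
        subsetD[OF keys_add_subset])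
  moreover have "uea_relations \<subseteq> ?J"
  proof
    fix r assume r: "r \<in> uea_relations"
    have "word_act M r v = \<zero>\<^bsub>M\<^esub>" if v: "v \<in> carrier M" for v
      using r
    proof (cases rule: uea_relations_cases)
      case (1 x y)
      have "word_act M r v = act M (x \<oplus>\<^bsub>H\<^esub> y) v \<oplus>\<^bsub>M\<^esub> (-1) \<odot>\<^bsub>M\<^esub> act M x v \<oplus>\<^bsub>M\<^esub> (-1) \<odot>\<^bsub>M\<^esub> act M y v"
        unfolding 1(1) using 1 v by (simp add: word_act_diff word_act_basis add_closed)
      also have "\<dots> = (act M x v \<oplus>\<^bsub>M\<^esub> (-1) \<odot>\<^bsub>M\<^esub> act M x v) \<oplus>\<^bsub>M\<^esub>
          (act M y v \<oplus>\<^bsub>M\<^esub> (-1) \<odot>\<^bsub>M\<^esub> act M y v)"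
        using 1 v is_lie_moduleD(3)[OF rep] act_linear(1) by (simp add: M.M.a_ac)
      also have "\<dots> = \<zero>\<^bsub>M\<^esub>" using 1 v act_linear(1) M.diff_zero_iff[of "act M x v" "act M x v"]
          M.diff_zero_iff[of "act M y v" "act M y v"] by simp
      finally show ?thesis .
    next
      case (2 c x)
      have "word_act M r v = act M (c \<odot>\<^bsub>H\<^esub> x) v \<oplus>\<^bsub>M\<^esub> (-1) \<odot>\<^bsub>M\<^esub> (c \<odot>\<^bsub>M\<^esub> act M x v)"
        unfolding 2(1) using 2 v by (simp add: word_act_diff word_act_scale word_act_basis smult_closed keys_scale_subset del: scale_basis)
      then show ?thesis
        using 2 v is_lie_moduleD(4)[OF rep] act_linear(1) by (simp add: M.diff_zero_iff)
    next
      case (3 x y)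
      have "word_act M r v = (act M x (act M y v) \<oplus>\<^bsub>M\<^esub> (-1) \<odot>\<^bsub>M\<^esub> act M y (act M x v)) \<oplus>\<^bsub>M\<^esub>
          (-1) \<odot>\<^bsub>M\<^esub> act M (bracket H x y) v"
        unfolding 3(1) using 3 v by (simp add: word_act_diff word_act_basis bracket_closed)
      then show ?thesis
        using 3 v is_lie_moduleD(5)[OF rep 3(2,3) v] act_linear(1) bracket_closed
        by (simp add: M.diff_zero_iff)
    qed
    then show "r \<in> ?J" using uea_relations_subset r by auto
  qed
  ultimately have "UI \<subseteq> ?J" by (rule UI_minimal)
  then show ?thesis using assms by blast
qed

lemma uea_act_cls:
  assumes p: "p \<in> W" and v: "v \<in> carrier M"
  shows "uea_act M (cls p) v = word_act M p v"
proof -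
  have "word_act M (i + p) v = word_act M p v" if i: "i \<in> UI" for i
  proof -
    have "i \<in> W" using UI_keys[OF i] by simp
    then show ?thesis using word_act_add[OF v, of i p] p word_act_UI[OF i v] word_act_closed[OF p v] by simp
  qed
  then have "(\<lambda>q. word_act M q v) ` cls p = {word_act M p v}"
    unfolding cls_image image_image using UI_zero by auto
  then show ?thesis by (simp add: uea_act_def)
qed

end

subsection \<open>Induced modules\<close>

text \<open>
  A subalgebra \<open>H\<close> of \<open>G\<close>, as a smaller carrier with the same
  operations, and a module \<open>M\<close> over it.
\<close>

locale induced_representation = lie_representation H M + G: closed_algebra G
  for G H :: "'g lie_algebra" and M :: "('g, 'v) lie_module" +
  assumes sub_carrier: "carrier H \<subseteq> carrier G"
    and sub_add: "x \<oplus>\<^bsub>H\<^esub> y = x \<oplus>\<^bsub>G\<^esub> y"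
    and sub_smult: "c \<odot>\<^bsub>H\<^esub> x = c \<odot>\<^bsub>G\<^esub> x"
    and sub_bracket: "bracket H x y = bracket G x y"
begin

lemma sub_lists: "p \<in> W \<Longrightarrow> p \<in> G.W"
  using lists_mono[OF sub_carrier] by auto

text \<open>
  The ideal of \<open>H\<close> is generated inside the smaller free algebra, so the elements of
  that algebra lying in the ideal of \<open>G\<close> have to be seen to form an ideal containing
  the relations of \<open>H\<close>. This makes the map between the enveloping algebras well
  defined.
\<close>

lemma UI_sub: "UI \<subseteq> G.UI"
proof -
  let ?J = "{p \<in> W. p \<in> G.UI}"
  have "ideal ?J FA"
  proof (rule ideal_free_algebraI)
    fix p q :: "'g list \<Rightarrow>\<^sub>0 complex" assume p: "p \<in> ?J" and q: "keys q \<subseteq> lists (carrier H)"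
    have "keys q \<subseteq> lists (carrier G)" using sub_lists[of q] q by simp
    moreover have "word_mult q p \<in> W" "word_mult p q \<in> W"
      using keys_word_mult[of q "carrier H" p] keys_word_mult[of p "carrier H" q] p q by simp_all
    ultimately show "word_mult q p \<in> ?J" "word_mult p q \<in> ?J"
      using p G.UI_mult_left G.UI_mult_right by simp_all
  qed (auto simp: G.UI_zero G.UI_add dest: subsetD[OF keys_add_subset])
  moreover have "uea_relations \<subseteq> G.uea_relations"
    unfolding uea_relations_def G.uea_relations_def sub_add sub_smult sub_bracket
    using sub_carrier by blast
  then have "uea_relations \<subseteq> ?J" using uea_relations_subset G.UI_relations by auto
  ultimately have "UI \<subseteq> ?J" by (rule UI_minimal)
  then show ?thesis by auto
qed

lemma uea_embed_cls: "uea_embed G (cls p) = G.cls p"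
proof -
  have "(\<exists>h\<in>G.UI. \<exists>i\<in>UI. x = h + (i + p)) \<longleftrightarrow> (\<exists>h\<in>G.UI. x = h + p)" for x
  proof
    assume "\<exists>h\<in>G.UI. \<exists>i\<in>UI. x = h + (i + p)"
    then obtain h i where "h \<in> G.UI" "i \<in> UI" "x = (h + i) + p" by (auto simp: algebra_simps)
    then show "\<exists>h\<in>G.UI. x = h + p" using G.UI_add UI_sub by blast
  next
    assume "\<exists>h\<in>G.UI. x = h + p"
    then obtain h where "h \<in> G.UI" "x = h + (0 + p)" by auto
    then show "\<exists>h\<in>G.UI. \<exists>i\<in>UI. x = h + (i + p)" using UI_zero by blast
  qed
  then show ?thesis
    by (auto simp: uea_embed_def set_add_def' cls_image G.cls_image set_eq_iff image_iff)
qed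

abbreviation "ind_gens \<equiv> carrier (uea G) \<times> carrier M"

text \<open>
  The relations that move elements of the enveloping algebra of \<open>H\<close> across the tensor
  sign.
\<close>

definition balance_relations where
  "balance_relations = {basis (u \<otimes>\<^bsub>uea G\<^esub> uea_embed G a, v) - basis (u, uea_act M a v) | u a v.
         u \<in> carrier (uea G) \<and> a \<in> carrier (uea H) \<and> v \<in> carrier M}"

abbreviation "ind_rels \<equiv> tensor_relations (uea G) M \<union> balance_relations"
abbreviation "ind_act \<equiv> (\<lambda>x (u, v). basis (G.cls (basis [x]) \<otimes>\<^bsub>uea G\<^esub> u, v))"

lemma induced_module_eq: "induced_module G H M = presented_module ind_gens ind_rels ind_act"
  by (simp add: induced_module_def balance_relations_def)

lemma balance_relations_eq:
  "balance_relations = {basis (G.cls (word_mult p q), v) - basis (G.cls p, word_act M q v) | p q v.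
    p \<in> G.W \<and> q \<in> W \<and> v \<in> carrier M}"
proof (intro equalityI subsetI)
  fix r assume "r \<in> balance_relations"
  then obtain u a v where r: "r = basis (u \<otimes>\<^bsub>uea G\<^esub> uea_embed G a, v) - basis (u, uea_act M a v)"
    and ua: "u \<in> carrier (uea G)" "a \<in> carrier (uea H)" "v \<in> carrier M"
    unfolding balance_relations_def by blast
  obtain p where p: "p \<in> G.W" "u = G.cls p" using ua(1) by (rule G.uea_cases)
  obtain q where q: "q \<in> W" "a = cls q" using ua(2) by (rule uea_cases)
  have "r = basis (G.cls (word_mult p q), v) - basis (G.cls p, word_act M q v)"
    unfolding r p(2) q(2) uea_embed_cls uea_act_cls[OF q(1) ua(3)] G.uea_simps(2)[OF p(1) sub_lists[OF q(1)]] ..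
  then show "r \<in> {basis (G.cls (word_mult p q), v) - basis (G.cls p, word_act M q v) | p q v.
    p \<in> G.W \<and> q \<in> W \<and> v \<in> carrier M}" using p(1) q(1) ua(3) by blast
next
  fix r assume "r \<in> {basis (G.cls (word_mult p q), v) - basis (G.cls p, word_act M q v) | p q v.
    p \<in> G.W \<and> q \<in> W \<and> v \<in> carrier M}"
  then obtain p q v where r: "r = basis (G.cls (word_mult p q), v) - basis (G.cls p, word_act M q v)"
    and pq: "p \<in> G.W" "q \<in> W" "v \<in> carrier M" by blast
  have "r = basis (G.cls p \<otimes>\<^bsub>uea G\<^esub> uea_embed G (cls q), v) - basis (G.cls p, uea_act M (cls q) v)"
    unfolding r uea_embed_cls uea_act_cls[OF pq(2,3)] G.uea_simps(2)[OF pq(1) sub_lists[OF pq(2)]] ..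
  then show "r \<in> balance_relations"
    unfolding balance_relations_def using G.cls_in_uea[OF pq(1)] cls_in_uea[OF pq(2)] pq(3) by blast
qed

lemma balance_cases:
  assumes "r \<in> balance_relations"
  obtains p q v where "r = basis (G.cls (word_mult p q), v) - basis (G.cls p, word_act M q v)"
    "p \<in> G.W" "q \<in> W" "v \<in> carrier M"
  using assms unfolding balance_relations_eq by blast

lemma balance_relation_mem:
  "p \<in> G.W \<Longrightarrow> q \<in> W \<Longrightarrow> v \<in> carrier M \<Longrightarrow>
    basis (G.cls (word_mult p q), v) - basis (G.cls p, word_act M q v) \<in> ind_rels"
  unfolding balance_relations_eq by blast

lemma GW_mult: "p \<in> G.W \<Longrightarrow> q \<in> G.W \<Longrightarrow> word_mult p q \<in> G.W"
  using keys_word_mult by blast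

lemma GW_letter: "x \<in> carrier G \<Longrightarrow> basis [x] \<in> G.W"
  by simp

lemma cls_closed: "p \<in> G.W \<Longrightarrow> v \<in> carrier M \<Longrightarrow> (G.cls p, v) \<in> ind_gens"
  using G.cls_in_uea by blast

sublocale Ind: presentation ind_gens ind_rels
proof
  fix r assume "r \<in> ind_rels"
  then show "keys r \<subseteq> ind_gens"
  proof
    assume "r \<in> tensor_relations (uea G) M"
    then show ?thesis
      by (rule presentation.relations_keys[OF presentation_tensor[OF G.complex_space_uea M.complex_space_axioms]])
  next
    assume "r \<in> balance_relations"
    then show ?thesis
    proof (rule balance_cases)
      fix p q v assume r: "r = basis (G.cls (word_mult p q), v) - basis (G.cls p, word_act M q v)"
        and pq: "p \<in> G.W" "q \<in> W" "v \<in> carrier M"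
      show ?thesis unfolding r
        by (rule keys_diff_subset; unfold keys_basis_subset, rule cls_closed)
          (use pq GW_mult[OF pq(1) sub_lists[OF pq(2)]] word_act_closed in simp_all)
    qed
  qed
qed

lemma left_mult_linear:
  assumes x: "x \<in> carrier G"
  shows "linear_map (uea G) (uea G) (\<lambda>u. G.cls (basis [x]) \<otimes>\<^bsub>uea G\<^esub> u)"
proof (rule linear_mapI)
  note X = GW_letter[OF x]
  fix u assume "u \<in> carrier (uea G)"
  then obtain p where p: "p \<in> G.W" "u = G.cls p" by (rule G.uea_cases)
  show "G.cls (basis [x]) \<otimes>\<^bsub>uea G\<^esub> u \<in> carrier (uea G)"
    unfolding p(2) G.uea_simps(2)[OF X p(1)] by (rule G.cls_in_uea[OF GW_mult[OF X p(1)]])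
  fix c
  have "scale c p \<in> G.W" using p(1) by simp
  then show "G.cls (basis [x]) \<otimes>\<^bsub>uea G\<^esub> (c \<odot>\<^bsub>uea G\<^esub> u) = c \<odot>\<^bsub>uea G\<^esub> (G.cls (basis [x]) \<otimes>\<^bsub>uea G\<^esub> u)"
    unfolding p(2) G.uea_smult[OF p(1)] G.uea_simps(2)[OF X p(1)] G.uea_smult[OF GW_mult[OF X p(1)]]
    by (simp only: G.uea_simps(2)[OF X] word_mult_scale_right)
next
  note X = GW_letter[OF x]
  fix u u' assume "u \<in> carrier (uea G)" "u' \<in> carrier (uea G)"
  then obtain p q where pq: "p \<in> G.W" "u = G.cls p" "q \<in> G.W" "u' = G.cls q" by (metis G.uea_cases)
  have "p + q \<in> G.W" using pq by simp
  then show "G.cls (basis [x]) \<otimes>\<^bsub>uea G\<^esub> (u \<oplus>\<^bsub>uea G\<^esub> u') =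
      G.cls (basis [x]) \<otimes>\<^bsub>uea G\<^esub> u \<oplus>\<^bsub>uea G\<^esub> G.cls (basis [x]) \<otimes>\<^bsub>uea G\<^esub> u'"
    unfolding pq(2,4) G.uea_simps(3)[OF pq(1,3)] G.uea_simps(2)[OF X pq(1)] G.uea_simps(2)[OF X pq(3)]
      G.uea_simps(3)[OF GW_mult[OF X pq(1)] GW_mult[OF X pq(3)]]
    by (simp only: G.uea_simps(2)[OF X] word_mult_add_right)
qed

lemma keys_ind_act:
  assumes "x \<in> carrier G" "b \<in> ind_gens"
  shows "keys (ind_act x b) \<subseteq> ind_gens"
  using assms linear_mapD(1)[OF left_mult_linear[OF assms(1)]] by auto

lemma ind_act_relation:
  assumes x: "x \<in> carrier G" and r: "r \<in> ind_rels"
  shows "linear_extension (ind_act x) r \<in> Ind.N"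
  using r
proof
  note L = linear_mapD[OF left_mult_linear[OF x]]
  note ext = linear_extension_diff linear_extension_scale linear_extension_basis prod.case
  assume "r \<in> tensor_relations (uea G) M"
  then have "linear_extension (ind_act x) r \<in> tensor_relations (uea G) M"
    by (cases rule: tensor_relations_cases) (simp_all add: ext L tensor_relationsI del: scale_basis)
  then show ?thesis using Ind.N_rel by blast
next
  assume "r \<in> balance_relations"
  then show ?thesis
  proof (rule balance_cases)
    note ext = linear_extension_diff linear_extension_scale linear_extension_basis prod.case
    note X = GW_letter[OF x]
    fix p q v assume r: "r = basis (G.cls (word_mult p q), v) - basis (G.cls p, word_act M q v)"
      and pq: "p \<in> G.W" "q \<in> W" "v \<in> carrier M"
    have "linear_extension (ind_act x) r = basis (G.cls (word_mult (word_mult (basis [x]) p) q), v) -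
        basis (G.cls (word_mult (basis [x]) p), word_act M q v)"
      unfolding r ext G.uea_simps(2)[OF X pq(1)] G.uea_simps(2)[OF X GW_mult[OF pq(1) sub_lists[OF pq(2)]]]
        word_mult_assoc ..
    then show ?thesis
      using Ind.N_rel[OF balance_relation_mem[OF GW_mult[OF X pq(1)] pq(2,3)]] by simp
  qed
qed

abbreviation "IndM \<equiv> induced_module G H M"

lemma acts_linearly_Ind: "acts_linearly G IndM"
  unfolding induced_module_eq by (rule Ind.acts_linearly_presented[OF keys_ind_act ind_act_relation])

sublocale IndC: complex_space IndM
  by (rule acts_linearlyD(1)[OF acts_linearly_Ind])

text \<open>
  The tensor of the class of \<open>p\<close> with \<open>v\<close>.
\<close>

definition gen where "gen p v = residue ind_gens ind_rels (basis (G.cls p, v))"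

lemma gen_closed: "p \<in> G.W \<Longrightarrow> v \<in> carrier M \<Longrightarrow> gen p v \<in> carrier IndM"
  unfolding gen_def induced_module_eq by (rule Ind.residue_in_carrier) (simp add: cls_closed)

lemma act_gen:
  assumes x: "x \<in> carrier G" and p: "p \<in> G.W"
  shows "act IndM x (gen p v) = gen (word_mult (basis [x]) p) v"
proof -
  have "act IndM x (gen p v) = residue ind_gens ind_rels (linear_extension (ind_act x) (basis (G.cls p, v)))"
    unfolding gen_def induced_module_eq by (rule Ind.presented_act[of ind_act x, OF keys_ind_act[OF x] ind_act_relation[OF x]])
  then show ?thesis
    by (simp only: gen_def linear_extension_basis prod.case G.uea_simps(2)[OF GW_letter[OF x] p])
qed

lemma gen_tensor_relation: "r \<in> tensor_relations (uea G) M \<Longrightarrow> r \<in> Ind.N"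
  using Ind.N_rel by blast

lemma linear_gen_right:
  assumes p: "p \<in> G.W"
  shows "linear_map M IndM (gen p)"
proof (rule linear_mapI)
  note u = G.cls_in_uea[OF p]
  show "gen p v \<in> carrier IndM" if "v \<in> carrier M" for v by (rule gen_closed[OF p that])
  show "gen p (v \<oplus>\<^bsub>M\<^esub> v') = gen p v \<oplus>\<^bsub>IndM\<^esub> gen p v'" if "v \<in> carrier M" "v' \<in> carrier M" for v v'
    unfolding gen_def induced_module_eq Ind.presented_add Ind.residue_eq_iff
    using gen_tensor_relation[OF tensor_relationsI(2)[OF u that]] by (simp add: diff_diff_eq)
  show "gen p (c \<odot>\<^bsub>M\<^esub> v) = c \<odot>\<^bsub>IndM\<^esub> gen p v" if "v \<in> carrier M" for c v
    unfolding gen_def induced_module_eq Ind.presented_smult Ind.residue_eq_iff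
    by (rule gen_tensor_relation[OF tensor_relationsI(4)[OF u that]])
qed

lemma linear_gen_left:
  assumes v: "v \<in> carrier M"
  shows "linear_map (free_space (lists (carrier G))) IndM (\<lambda>p. gen p v)"
proof (rule linear_mapI; unfold free_space_simps)
  show "gen p v \<in> carrier IndM" if "p \<in> G.W" for p by (rule gen_closed[OF that v])
  show "gen (p + q) v = gen p v \<oplus>\<^bsub>IndM\<^esub> gen q v" if pq: "p \<in> G.W" "q \<in> G.W" for p q
    unfolding gen_def induced_module_eq Ind.presented_add Ind.residue_eq_iff
    using gen_tensor_relation[OF tensor_relationsI(1)[OF G.cls_in_uea[OF pq(1)] G.cls_in_uea[OF pq(2)] v]]
    unfolding G.uea_simps(3)[OF pq] by (simp add: diff_diff_eq)
  show "gen (scale c p) v = c \<odot>\<^bsub>IndM\<^esub> gen p v" if p: "p \<in> G.W" for c p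
    unfolding gen_def induced_module_eq Ind.presented_smult Ind.residue_eq_iff
    using gen_tensor_relation[OF tensor_relationsI(3)[OF G.cls_in_uea[OF p] v]]
    unfolding G.uea_smult[OF p] .
qed

lemma gen_balance:
  "p \<in> G.W \<Longrightarrow> q \<in> W \<Longrightarrow> v \<in> carrier M \<Longrightarrow> gen (word_mult p q) v = gen p (word_act M q v)"
  unfolding gen_def Ind.residue_eq_iff by (rule Ind.N_rel[OF balance_relation_mem])

lemma gen_cong:
  "p - q \<in> G.UI \<Longrightarrow> gen p v = gen q v"
  by (simp only: gen_def G.cls_eq_iff[symmetric])

lemma Ind_induct [consumes 1, case_names word add zero scale]:
  assumes "z \<in> carrier IndM"
    and "\<And>w v. w \<in> lists (carrier G) \<Longrightarrow> v \<in> carrier M \<Longrightarrow> P (gen (basis w) v)"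
    and "\<And>y z. y \<in> carrier IndM \<Longrightarrow> z \<in> carrier IndM \<Longrightarrow> P y \<Longrightarrow> P z \<Longrightarrow> P (y \<oplus>\<^bsub>IndM\<^esub> z)"
    and "P \<zero>\<^bsub>IndM\<^esub>"
    and "\<And>c z. z \<in> carrier IndM \<Longrightarrow> P z \<Longrightarrow> P (c \<odot>\<^bsub>IndM\<^esub> z)"
  shows "P z"
proof -
  have gen: "P (gen p v)" if p: "p \<in> G.W" and v: "v \<in> carrier M" for p v
  proof -
    note lin = linear_mapD[OF linear_gen_left[OF v], unfolded free_space_simps]
    have "keys p \<subseteq> lists (carrier G)" using p by simp
    then show ?thesis
    proof (induction p rule: free_induct)
      case (add p q)
      then have "p \<in> G.W" "q \<in> G.W" by simp_all
      then show ?case using add lin(1,2) assms(3) by metis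
    next
      case zero
      show ?case
        using linear_map_zero[OF linear_gen_left[OF v] complex_space_free_space IndC.complex_space_axioms] assms(4)
        unfolding free_space_simps by metis
    next
      case (scale c p)
      then have "p \<in> G.W" by simp
      then show ?case using scale lin(1,3) assms(5) by metis
    qed (use assms(2) v in blast)
  qed
  from assms(1) show ?thesis
    unfolding induced_module_eq
  proof (induction z rule: Ind.presented_induct)
    case (basis x)
    then obtain u v where x: "x = (u, v)" "u \<in> carrier (uea G)" "v \<in> carrier M" by blast
    obtain p where "p \<in> G.W" "u = G.cls p" using x(2) by (rule G.uea_cases)
    then show ?case using gen[of p v] x unfolding gen_def by simp
  qed (use assms(3-5) in \<open>simp_all only: induced_module_eq\<close>)
qed

lemma Ind_linear_eqI:
  assumes "linear_map IndM V f" "linear_map IndM V g" "complex_space V"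
    and "\<And>p v. p \<in> G.W \<Longrightarrow> v \<in> carrier M \<Longrightarrow> f (gen p v) = g (gen p v)" and "z \<in> carrier IndM"
  shows "f z = g z"
proof -
  have "f (residue ind_gens ind_rels (basis b)) = g (residue ind_gens ind_rels (basis b))" if "b \<in> ind_gens" for b
  proof -
    obtain u v where b: "b = (u, v)" "u \<in> carrier (uea G)" "v \<in> carrier M" by (cases b) (use \<open>b \<in> ind_gens\<close> in auto)
    obtain p where "p \<in> G.W" "u = G.cls p" using b(2) by (rule G.uea_cases)
    then show ?thesis using assms(4)[of p v] b unfolding gen_def by simp
  qed
  then show ?thesis
    using Ind.linear_map_eqI[of ind_act V f g z] assms(1-3,5) unfolding induced_module_eq by blast
qed

lemma linear_add_maps:
  assumes "linear_map V V' f" "linear_map V V' g" "complex_space V'"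
  shows "linear_map V V' (\<lambda>v. f v \<oplus>\<^bsub>V'\<^esub> c \<odot>\<^bsub>V'\<^esub> g v)"
proof -
  interpret complex_space V' by fact
  show ?thesis
    using linear_mapD[OF assms(1)] linear_mapD[OF assms(2)]
    by (intro linear_mapI) (simp_all add: smult_oplus smult_smult M.a_ac mult.commute)
qed

text \<open>
  Each axiom is an identity between linear endomorphisms, so it is checked on the tensors
  \<open>gen p v\<close>, where it is one of the defining relations of the enveloping algebra
  multiplied by \<open>p\<close> from the right.
\<close>

lemma is_lie_module_Ind: "is_lie_module G IndM"
proof (rule is_lie_moduleI[OF acts_linearly_Ind])
  note L = acts_linearlyD(2)[OF acts_linearly_Ind]
  note C = IndC.complex_space_axioms
  fix x y z assume x: "x \<in> carrier G" and y: "y \<in> carrier G" and z: "z \<in> carrier IndM"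
  note X = GW_letter[OF x] and Y = GW_letter[OF y]
  show "act IndM (x \<oplus>\<^bsub>G\<^esub> y) z = act IndM x z \<oplus>\<^bsub>IndM\<^esub> act IndM y z"
  proof -
    have xy: "x \<oplus>\<^bsub>G\<^esub> y \<in> carrier G" using x y G.add_closed by blast
    have "act IndM (x \<oplus>\<^bsub>G\<^esub> y) z = act IndM x z \<oplus>\<^bsub>IndM\<^esub> 1 \<odot>\<^bsub>IndM\<^esub> act IndM y z"
    proof (rule Ind_linear_eqI[OF L[OF xy] linear_add_maps[OF L[OF x] L[OF y] C] C _ z])
      fix p :: "'g list \<Rightarrow>\<^sub>0 complex" and v assume p: "p \<in> G.W" and v: "v \<in> carrier M"
      have "word_mult (basis [x \<oplus>\<^bsub>G\<^esub> y] - basis [x] - basis [y]) p \<in> G.UI"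
        by (rule G.UI_mult_right[OF G.UI_relations]) (use x y p in \<open>auto simp: G.uea_relations_def\<close>)
      then have "gen (word_mult (basis [x \<oplus>\<^bsub>G\<^esub> y]) p) v = gen (word_mult (basis [x]) p + word_mult (basis [y]) p) v"
        by (intro gen_cong) (simp add: word_mult_diff_left diff_diff_eq word_mult_add_left)
      also have "\<dots> = gen (word_mult (basis [x]) p) v \<oplus>\<^bsub>IndM\<^esub> gen (word_mult (basis [y]) p) v"
        using linear_mapD(2)[OF linear_gen_left[OF v]] GW_mult[OF X p] GW_mult[OF Y p] by simp
      finally show "act IndM (x \<oplus>\<^bsub>G\<^esub> y) (gen p v) = act IndM x (gen p v) \<oplus>\<^bsub>IndM\<^esub> 1 \<odot>\<^bsub>IndM\<^esub> act IndM y (gen p v)"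
        using act_gen[OF xy p] act_gen[OF x p] act_gen[OF y p] gen_closed[OF GW_mult[OF Y p] v] by simp
    qed
    then show ?thesis using acts_linearlyD(3)[OF acts_linearly_Ind y z] by simp
  qed
  show "act IndM (bracket G x y) z = act IndM x (act IndM y z) \<oplus>\<^bsub>IndM\<^esub> (-1) \<odot>\<^bsub>IndM\<^esub> act IndM y (act IndM x z)"
  proof -
    have xy: "bracket G x y \<in> carrier G" using x y G.bracket_closed by blast
    show ?thesis
    proof (rule Ind_linear_eqI[OF L[OF xy] linear_add_maps[OF linear_map_comp[OF L[OF y] L[OF x]]
            linear_map_comp[OF L[OF x] L[OF y]] C] C _ z])
      fix p :: "'g list \<Rightarrow>\<^sub>0 complex" and v assume p: "p \<in> G.W" and v: "v \<in> carrier M"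
      have "word_mult (basis [x, y] - basis [y, x] - basis [bracket G x y]) p \<in> G.UI"
        by (rule G.UI_mult_right[OF G.UI_relations]) (use x y p in \<open>auto simp: G.uea_relations_def\<close>)
      from G.UI_scale[OF this, of "-1"]
      have *: "word_mult (basis [bracket G x y]) p - (word_mult (basis [x, y]) p + scale (-1) (word_mult (basis [y, x]) p)) \<in> G.UI"
        by (simp add: word_mult_diff_left word_mult_add_left algebra_simps)
      have xyp: "word_mult (basis [x]) (word_mult (basis [y]) p) = word_mult (basis [x, y]) p"
        "word_mult (basis [y]) (word_mult (basis [x]) p) = word_mult (basis [y, x]) p"
        by (simp_all add: word_mult_assoc[symmetric])
      have w: "word_mult (basis [x, y]) p \<in> G.W" "word_mult (basis [y, x]) p \<in> G.W"
        by (rule GW_mult[OF _ p]; use x y in simp)+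
      then have w': "scale (-1) (word_mult (basis [y, x]) p) \<in> G.W" using keys_scale_subset by blast
      have "gen (word_mult (basis [bracket G x y]) p) v =
          gen (word_mult (basis [x, y]) p) v \<oplus>\<^bsub>IndM\<^esub> (-1) \<odot>\<^bsub>IndM\<^esub> gen (word_mult (basis [y, x]) p) v"
        unfolding gen_cong[OF *]
        using linear_mapD(2)[OF linear_gen_left[OF v], unfolded free_space_simps, OF w(1) w']
          linear_mapD(3)[OF linear_gen_left[OF v], unfolded free_space_simps, OF w(2), of "-1"] by metis
      then show "act IndM (bracket G x y) (gen p v) =
          act IndM x (act IndM y (gen p v)) \<oplus>\<^bsub>IndM\<^esub> (-1) \<odot>\<^bsub>IndM\<^esub> act IndM y (act IndM x (gen p v))"
        using act_gen[OF xy p] act_gen[OF x p] act_gen[OF y p] act_gen[OF x GW_mult[OF Y p]]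
          act_gen[OF y GW_mult[OF X p]] by (simp only: xyp)
    qed
  qed
next
  note L = acts_linearlyD(2)[OF acts_linearly_Ind]
  note C = IndC.complex_space_axioms
  fix c x z assume x: "x \<in> carrier G" and z: "z \<in> carrier IndM"
  note X = GW_letter[OF x]
  have cx: "c \<odot>\<^bsub>G\<^esub> x \<in> carrier G" using x G.smult_closed by blast
  have lin: "linear_map IndM IndM (\<lambda>z. c \<odot>\<^bsub>IndM\<^esub> act IndM x z)"
    using linear_mapD[OF L[OF x]]
    by (intro linear_mapI) (simp_all add: IndC.smult_oplus IndC.smult_smult mult.commute)
  show "act IndM (c \<odot>\<^bsub>G\<^esub> x) z = c \<odot>\<^bsub>IndM\<^esub> act IndM x z"
  proof (rule Ind_linear_eqI[OF L[OF cx] lin C _ z])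
    fix p :: "'g list \<Rightarrow>\<^sub>0 complex" and v assume p: "p \<in> G.W" and v: "v \<in> carrier M"
    have "word_mult (basis [c \<odot>\<^bsub>G\<^esub> x] - scale c (basis [x])) p \<in> G.UI"
      by (rule G.UI_mult_right[OF G.UI_relations]) (use x p in \<open>auto simp: G.uea_relations_def\<close>)
    then have "gen (word_mult (basis [c \<odot>\<^bsub>G\<^esub> x]) p) v = gen (scale c (word_mult (basis [x]) p)) v"
      by (intro gen_cong) (simp only: word_mult_diff_left word_mult_scale_left)
    also have "\<dots> = c \<odot>\<^bsub>IndM\<^esub> gen (word_mult (basis [x]) p) v"
      using linear_mapD(3)[OF linear_gen_left[OF v]] GW_mult[OF X p] by simp
    finally show "act IndM (c \<odot>\<^bsub>G\<^esub> x) (gen p v) = c \<odot>\<^bsub>IndM\<^esub> act IndM x (gen p v)"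
      using act_gen[OF cx p] act_gen[OF x p] by simp
  qed
qed

lemma act_gen_one:
  assumes "x \<in> carrier H" "v \<in> carrier M"
  shows "act IndM x (gen (basis []) v) = gen (basis []) (act M x v)"
proof -
  have x: "x \<in> carrier G" using assms(1) sub_carrier by blast
  have "act IndM x (gen (basis []) v) = gen (word_mult (basis []) (basis [x])) v"
    using act_gen[OF x, of "basis []" v] by simp
  also have "\<dots> = gen (basis []) (word_act M (basis [x]) v)"
    by (rule gen_balance) (use assms in simp_all)
  finally show ?thesis using assms by (simp add: word_act_basis)
qed

text \<open>
  Frobenius reciprocity: letting the enveloping algebra act on \<open>\<iota> v\<close> is
  bilinear, and it respects the balancing relations because \<open>\<iota>\<close> intertwines the
  actions of \<open>H\<close>.
\<close>

lemma exists_map_from_Ind: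
  assumes V: "is_lie_module G V" and iota: "linear_map M V \<iota>"
    and equiv: "\<And>x v. x \<in> carrier H \<Longrightarrow> v \<in> carrier M \<Longrightarrow> \<iota> (act M x v) = act V x (\<iota> v)"
  shows "\<exists>f. linear_map IndM V f \<and> (\<forall>v\<in>carrier M. f (gen (basis []) v) = \<iota> v)"
proof -
  interpret V: lie_representation G V by unfold_locales (rule V)
  note \<iota>c = linear_mapD(1)[OF iota]
  have act_\<iota>: "\<iota> (word_act M q v) = word_act V q (\<iota> v)" if q: "q \<in> W" and v: "v \<in> carrier M" for q v
  proof -
    have w: "\<iota> (foldr (act M) w v) = foldr (act V) w (\<iota> v)" if "w \<in> lists (carrier H)" for w
      using that by (induction w) (use v word_closed equiv in auto)
    have f: "(\<lambda>w. foldr (act M) w v) \<in> keys q \<rightarrow> carrier M"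
      by (rule M.subset_funcset[OF word_fun[OF v]]) (use q in simp)
    have "\<iota> (word_act M q v) = combination V (\<lambda>w. \<iota> (foldr (act M) w v)) q"
      unfolding word_act_combination
      by (rule linear_map_of_combination[OF iota M.complex_space_axioms V.M.complex_space_axioms f])
    also have "\<dots> = combination V (\<lambda>w. foldr (act V) w (\<iota> v)) q"
    proof (rule V.M.combination_cong)
      show "\<iota> (foldr (act M) x v) = foldr (act V) x (\<iota> v)" if "x \<in> keys q" for x
        by (rule w) (use q that in blast)
      show "(\<lambda>w. \<iota> (foldr (act M) w v)) \<in> keys q \<rightarrow> carrier V" using f \<iota>c by (auto simp: Pi_iff)
    qed
    finally show ?thesis by (simp add: V.word_act_combination)
  qed
  define F where "F = (\<lambda>(u, v). uea_act V u (\<iota> v))"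
  have F: "F (G.cls p, v) = word_act V p (\<iota> v)" if "p \<in> G.W" "v \<in> carrier M" for p v
    unfolding F_def prod.case by (rule V.uea_act_cls[OF that(1) \<iota>c[OF that(2)]])
  have Fc: "F (u, v) \<in> carrier V" if u: "u \<in> carrier (uea G)" and v: "v \<in> carrier M" for u v
  proof -
    obtain p where p: "p \<in> G.W" "u = G.cls p" using u by (rule G.uea_cases)
    show ?thesis unfolding p(2) F[OF p(1) v] by (rule V.word_act_closed[OF p(1) \<iota>c[OF v]])
  qed
  then have FB: "F \<in> ind_gens \<rightarrow> carrier V" by auto
  have F1: "F (u \<oplus>\<^bsub>uea G\<^esub> u', v) = F (u, v) \<oplus>\<^bsub>V\<^esub> F (u', v)"
    if u: "u \<in> carrier (uea G)" "u' \<in> carrier (uea G)" and v: "v \<in> carrier M" for u u' v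
  proof -
    obtain p where p: "p \<in> G.W" "u = G.cls p" using u(1) by (rule G.uea_cases)
    obtain q where q: "q \<in> G.W" "u' = G.cls q" using u(2) by (rule G.uea_cases)
    have "p + q \<in> G.W" using p q by simp
    then show ?thesis
      using V.word_act_add[OF \<iota>c[OF v], of p q] p(1) q(1)
      unfolding p(2) q(2) G.uea_simps(3)[OF p(1) q(1)] by (simp only: F[OF _ v])
  qed
  have F2: "F (c \<odot>\<^bsub>uea G\<^esub> u, v) = c \<odot>\<^bsub>V\<^esub> F (u, v)" if u: "u \<in> carrier (uea G)" and v: "v \<in> carrier M" for u c v
  proof -
    obtain p where p: "p \<in> G.W" "u = G.cls p" using u by (rule G.uea_cases)
    have "scale c p \<in> G.W" using p by simp
    then show ?thesis
      using V.word_act_scale[OF \<iota>c[OF v], of p c] p(1)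
      unfolding p(2) G.uea_smult[OF p(1)] by (simp only: F[OF _ v])
  qed
  have FR: "linear_map M V (\<lambda>v. F (u, v))" if u: "u \<in> carrier (uea G)" for u
  proof -
    obtain p where p: "p \<in> G.W" "u = G.cls p" using u by (rule G.uea_cases)
    have "linear_map M V (\<lambda>v. word_act V p (\<iota> v))"
      by (rule linear_map_comp[OF iota V.linear_word_act_right[OF p(1)]])
    moreover have "F (u, v) = word_act V p (\<iota> v)" if "v \<in> carrier M" for v
      using F[OF p(1) that] p(2) by simp
    ultimately show ?thesis by (simp add: linear_map_def Pi_iff)
  qed
  note FRD = linear_mapD[OF FR]
  note comb = V.M.combination_diff[OF FB] V.M.combination_scale[OF FB]
  have uc: "u \<oplus>\<^bsub>uea G\<^esub> u' \<in> carrier (uea G)" "c \<odot>\<^bsub>uea G\<^esub> u \<in> carrier (uea G)"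
    if "u \<in> carrier (uea G)" "u' \<in> carrier (uea G)" for u u' c
  proof -
    interpret U: complex_space "uea G" by (rule G.complex_space_uea)
    show "u \<oplus>\<^bsub>uea G\<^esub> u' \<in> carrier (uea G)" "c \<odot>\<^bsub>uea G\<^esub> u \<in> carrier (uea G)" using that by auto
  qed
  have rel: "combination V F r = \<zero>\<^bsub>V\<^esub>" if "r \<in> ind_rels" for r
    using that
  proof
    assume "r \<in> tensor_relations (uea G) M"
    then show ?thesis
    proof (cases rule: tensor_relations_cases)
      case (1 u u' v)
      then show ?thesis
        by (simp add: comb Fc uc F1 a_minus_def V.M.M.minus_add V.M.M.a_ac V.M.M.r_neg V.M.M.r_neg1)
    next
      case (2 u v v')
      then show ?thesis
        by (simp add: comb Fc FRD(2) a_minus_def V.M.M.minus_add V.M.M.a_ac V.M.M.r_neg V.M.M.r_neg1)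
    next
      case (3 c u v)
      then show ?thesis
        by (simp add: comb Fc uc F2 a_minus_def V.M.M.r_neg)
    next
      case (4 c u v)
      then show ?thesis
        by (simp add: comb Fc FRD(3) a_minus_def V.M.M.r_neg)
    qed
  next
    assume "r \<in> balance_relations"
    then show ?thesis
    proof (rule balance_cases)
      fix p q v assume r: "r = basis (G.cls (word_mult p q), v) - basis (G.cls p, word_act M q v)"
        and pq: "p \<in> G.W" "q \<in> W" "v \<in> carrier M"
      note pqG = GW_mult[OF pq(1) sub_lists[OF pq(2)]]
      have "F (G.cls (word_mult p q), v) = F (G.cls p, word_act M q v)"
        unfolding F[OF pqG pq(3)] F[OF pq(1) word_act_closed[OF pq(2,3)]] act_\<iota>[OF pq(2,3)]
        by (rule V.word_act_mult[OF pq(1) sub_lists[OF pq(2)] \<iota>c[OF pq(3)]])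
      then show ?thesis
        unfolding r using pq word_act_closed[OF pq(2,3)] G.cls_in_uea[OF pqG] G.cls_in_uea[OF pq(1)]
        by (simp add: comb Fc a_minus_def V.M.M.r_neg)
    qed
  qed
  obtain f where f: "linear_map IndM V f" "\<And>p. keys p \<subseteq> ind_gens \<Longrightarrow> f (residue ind_gens ind_rels p) = combination V F p"
    using Ind.exists_linear_map[OF V.M.complex_space_axioms FB rel, where F = ind_act] unfolding induced_module_eq by blast
  have "f (gen (basis []) v) = \<iota> v" if v: "v \<in> carrier M" for v
  proof -
    have one: "basis [] \<in> G.W" by simp
    have "f (gen (basis []) v) = F (G.cls (basis []), v)"
      unfolding gen_def using f(2)[of "basis (G.cls (basis []), v)"] cls_closed[OF one v] Fc[OF G.cls_in_uea[OF one] v]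
      by simp
    then show ?thesis using F[OF one v] \<iota>c[OF v] by (simp add: V.word_act_basis)
  qed
  then show ?thesis using f(1) by blast
qed

end

section \<open>Extending a representation of a subalgebra\<close>

text \<open>
  An argument of Poincare-Birkhoff-Witt type, relative to a subalgebra. A Lie algebra has the
  basis \<open>'b\<close>, with bracket \<open>br\<close> on basis elements (letters); the letters
  outside \<open>neg\<close> span a subalgebra, which is represented by \<open>rho\<close> on the
  free space on \<open>'v\<close>. The representation extends to the whole algebra on the free
  space on pairs of a sorted word in \<open>neg\<close> and an element of \<open>'v\<close>. The
  map \<open>rk\<close> serves only to sort the letters of \<open>neg\<close>.
\<close>

locale partial_representation =
  fixes br :: "'b \<Rightarrow> 'b \<Rightarrow> 'b \<Rightarrow>\<^sub>0 complex" and neg :: "'b set" and rk :: "'b \<Rightarrow> int"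
    and rho :: "'b \<Rightarrow> 'v \<Rightarrow> 'v \<Rightarrow>\<^sub>0 complex"
  assumes inj_rk: "inj_on rk neg"
    and br_self: "br x x = 0"
    and br_swap: "br y x = - br x y"
    and jacobi: "linear_extension (br x) (br y z) =
      linear_extension (br y) (br x z) + linear_extension (\<lambda>u. br u z) (br x y)"
    and br_closed: "x \<notin> neg \<Longrightarrow> y \<notin> neg \<Longrightarrow> keys (br x y) \<inter> neg = {}"
    and rho_bracket: "x \<notin> neg \<Longrightarrow> y \<notin> neg \<Longrightarrow>
      linear_extension (rho x) (rho y v) - linear_extension (rho y) (rho x v) =
      linear_extension (\<lambda>z. rho z v) (br x y)"
begin

abbreviation below :: "'b \<Rightarrow> 'b list \<Rightarrow> bool"
  where "below x t \<equiv> x \<in> neg \<and> (\<forall>y\<in>set t. rk x \<le> rk y)"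

text \<open>
  The action of a letter \<open>x\<close> on a sorted word. A letter of \<open>neg\<close> that
  can be put in front is put there, and a letter of the subalgebra acts on the empty word through
  \<open>rho\<close>. Otherwise \<open>x y t = y x t + [x, y] t\<close> has to hold for the first
  letter \<open>y\<close> of the word. The recursion is nested, since \<open>y\<close> acts on the
  result of \<open>x t\<close>, and terminates because that result is a word in front of which
  \<open>y\<close> can be put, plus terms shorter than the given word; a bound on the depth avoids
  proving this at the time of definition.
\<close>

primrec act_fuel :: "nat \<Rightarrow> 'b \<Rightarrow> 'b list \<times> 'v \<Rightarrow> ('b list \<times> 'v) \<Rightarrow>\<^sub>0 complex" where
  "act_fuel 0 x s = 0"
| "act_fuel (Suc n) x s =
    (if below x (fst s) then basis (x # fst s, snd s)
     else case fst s of
       [] \<Rightarrow> linear_extension (\<lambda>v. basis ([], v)) (rho x (snd s))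
     | y # t \<Rightarrow> linear_extension (act_fuel n y) (act_fuel n x (t, snd s)) +
         linear_extension (\<lambda>z. act_fuel n z (t, snd s)) (br x y))"

text \<open>
  The basis of the filtration of the module by the length of words.
\<close>

definition standard :: "nat \<Rightarrow> ('b list \<times> 'v) set"
  where "standard d = {s. sorted (map rk (fst s)) \<and> set (fst s) \<subseteq> neg \<and> length (fst s) \<le> d}"

abbreviation "ins \<equiv> insort_key rk"

text \<open>
  The leading term of the action of \<open>x\<close>: insertion into the sorted word.
\<close>

definition lead :: "'b \<Rightarrow> 'b list \<Rightarrow> 'v \<Rightarrow> ('b list \<times> 'v) \<Rightarrow>\<^sub>0 complex"
  where "lead x t v = (if x \<in> neg then basis (ins x t, v) else 0)"

lemma standard_mono: "d \<le> d' \<Longrightarrow> standard d \<subseteq> standard d'"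
  by (auto simp: standard_def)

lemma standard_ConsD:
  assumes "(y # t, v) \<in> standard d"
  shows "below y t" "(t, v) \<in> standard (length t)" "length t < d" "y \<in> neg"
  using assms by (auto simp: standard_def)

lemma not_below_Cons:
  assumes "(y # t, v) \<in> standard d" "\<not> below x (y # t)" "x \<in> neg"
  shows "rk y < rk x"
  using assms by (force simp: standard_def)

lemma standard_ins: "x \<in> neg \<Longrightarrow> (t, v) \<in> standard d \<Longrightarrow> (ins x t, v) \<in> standard (Suc d)"
  by (auto simp: standard_def sorted_insort_key set_insort_key)

lemma keys_lead: "(t, v) \<in> standard d \<Longrightarrow> keys (lead x t v) \<subseteq> standard (Suc d)"
  by (auto simp: lead_def standard_ins)

lemma ins_below: "below x t \<Longrightarrow> ins x t = x # t"
  by (cases t) auto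

lemma act_fuel_below: "n > 0 \<Longrightarrow> below x t \<Longrightarrow> act_fuel n x (t, v) = basis (x # t, v)"
  by (cases n) auto

text \<open>
  The action is insertion up to terms no longer than the given word. If \<open>x\<close> moves
  past the first letter \<open>y\<close>, the leading term of \<open>x t\<close> starts with
  letters not before \<open>y\<close>, so \<open>y\<close> is put in front of it; all other terms
  have length at most that of \<open>y t\<close>.
\<close>

lemma keys_act_fuel:
  assumes "(t, v) \<in> standard d" "length t < n"
  shows "keys (act_fuel n x (t, v) - lead x t v) \<subseteq> standard (length t)"
  using assms
proof (induction n arbitrary: x t v d)
  case (Suc m)
  have full: "keys (act_fuel m y s) \<subseteq> standard (Suc e)" if s: "s \<in> standard e" "e < m" for s e y
  proof -
    obtain t' v' where tv: "s = (t', v')" by (cases s)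
    have le: "length t' \<le> e" using s(1) tv by (simp add: standard_def)
    have "keys (act_fuel m y (t', v') - lead y t' v') \<subseteq> standard (length t')"
      by (rule Suc.IH) (use s tv le in auto)
    then have "keys (act_fuel m y (t', v') - lead y t' v') \<subseteq> standard (Suc e)"
      using standard_mono[of "length t'" "Suc e"] le by auto
    moreover have "keys (lead y t' v') \<subseteq> standard (Suc e)" using keys_lead s(1) tv by blast
    ultimately show ?thesis using keys_add_subset[of "act_fuel m y (t', v') - lead y t' v'" "standard (Suc e)" "lead y t' v'"] tv by simp
  qed
  show ?case
  proof (cases "below x t")
    case True
    then show ?thesis by (simp add: lead_def ins_below)
  next
    case nb: False
    show ?thesis
    proof (cases t)
      case Nil
      then have "x \<notin> neg" using nb by simp
      moreover have "keys (linear_extension (\<lambda>v. basis ([], v)) (rho x v)) \<subseteq> standard 0"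
        by (rule keys_linear_extension) (simp add: standard_def)
      ultimately show ?thesis using Nil by (simp add: lead_def)
    next
      case (Cons y u)
      note st = standard_ConsD[OF Suc.prems(1)[unfolded Cons]]
      have m: "length u < m" using Suc.prems(2) Cons by simp
      define w where "w = act_fuel m x (u, v) - lead x u v"
      have w: "keys w \<subseteq> standard (length u)" unfolding w_def by (rule Suc.IH[OF st(2) m])
      have "keys (linear_extension (act_fuel m y) w) \<subseteq> standard (Suc (length u))"
        by (rule keys_linear_extension) (use w full m in blast)
      moreover have "keys (linear_extension (\<lambda>z. act_fuel m z (u, v)) (br x y)) \<subseteq> standard (Suc (length u))"
        by (rule keys_linear_extension) (use full st(2) m in blast)
      moreover have "linear_extension (act_fuel m y) (lead x u v) = lead x t v"
      proof (cases "x \<in> neg")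
        case True
        then have lt: "rk y < rk x" using not_below_Cons[OF Suc.prems(1)[unfolded Cons]] nb Cons by blast
        then have "below y (ins x u)" using st(1) by (auto simp: set_insort_key)
        then show ?thesis using True lt m Cons by (simp add: lead_def act_fuel_below)
      qed (simp add: lead_def)
      moreover have "act_fuel (Suc m) x (t, v) = linear_extension (act_fuel m y) (act_fuel m x (u, v)) +
          linear_extension (\<lambda>z. act_fuel m z (u, v)) (br x y)"
        using nb Cons by (subst act_fuel.simps(2)) auto
      moreover have "act_fuel m x (u, v) = w + lead x u v" by (simp add: w_def)
      ultimately have "act_fuel (Suc m) x (t, v) - lead x t v = linear_extension (act_fuel m y) w +
          linear_extension (\<lambda>z. act_fuel m z (u, v)) (br x y)"
        and "keys (linear_extension (act_fuel m y) w + linear_extension (\<lambda>z. act_fuel m z (u, v)) (br x y))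
          \<subseteq> standard (Suc (length u))"
        by (simp_all add: linear_extension_add del: act_fuel.simps)
      then show ?thesis using Cons by (simp del: act_fuel.simps)
    qed
  qed
qed simp

text \<open>
  Since \<open>x t\<close> is known up to shorter words, two operators agree on it once they agree
  on short words and on words that \<open>y\<close> can be put in front of.
\<close>

lemma act_fuel_linear_cong:
  assumes t: "(t, v) \<in> standard d" "length t < n" and y: "below y t" and x: "x \<in> neg \<Longrightarrow> rk y \<le> rk x"
    and eq: "\<And>s. s \<in> standard (length t) \<Longrightarrow> f s = g s"
    and below: "\<And>s. below y (fst s) \<Longrightarrow> f s = g s"
  shows "linear_extension f (act_fuel n x (t, v)) = linear_extension g (act_fuel n x (t, v))"
proof (rule linear_extension_cong)
  fix s assume "s \<in> keys (act_fuel n x (t, v))"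
  then have "s \<in> keys (act_fuel n x (t, v) - lead x t v) \<or> s \<in> keys (lead x t v)"
    using Poly_Mapping.keys_add[of "act_fuel n x (t, v) - lead x t v" "lead x t v"] by auto
  then show "f s = g s"
  proof
    assume "s \<in> keys (act_fuel n x (t, v) - lead x t v)"
    then show ?thesis using eq keys_act_fuel[OF t] by blast
  next
    assume "s \<in> keys (lead x t v)"
    then have "x \<in> neg" "s = (ins x t, v)" by (auto simp: lead_def split: if_splits)
    then show ?thesis using below[of s] x y by (auto simp: set_insort_key)
  qed
qed

text \<open>
  Any bound exceeding the length of the word gives the same result, so the bound can be dropped
  afterwards.
\<close>

lemma act_fuel_Suc:
  assumes "(t, v) \<in> standard d" "length t < n"
  shows "act_fuel (Suc n) x (t, v) = act_fuel n x (t, v)"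
  using assms
proof (induction n arbitrary: x t v d)
  case (Suc m)
  show ?case
  proof (cases "below x t \<or> t = []")
    case True
    then show ?thesis by (auto split: list.split)
  next
    case False
    then obtain y u where t: "t = y # u" by (cases t) auto
    note st = standard_ConsD[OF Suc.prems(1)[unfolded t]]
    have m: "length u < m" using Suc.prems(2) t by simp
    have IH: "act_fuel (Suc m) z s = act_fuel m z s" if "s \<in> standard (length u)" for z s
    proof -
      have "length (fst s) < m" using that m by (auto simp: standard_def)
      then show ?thesis using Suc.IH[of "fst s" "snd s" "length u" z] that by simp
    qed
    have x: "x \<in> neg \<Longrightarrow> rk y \<le> rk x"
      using not_below_Cons[OF Suc.prems(1)[unfolded t]] False t by fastforce
    have "linear_extension (act_fuel (Suc m) y) (act_fuel m x (u, v)) = linear_extension (act_fuel m y) (act_fuel m x (u, v))"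
    proof (rule act_fuel_linear_cong[OF st(2) m st(1) x])
      fix s :: "'b list \<times> 'v" assume "below y (fst s)"
      then show "act_fuel (Suc m) y s = act_fuel m y s"
        using act_fuel_below[of m y "fst s" "snd s"] m by simp
    qed (use IH in simp_all)
    moreover have "act_fuel (Suc m) z (u, v) = act_fuel m z (u, v)" for z
      using IH st(2) by blast
    moreover have "act_fuel (Suc (Suc m)) x (t, v) = linear_extension (act_fuel (Suc m) y) (act_fuel (Suc m) x (u, v)) +
         linear_extension (\<lambda>z. act_fuel (Suc m) z (u, v)) (br x y)"
      using False t by (subst act_fuel.simps(2)) auto
    moreover have "act_fuel (Suc m) x (t, v) = linear_extension (act_fuel m y) (act_fuel m x (u, v)) +
         linear_extension (\<lambda>z. act_fuel m z (u, v)) (br x y)"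
      using False t by (subst act_fuel.simps(2)) auto
    ultimately show ?thesis by simp
  qed
qed simp

definition letter_act :: "'b \<Rightarrow> 'b list \<times> 'v \<Rightarrow> ('b list \<times> 'v) \<Rightarrow>\<^sub>0 complex"
  where "letter_act x s = act_fuel (Suc (length (fst s))) x s"

lemma act_fuel_eq_letter_act:
  assumes "(t, v) \<in> standard d" "length t < n"
  shows "act_fuel n x (t, v) = letter_act x (t, v)"
proof -
  have "Suc (length t) \<le> n" using assms(2) by simp
  then show ?thesis
  proof (induction n rule: dec_induct)
    case base
    show ?case by (simp only: letter_act_def fst_conv)
  next
    case (step n)
    then show ?case using act_fuel_Suc[OF assms(1), of n x] by simp
  qed
qed

lemma letter_act_below: "below x t \<Longrightarrow> letter_act x (t, v) = basis (x # t, v)"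
  by (simp add: letter_act_def)

lemma letter_act_Nil: "x \<notin> neg \<Longrightarrow> letter_act x ([], v) = linear_extension (\<lambda>v. basis ([], v)) (rho x v)"
  by (simp add: letter_act_def)

text \<open>
  The defining recursion without the bound. The bound left for the nested call is exceeded only by
  the leading term, where \<open>y\<close> is put in front in a single step.
\<close>

lemma letter_act_Cons:
  assumes t: "(y # t, v) \<in> standard d" and x: "\<not> below x (y # t)"
  shows "letter_act x (y # t, v) = linear_extension (letter_act y) (letter_act x (t, v)) + linear_extension (\<lambda>z. letter_act z (t, v)) (br x y)"
proof -
  note st = standard_ConsD[OF t]
  let ?n = "Suc (length t)"
  have "letter_act x (y # t, v) = linear_extension (act_fuel ?n y) (act_fuel ?n x (t, v)) +
      linear_extension (\<lambda>z. act_fuel ?n z (t, v)) (br x y)"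
    using x by (simp add: letter_act_def del: act_fuel.simps) (subst act_fuel.simps(2), auto)
  also have "linear_extension (act_fuel ?n y) (act_fuel ?n x (t, v)) = linear_extension (letter_act y) (act_fuel ?n x (t, v))"
  proof (rule act_fuel_linear_cong[OF st(2) _ st(1)])
    show "rk y \<le> rk x" if "x \<in> neg" using not_below_Cons[OF t x that] by simp
    fix s :: "'b list \<times> 'v" assume "s \<in> standard (length t)"
    then show "act_fuel ?n y s = letter_act y s"
      using act_fuel_eq_letter_act[of "fst s" "snd s" "length t" ?n y] by (simp add: standard_def)
  next
    fix s :: "'b list \<times> 'v" assume "below y (fst s)"
    then show "act_fuel ?n y s = letter_act y s"
      using act_fuel_below[of ?n y "fst s" "snd s"] letter_act_below[of y "fst s" "snd s"] by simp
  qed simp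
  finally have "letter_act x (y # t, v) = linear_extension (letter_act y) (act_fuel ?n x (t, v)) +
      linear_extension (\<lambda>z. act_fuel ?n z (t, v)) (br x y)" .
  moreover have "act_fuel ?n z (t, v) = letter_act z (t, v)" for z
    by (simp only: letter_act_def fst_conv)
  ultimately show ?thesis by (simp only:)
qed

lemma keys_letter_act: "(t, v) \<in> standard d \<Longrightarrow> keys (letter_act x (t, v) - lead x t v) \<subseteq> standard (length t)"
  unfolding letter_act_def using keys_act_fuel[of t v d "Suc (length t)" x] by simp

definition act_letter :: "'b \<Rightarrow> ('b list \<times> 'v \<Rightarrow>\<^sub>0 complex) \<Rightarrow> ('b list \<times> 'v) \<Rightarrow>\<^sub>0 complex"
  where "act_letter x P = linear_extension (letter_act x) P"

definition act_vector :: "('b \<Rightarrow>\<^sub>0 complex) \<Rightarrow> ('b list \<times> 'v \<Rightarrow>\<^sub>0 complex) \<Rightarrow> ('b list \<times> 'v) \<Rightarrow>\<^sub>0 complex"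
  where "act_vector p P = linear_extension (\<lambda>z. act_letter z P) p"

lemma act_letter_linear:
  "act_letter x (P + Q) = act_letter x P + act_letter x Q" "act_letter x (scale c P) = scale c (act_letter x P)" "act_letter x 0 = 0"
  "act_letter x (P - Q) = act_letter x P - act_letter x Q"
  by (simp_all add: act_letter_def linear_extension_add linear_extension_scale linear_extension_diff)

lemma act_letter_basis [simp]: "act_letter x (basis s) = letter_act x s"
  by (simp add: act_letter_def)

lemma act_vector_linear:
  "act_vector (p + q) P = act_vector p P + act_vector q P" "act_vector (scale c p) P = scale c (act_vector p P)" "act_vector 0 P = 0" "act_vector (p - q) P = act_vector p P - act_vector q P"
  "act_vector (- p) P = - act_vector p P"
  "act_vector p (P + Q) = act_vector p P + act_vector p Q" "act_vector p (scale c P) = scale c (act_vector p P)" "act_vector p 0 = 0"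
  by (simp_all add: act_vector_def linear_extension_add linear_extension_scale linear_extension_diff
      linear_extension_minus act_letter_linear linear_extension_add_fun linear_extension_scale_fun)
    (simp add: linear_extension_def)

lemma act_vector_basis [simp]: "act_vector (basis x) P = act_letter x P"
  by (simp add: act_vector_def)

definition commutes :: "'b \<Rightarrow> 'b \<Rightarrow> ('b list \<times> 'v \<Rightarrow>\<^sub>0 complex) \<Rightarrow> bool"
  where "commutes x y P \<longleftrightarrow> act_letter x (act_letter y P) = act_letter y (act_letter x P) + act_vector (br x y) P"

lemma commutes_sym: "commutes x y P \<Longrightarrow> commutes y x P"
  by (simp add: commutes_def br_swap[of x y] act_vector_linear)

lemma commutes_add: "commutes x y P \<Longrightarrow> commutes x y Q \<Longrightarrow> commutes x y (P + Q)"
  by (simp add: commutes_def act_letter_linear act_vector_linear algebra_simps)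

lemma commutes_linear:
  assumes "\<And>s. s \<in> S \<Longrightarrow> commutes x y (basis s)" "keys P \<subseteq> S"
  shows "commutes x y P"
  using assms(2)
proof (induction P rule: free_induct)
  case (scale c p)
  then show ?case by (simp add: commutes_def act_letter_linear act_vector_linear fs.scale_right_distrib)
qed (use assms(1) commutes_add in \<open>auto simp: commutes_def act_letter_linear act_vector_linear\<close>)

text \<open>
  If \<open>y\<close> can be put in front of the word, then the recursion for \<open>x\<close> on
  the word starting with \<open>y\<close> is the commutator identity itself, unless
  \<open>x\<close> comes before \<open>y\<close>; then the roles of the two letters are exchanged.
\<close>

lemma commutes_below:
  assumes t: "(t, v) \<in> standard d" and y: "below y t"
  shows "commutes x y (basis (t, v))"
proof (cases "x \<in> neg \<and> rk x \<le> rk y")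
  case True
  show ?thesis
  proof (cases "rk x = rk y")
    case True
    then have "x = y" using \<open>x \<in> neg \<and> rk x \<le> rk y\<close> y inj_rk by (auto simp: inj_on_def)
    then show ?thesis by (simp add: commutes_def br_self act_vector_linear)
  next
    case False
    have x: "below x t" using True y by force
    then have "(x # t, v) \<in> standard (Suc d)" using t by (auto simp: standard_def)
    moreover have "\<not> below y (x # t)" using True False by auto
    ultimately have "letter_act y (x # t, v) = linear_extension (letter_act x) (letter_act y (t, v)) + linear_extension (\<lambda>z. letter_act z (t, v)) (br y x)"
      by (rule letter_act_Cons)
    then have "act_letter y (act_letter x (basis (t, v))) = act_letter x (act_letter y (basis (t, v))) + act_vector (br y x) (basis (t, v))"
      using letter_act_below[OF x] by (simp add: act_letter_def act_vector_def)
    then show ?thesis by (simp add: commutes_def br_swap[of x y] act_vector_linear)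
  qed
next
  case False
  have "(y # t, v) \<in> standard (Suc d)" using t y by (auto simp: standard_def)
  moreover have "\<not> below x (y # t)" using False by auto
  ultimately have "letter_act x (y # t, v) = linear_extension (letter_act y) (letter_act x (t, v)) + linear_extension (\<lambda>z. letter_act z (t, v)) (br x y)"
    by (rule letter_act_Cons)
  then show ?thesis using letter_act_below[OF y] by (simp add: commutes_def act_letter_def act_vector_def)
qed

text \<open>
  The commutator identity extended linearly in the second letter.
\<close>

lemma act_letter_act_vector:
  assumes "\<And>z. commutes x z P"
  shows "act_letter x (act_vector p P) = act_vector p (act_letter x P) + act_vector (linear_extension (br x) p) P"
proof -
  have "keys p \<subseteq> UNIV" by simp
  then show ?thesis
  proof (induction p rule: free_induct)
    case (basis z)
    then show ?case using assms[of z] by (simp add: commutes_def)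
  qed (simp_all add: act_vector_linear act_letter_linear linear_extension_add linear_extension_scale fs.scale_right_distrib algebra_simps)
qed

text \<open>
  Induction on the length of the word. The essential case is a word \<open>k u\<close> whose first
  letter comes before both \<open>x\<close> and \<open>y\<close>. Both letters are moved past
  \<open>k\<close>; the commutator of \<open>a\<close> and \<open>k\<close> on \<open>b u\<close>
  is known for the leading term, because \<open>k\<close> can be put in front of it, and by
  induction for the rest. What remains after subtracting the two orders is the Jacobi identity for
  \<open>x\<close>, \<open>y\<close> and \<open>k\<close>.
\<close>

lemma commutes_standard:
  assumes "s \<in> standard d"
  shows "commutes x y (basis s)"
  using assms
proof (induction d arbitrary: s x y rule: less_induct)
  case (less d)
  obtain t v where s: "s = (t, v)" by (cases s)
  note t = less.prems[unfolded s]
  show ?case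
  proof (cases "below x t \<or> below y t")
    case True
    then show ?thesis using commutes_below[OF t] commutes_sym s by blast
  next
    case nb: False
    show ?thesis
    proof (cases t)
      case Nil
      then have xy: "x \<notin> neg" "y \<notin> neg" using nb by auto
      let ?i = "\<lambda>v. basis ([], v) :: ('b list \<times> 'v) \<Rightarrow>\<^sub>0 complex"
      have act_letter_i: "act_letter z (linear_extension ?i p) = linear_extension ?i (linear_extension (rho z) p)"
        if "z \<notin> neg" for z p
        unfolding act_letter_def linear_extension_linear_extension using letter_act_Nil[OF that]
        by (intro linear_extension_cong) simp
      have "act_vector (br x y) (basis ([], v)) = linear_extension (\<lambda>z. linear_extension ?i (rho z v)) (br x y)"
        unfolding act_vector_def by (rule linear_extension_cong) (use letter_act_Nil br_closed[OF xy] in auto)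
      also have "\<dots> = linear_extension ?i (linear_extension (\<lambda>z. rho z v) (br x y))"
        by (simp add: linear_extension_linear_extension)
      also have "\<dots> = linear_extension ?i (linear_extension (rho x) (rho y v)) - linear_extension ?i (linear_extension (rho y) (rho x v))"
        by (simp add: rho_bracket[OF xy, symmetric] linear_extension_diff)
      finally show ?thesis
        using s Nil by (simp add: commutes_def letter_act_Nil xy act_letter_i)
    next
      case (Cons k u)
      note st = standard_ConsD[OF t[unfolded Cons]]
      have IH: "commutes a b P" if "keys P \<subseteq> standard (length u)" for a b P
        by (rule commutes_linear[OF less.IH[OF st(3)] that])
      let ?u = "basis (u, v) :: ('b list \<times> 'v) \<Rightarrow>\<^sub>0 complex"
      have u: "commutes a b ?u" for a b
        by (rule IH) (use st(2) in simp)
      have ku: "act_letter k ?u = basis (t, v)" using letter_act_below[OF st(1)] Cons by simp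
      have step: "act_letter a (basis (t, v)) = act_letter k (act_letter a ?u) + act_vector (br a k) ?u" if "\<not> below a t" for a
        using letter_act_Cons[OF t[unfolded Cons], of a] that Cons by (simp add: act_letter_def act_vector_def)
      have lead_commutes: "commutes a k (act_letter b ?u)" if nb: "\<not> below b t" for a b
      proof -
        have "commutes a k (lead b u v)"
        proof (cases "b \<in> neg")
          case True
          then have "rk k \<le> rk b" using not_below_Cons[OF t[unfolded Cons]] nb Cons by fastforce
          then have "below k (ins b u)" using st(1) by (auto simp: set_insort_key)
          then show ?thesis using commutes_below[OF standard_ins[OF True st(2)], of k a] True by (simp add: lead_def)
        qed (simp add: lead_def commutes_def act_letter_linear act_vector_linear)
        moreover have "commutes a k (letter_act b (u, v) - lead b u v)"
          by (rule IH[OF keys_letter_act[OF st(2)]])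
        ultimately show ?thesis using commutes_add[of a k "letter_act b (u, v) - lead b u v" "lead b u v"] by simp
      qed
      \<comment> \<open>\<open>a b k u = k a b u + [a, k] b u + [b, k] a u + [a, [b, k]] u\<close>\<close>
      have half: "act_letter a (act_letter b (basis (t, v))) = act_letter k (act_letter a (act_letter b ?u)) + act_vector (br a k) (act_letter b ?u) +
          act_vector (br b k) (act_letter a ?u) + act_vector (linear_extension (br a) (br b k)) ?u" if "\<not> below b t" for a b
      proof -
        have "act_letter a (act_letter b (basis (t, v))) = act_letter a (act_letter k (act_letter b ?u)) + act_letter a (act_vector (br b k) ?u)"
          using step[OF that] by (simp only: act_letter_linear)
        also have "act_letter a (act_letter k (act_letter b ?u)) = act_letter k (act_letter a (act_letter b ?u)) + act_vector (br a k) (act_letter b ?u)"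
          using lead_commutes[OF that, of a] by (simp only: commutes_def)
        also have "act_letter a (act_vector (br b k) ?u) = act_vector (br b k) (act_letter a ?u) + act_vector (linear_extension (br a) (br b k)) ?u"
          by (rule act_letter_act_vector[OF u])
        finally show ?thesis by (simp only: add.assoc)
      qed
      have "act_letter k (act_letter x (act_letter y ?u)) = act_letter k (act_letter y (act_letter x ?u)) + act_letter k (act_vector (br x y) ?u)"
        using u[of x y] by (simp only: commutes_def act_letter_linear)
      also have "act_letter k (act_vector (br x y) ?u) = act_vector (br x y) (basis (t, v)) + act_vector (linear_extension (br k) (br x y)) ?u"
        using act_letter_act_vector[OF u, of k "br x y"] by (simp only: ku)
      finally have 1: "act_letter k (act_letter x (act_letter y ?u)) = act_letter k (act_letter y (act_letter x ?u)) + act_vector (br x y) (basis (t, v)) +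
          act_vector (linear_extension (br k) (br x y)) ?u" by (simp only: add.assoc)
      have "linear_extension (\<lambda>a. br a k) (br x y) = - linear_extension (br k) (br x y)"
      proof -
        have "linear_extension (\<lambda>a. br a k) (br x y) = linear_extension (\<lambda>a. - br k a) (br x y)"
          by (rule linear_extension_cong) (rule br_swap)
        then show ?thesis using linear_extension_scale_fun[of "-1" "br k" "br x y"] by simp
      qed
      then have "linear_extension (br x) (br y k) = linear_extension (br y) (br x k) - linear_extension (br k) (br x y)"
        using jacobi[of x y k] by simp
      then have 2: "act_vector (linear_extension (br x) (br y k)) ?u =
          act_vector (linear_extension (br y) (br x k)) ?u - act_vector (linear_extension (br k) (br x y)) ?u"
        by (simp only: act_vector_linear)
      have "act_letter x (act_letter y (basis (t, v))) = act_letter y (act_letter x (basis (t, v))) + act_vector (br x y) (basis (t, v))"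
        using half[of y x] half[of x y] nb 1 2 by (simp add: algebra_simps)
      then show ?thesis by (simp only: commutes_def s)
    qed
  qed
qed

abbreviation "all_standard \<equiv> {s. sorted (map rk (fst s)) \<and> set (fst s) \<subseteq> neg}"

lemma all_standard: "s \<in> all_standard \<Longrightarrow> s \<in> standard (length (fst s))"
  by (simp add: standard_def)

lemma standard_all: "standard d \<subseteq> all_standard"
  by (auto simp: standard_def)

lemma keys_act_letter:
  assumes "keys P \<subseteq> all_standard"
  shows "keys (act_letter x P) \<subseteq> all_standard"
  unfolding act_letter_def
proof (rule keys_linear_extension)
  fix s assume "s \<in> keys P"
  then have s: "s \<in> standard (length (fst s))" using assms all_standard by blast
  obtain t v where tv: "s = (t, v)" by (cases s)
  have "keys (letter_act x (t, v) - lead x t v) \<subseteq> all_standard"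
    using keys_letter_act[of t v "length t" x] s standard_all tv by fastforce
  moreover have "keys (lead x t v) \<subseteq> all_standard"
    using keys_lead[of t v "length t" x] s standard_all tv by fastforce
  ultimately have "keys ((letter_act x (t, v) - lead x t v) + lead x t v) \<subseteq> all_standard" by (rule keys_add_subset)
  then show "keys (letter_act x s) \<subseteq> all_standard" using tv by simp
qed

lemma keys_act_vector: "keys P \<subseteq> all_standard \<Longrightarrow> keys (act_vector p P) \<subseteq> all_standard"
  unfolding act_vector_def by (rule keys_linear_extension) (rule keys_act_letter)

lemma act_vector_bracket:
  assumes P: "keys P \<subseteq> all_standard"
  shows "act_vector (linear_extension (\<lambda>a. linear_extension (br a) q) p) P = act_vector p (act_vector q P) - act_vector q (act_vector p P)"
proof -
  have comm: "commutes a b P" for a b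
  proof (rule commutes_linear[OF _ P])
    fix s :: "'b list \<times> 'v" assume "s \<in> all_standard"
    then show "commutes a b (basis s)" by (rule commutes_standard[OF all_standard])
  qed
  have p: "keys p \<subseteq> UNIV" and q: "keys q \<subseteq> UNIV" by auto
  have 1: "act_letter a (act_vector q P) = act_vector q (act_letter a P) + act_vector (linear_extension (br a) q) P" for a
    by (rule act_letter_act_vector[OF comm])
  show ?thesis
    using p
  proof (induction p rule: free_induct)
    case (basis a)
    show ?case using 1[of a] by simp
  qed (simp_all add: act_vector_linear linear_extension_add linear_extension_scale fs.scale_right_diff_distrib)
qed

definition extended_module :: "(('b \<Rightarrow>\<^sub>0 complex), ('b list \<times> 'v) \<Rightarrow>\<^sub>0 complex) lie_module"
  where "extended_module = \<lparr>carrier = {P. keys P \<subseteq> all_standard}, monoid.mult = undefined,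
    monoid.one = undefined, ring.zero = 0, add = (+), module.smult = scale, act = act_vector\<rparr>"

lemma extended_module_simps [simp]:
  "carrier extended_module = {P. keys P \<subseteq> all_standard}" "P \<oplus>\<^bsub>extended_module\<^esub> Q = P + Q"
  "\<zero>\<^bsub>extended_module\<^esub> = 0" "c \<odot>\<^bsub>extended_module\<^esub> P = scale c P" "act extended_module = act_vector"
  by (simp_all add: extended_module_def)

lemma is_lie_module_extended:
  assumes "\<And>x y. x \<oplus>\<^bsub>G\<^esub> y = x + y" "\<And>c x. c \<odot>\<^bsub>G\<^esub> x = scale c x"
    and "\<And>x y. bracket G x y = linear_extension (\<lambda>a. linear_extension (br a) y) x"
  shows "is_lie_module G extended_module"
proof (rule is_lie_moduleI)
  have "complex_space extended_module"
    by (rule complex_spaceI)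
      (simp_all add: fs.scale_left_distrib fs.scale_right_distrib algebra_simps)
  moreover have "linear_map extended_module extended_module (act extended_module x)" for x
    by (rule linear_mapI) (use keys_act_vector in \<open>simp_all add: act_vector_linear\<close>)
  ultimately show "acts_linearly G extended_module" by (simp add: acts_linearly_def)
qed (simp_all add: assms act_vector_linear act_vector_bracket)

text \<open>
  The subalgebra acts on the empty word through \<open>rho\<close>, so the original representation
  embeds.
\<close>

lemma act_vector_vacuum:
  assumes "keys g \<inter> neg = {}"
  shows "act_vector g (linear_extension (\<lambda>v. basis ([], v)) p) =
    linear_extension (\<lambda>v. basis ([], v)) (linear_extension (\<lambda>z. linear_extension (rho z) p) g)"
proof -
  have "act_vector g (linear_extension (\<lambda>v. basis ([], v)) p) =
      linear_extension (\<lambda>z. linear_extension (\<lambda>v. basis ([], v)) (linear_extension (rho z) p)) g"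
    unfolding act_vector_def
  proof (rule linear_extension_cong)
    fix z assume "z \<in> keys g"
    then have "z \<notin> neg" using assms by blast
    then show "act_letter z (linear_extension (\<lambda>v. basis ([], v)) p) =
        linear_extension (\<lambda>v. basis ([], v)) (linear_extension (rho z) p)"
      unfolding act_letter_def linear_extension_linear_extension using letter_act_Nil
      by (intro linear_extension_cong) simp
  qed
  then show ?thesis by (simp only: linear_extension_linear_extension)
qed

end

section \<open>The twisted Heisenberg-Virasoro algebra\<close>

lemma hv_bracket_basis_basis [simp]: "hv_bracket (basis x) (basis y) = hv_bracket_basis x y"
  by (simp add: hv_bracket_def)

lemma hv_bracket_basis_swap: "hv_bracket_basis y x = - hv_bracket_basis x y"
proof (cases x; cases y)
  fix m n assume x: "x = L m" and y: "y = L n"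
  show ?thesis
  proof (cases "m + n = 0")
    case True
    then have n: "n = - m" by simp
    show ?thesis unfolding x y n
      by (rule poly_mapping_eqI) (simp add: lookup_add lookup_minus lookup_single when_def field_simps)
  next
    case False
    then show ?thesis unfolding x y
      by (intro poly_mapping_eqI) (simp add: lookup_add lookup_minus lookup_single when_def add.commute)
  qed
next
  fix m n assume x: "x = I m" and y: "y = I n"
  show ?thesis
  proof (cases "m + n = 0")
    case True
    then have n: "n = - m" by simp
    show ?thesis unfolding x y n by (rule poly_mapping_eqI) (simp add: lookup_single when_def)
  qed (simp add: x y add.commute)
qed (simp_all add: add.commute)

lemma hv_bracket_basis_self: "hv_bracket_basis x x = 0"
  by (cases x) (auto simp: power3_eq_cube)

text \<open>
  Only triples of letters \<open>L\<close> and \<open>I\<close> matter, and central terms occur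
  only if the indices add up to zero; in that case one index is eliminated and the cocycle
  conditions become polynomial identities.
\<close>

lemma hv_jacobi:
  "linear_extension (hv_bracket_basis x) (hv_bracket_basis y z) =
    linear_extension (hv_bracket_basis y) (hv_bracket_basis x z) +
    linear_extension (\<lambda>u. hv_bracket_basis u z) (hv_bracket_basis x y)"
proof -
  note ext = linear_extension_add linear_extension_minus linear_extension_diff linear_extension_single
    if_distrib[of "linear_extension _"] scale_single fs.scale_right_distrib if_distrib[of "scale _"]
  have main: ?thesis if xyz: "x = L a \<or> x = I a" "y = L b \<or> y = I b" "z = L c \<or> z = I c" for a b c
  proof (rule poly_mapping_eqI)
    fix k
    show "lookup (linear_extension (hv_bracket_basis x) (hv_bracket_basis y z)) k =
      lookup (linear_extension (hv_bracket_basis y) (hv_bracket_basis x z) +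
        linear_extension (\<lambda>u. hv_bracket_basis u z) (hv_bracket_basis x y)) k"
    proof (cases "a + b + c = 0")
      case True
      then have c: "c = - a - b" by simp
      show ?thesis using xyz unfolding c
        by (elim disjE; cases k) (auto simp: ext lookup_add lookup_minus lookup_single power2_eq_square when_def power3_eq_cube field_simps)
    next
      case False
      then have "a + (b + c) \<noteq> 0" "b + (a + c) \<noteq> 0" "a + b + c \<noteq> 0" by auto
      then show ?thesis using xyz
        by (elim disjE; cases k) (auto simp: ext lookup_add lookup_minus lookup_single power2_eq_square when_def algebra_simps)
    qed
  qed
  show ?thesis
  proof (cases "\<exists>a b c. (x = L a \<or> x = I a) \<and> (y = L b \<or> y = I b) \<and> (z = L c \<or> z = I c)")
    case True
    then show ?thesis using main by blast
  next
    case False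
    then show ?thesis by (cases x; cases y; cases z) (auto simp: ext)
  qed
qed

definition hv_sub_basis :: "nat \<Rightarrow> hv_basis set"
  where "hv_sub_basis e = {L m | m. 0 \<le> m} \<union> {I m | m. - int e \<le> m} \<union> {C1, C2, C3}"

lemma HV_sub_simps [simp]:
  "carrier (HV_sub e) = {x. keys x \<subseteq> hv_sub_basis e}" "x \<oplus>\<^bsub>HV_sub e\<^esub> y = x + y"
  "c \<odot>\<^bsub>HV_sub e\<^esub> x = scale c x" "bracket (HV_sub e) = hv_bracket"
  by (simp_all add: HV_sub_def hv_sub_basis_def HV_def)

lemma hv_bracket_basis_closed:
  "x \<in> hv_sub_basis e \<Longrightarrow> y \<in> hv_sub_basis e \<Longrightarrow> keys (hv_bracket_basis x y) \<subseteq> hv_sub_basis e"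
  by (cases x; cases y) (auto simp: hv_sub_basis_def intro!: keys_add_subset)

lemma closed_algebra_HV: "closed_algebra HV"
  by unfold_locales simp_all

lemma closed_algebra_HV_sub: "closed_algebra (HV_sub e)"
proof unfold_locales
  fix x y assume "x \<in> carrier (HV_sub e)" "y \<in> carrier (HV_sub e)"
  then have x: "keys x \<subseteq> hv_sub_basis e" and y: "keys y \<subseteq> hv_sub_basis e" by simp_all
  have "keys (hv_bracket x y) \<subseteq> hv_sub_basis e"
    unfolding hv_bracket_def
    by (intro keys_linear_extension hv_bracket_basis_closed) (use x y in auto)
  then show "bracket (HV_sub e) x y \<in> carrier (HV_sub e)" by simp
qed simp_all

lemma induced_representation_HV:
  assumes "is_lie_module (HV_sub e) M"
  shows "induced_representation HV (HV_sub e) M"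
proof -
  interpret A: closed_algebra "HV_sub e" by (rule closed_algebra_HV_sub)
  interpret B: closed_algebra HV by (rule closed_algebra_HV)
  show ?thesis by unfold_locales (use assms in simp_all)
qed

subsection \<open>The induced module is restricted\<close>

lemma eventually_killed_add:
  assumes V: "acts_linearly HV V" and v: "v \<in> carrier V" "w \<in> carrier V"
    and "eventually_killed V v" "eventually_killed V w"
  shows "eventually_killed V (v \<oplus>\<^bsub>V\<^esub> w)"
proof -
  interpret complex_space V by (rule acts_linearlyD(1)[OF V])
  obtain K where K: "\<And>k. k \<ge> K \<Longrightarrow> act V (L_seq k) v = \<zero>\<^bsub>V\<^esub> \<and> act V (I_seq k) v = \<zero>\<^bsub>V\<^esub>"
    using assms(4) unfolding eventually_killed_def by blast
  obtain K' where K': "\<And>k. k \<ge> K' \<Longrightarrow> act V (L_seq k) w = \<zero>\<^bsub>V\<^esub> \<and> act V (I_seq k) w = \<zero>\<^bsub>V\<^esub>"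
    using assms(5) unfolding eventually_killed_def by blast
  have "act V x (v \<oplus>\<^bsub>V\<^esub> w) = act V x v \<oplus>\<^bsub>V\<^esub> act V x w" for x
    by (rule linear_mapD(2)[OF acts_linearlyD(2)[OF V]]) (use v in simp_all)
  then show ?thesis
    unfolding eventually_killed_def using K K' by (intro exI[of _ "max K K'"]) simp
qed

lemma eventually_killed_scale:
  assumes V: "acts_linearly HV V" and v: "v \<in> carrier V" and "eventually_killed V v"
  shows "eventually_killed V (c \<odot>\<^bsub>V\<^esub> v)"
proof -
  interpret complex_space V by (rule acts_linearlyD(1)[OF V])
  have "act V x (c \<odot>\<^bsub>V\<^esub> v) = c \<odot>\<^bsub>V\<^esub> act V x v" for x
    by (rule linear_mapD(3)[OF acts_linearlyD(2)[OF V]]) (use v in simp_all)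
  moreover obtain K where K: "\<And>k. k \<ge> K \<Longrightarrow> act V (L_seq k) v = \<zero>\<^bsub>V\<^esub> \<and> act V (I_seq k) v = \<zero>\<^bsub>V\<^esub>"
    using assms(3) unfolding eventually_killed_def by blast
  ultimately show ?thesis unfolding eventually_killed_def by (intro exI[of _ K]) simp
qed

lemma eventually_killed_zero:
  assumes V: "acts_linearly HV V"
  shows "eventually_killed V \<zero>\<^bsub>V\<^esub>"
  using linear_map_zero[OF acts_linearlyD(2)[OF V] acts_linearlyD(1)[OF V] acts_linearlyD(1)[OF V]]
  by (simp add: eventually_killed_def)

text \<open>
  The commutator of \<open>L k\<close> or \<open>I k\<close> with a basis element is, for large
  \<open>k\<close>, a multiple of some \<open>L m\<close> or \<open>I m\<close> with
  \<open>m\<close> large, since the central terms occur for a single \<open>k\<close> only.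
\<close>

lemma eventually_killed_act:
  assumes rep: "is_lie_module HV V" and v: "v \<in> carrier V" and killed: "eventually_killed V v"
  shows "eventually_killed V (act V x v)"
proof -
  note D = is_lie_moduleD[OF rep]
  interpret complex_space V by (rule D(1))
  have closed: "act V x w \<in> carrier V" if "w \<in> carrier V" for x w
    using acts_linearlyD(3)[OF D(2)] that by simp
  have zero: "act V x \<zero>\<^bsub>V\<^esub> = \<zero>\<^bsub>V\<^esub>" for x
    using linear_map_zero[OF acts_linearlyD(2)[OF D(2)] D(1) D(1)] by simp
  have add: "act V (p + q) v = act V p v \<oplus>\<^bsub>V\<^esub> act V q v" for p q
    using D(3)[of p q v] v by simp
  have scale: "act V (scale c p) v = c \<odot>\<^bsub>V\<^esub> act V p v" for p c
    using D(4)[of p v c] v by simp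
  have act0: "act V 0 v = \<zero>\<^bsub>V\<^esub>" using scale[of 0 0] closed[OF v] by simp
  obtain K where K: "\<And>k. k \<ge> K \<Longrightarrow> act V (L_seq k) v = \<zero>\<^bsub>V\<^esub> \<and> act V (I_seq k) v = \<zero>\<^bsub>V\<^esub>"
    using killed unfolding eventually_killed_def by blast
  have single: "act V (Poly_Mapping.single h c) v = \<zero>\<^bsub>V\<^esub>" if "act V (basis h) v = \<zero>\<^bsub>V\<^esub>" for h c
    using scale[of c "basis h"] that by (simp add: scale_basis)
  have far: "act V (basis (L m)) v = \<zero>\<^bsub>V\<^esub>" "act V (basis (I m)) v = \<zero>\<^bsub>V\<^esub>" if "int K \<le> m" for m
    using K[of "nat m"] that by (simp_all add: le_nat_iff)
  have basis: "eventually_killed V (act V (basis h) v)" for h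
  proof -
    \<comment> \<open>the shift of the index caused by the bracket with \<open>h\<close>\<close>
    define s where "s = (case h of L n \<Rightarrow> n | I n \<Rightarrow> n | _ \<Rightarrow> 0)"
    have br: "act V (hv_bracket_basis (L (int k)) h) v = \<zero>\<^bsub>V\<^esub> \<and> act V (hv_bracket_basis (I (int k)) h) v = \<zero>\<^bsub>V\<^esub>"
      if k: "k \<ge> K + nat \<bar>s\<bar> + 1" for k
    proof -
      have s: "int K \<le> int k + s" "int k + s \<noteq> 0" "int K \<le> s + int k" "s + int k \<noteq> 0" using k by linarith+
      show ?thesis
      proof (cases h)
        case (L n)
        then have "s = n" by (simp add: s_def)
        then show ?thesis using L s by (simp add: single far single_uminus[symmetric])
      next
        case (I n)
        then have "s = n" by (simp add: s_def)
        then show ?thesis using I s by (simp add: single far act0)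
      qed (simp_all add: act0)
    qed
    have "act V y (act V (basis h) v) = \<zero>\<^bsub>V\<^esub>"
      if "act V (hv_bracket y (basis h)) v = \<zero>\<^bsub>V\<^esub>" "act V y v = \<zero>\<^bsub>V\<^esub>" for y
      using D(5)[of y "basis h" v] that closed[OF closed[OF v]] v by (simp add: zero)
    then show ?thesis
      unfolding eventually_killed_def using br K by (intro exI[of _ "K + nat \<bar>s\<bar> + 1"]) simp
  qed
  have "keys x \<subseteq> UNIV" by simp
  then show ?thesis
  proof (induction x rule: free_induct)
    case (basis h)
    show ?case by (rule \<open>eventually_killed V (act V (basis h) v)\<close>)
  next
    case (add p q)
    then show ?case using eventually_killed_add[OF D(2) closed[OF v] closed[OF v]] \<open>act V (p + q) v = _\<close> by simp
  next
    case zero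
    then show ?case using eventually_killed_zero[OF D(2)] act0 by simp
  next
    case (scale c p)
    then show ?case using eventually_killed_scale[OF D(2) closed[OF v]] \<open>act V (scale c p) v = _\<close> by simp
  qed
qed

context
  fixes e :: nat and M :: "(hv, 'v) lie_module"
  assumes star: "condition_star e M"
begin

lemma star_rep: "is_lie_module (HV_sub e) M" and star_nonzero: "carrier M \<noteq> {\<zero>\<^bsub>M\<^esub>}"
  using star by (auto simp: condition_star_def simple_lie_module_def)

lemma star_killed: "\<exists>K. \<forall>k\<ge>K. \<forall>v\<in>carrier M. act M (L_seq k) v = \<zero>\<^bsub>M\<^esub> \<and> act M (I_seq k) v = \<zero>\<^bsub>M\<^esub>"
proof -
  obtain k :: nat where "\<forall>n>k. \<forall>v\<in>carrier M. act M (basis (I (int n))) v = \<zero>\<^bsub>M\<^esub>"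
    "\<forall>n>k + e. \<forall>v\<in>carrier M. act M (basis (L (int n))) v = \<zero>\<^bsub>M\<^esub>"
    using star unfolding condition_star_def by blast
  then show ?thesis by (intro exI[of _ "k + e + 1"]) auto
qed

interpretation Ind: induced_representation HV "HV_sub e" M
  by (rule induced_representation_HV[OF star_rep])

lemma acts_linearly_star_Ind: "acts_linearly HV (Ind e M)"
  by (rule Ind.acts_linearly_Ind)

text \<open>
  The vectors \<open>1 \<otimes> v\<close> are killed by the condition on \<open>M\<close>; being
  killed eventually is preserved by the action and by linear combinations, and the module is
  generated by these vectors.
\<close>

lemma restricted_star_Ind: "restricted (Ind e M)"
proof -
  have "eventually_killed (Ind e M) z" if "z \<in> carrier (Ind e M)" for z
    using that
  proof (induction z rule: Ind.Ind_induct)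
    case (word w v)
    from word(1) show ?case
    proof (induction w)
      case Nil
      obtain K where K: "\<And>k. k \<ge> K \<Longrightarrow> act M (L_seq k) v = \<zero>\<^bsub>M\<^esub> \<and> act M (I_seq k) v = \<zero>\<^bsub>M\<^esub>"
        using star_killed word(2) by blast
      have "Ind.gen (basis []) \<zero>\<^bsub>M\<^esub> = \<zero>\<^bsub>Ind e M\<^esub>"
        by (rule linear_map_zero[OF Ind.linear_gen_right Ind.M.complex_space_axioms Ind.IndC.complex_space_axioms]) simp
      then show ?case
        unfolding eventually_killed_def using K Ind.act_gen_one[OF _ word(2)]
        by (intro exI[of _ K]) (simp add: hv_sub_basis_def)
    next
      case (Cons x w)
      have w: "basis w \<in> Ind.G.W" using Cons by simp
      have "eventually_killed (Ind e M) (act (Ind e M) x (Ind.gen (basis w) v))"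
        by (rule eventually_killed_act[OF Ind.is_lie_module_Ind Ind.gen_closed[OF w word(2)]]) (use Cons in simp)
      then show ?case using Ind.act_gen[OF _ w, of x v] by simp
    qed
  next
    case (add y z)
    then show ?case by (rule eventually_killed_add[OF Ind.acts_linearly_Ind])
  next
    case zero
    show ?case by (rule eventually_killed_zero[OF Ind.acts_linearly_Ind])
  next
    case (scale c z)
    then show ?case by (rule eventually_killed_scale[OF Ind.acts_linearly_Ind])
  qed
  then show ?thesis by (simp add: restricted_def)
qed

subsection \<open>The induced module is nonzero\<close>

text \<open>
  The module \<open>M\<close> is transported to a free space by a linear section \<open>j\<close>,
  where the subalgebra acts through \<open>rho\<close>. The extension of this representation to
  the whole algebra contains \<open>M\<close> as the part with empty words, and by Frobenius
  reciprocity it receives a map from the induced module that is injective on \<open>1 \<otimes>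
  M\<close>.
\<close>

lemma star_Ind_nonzero: "\<exists>z\<in>carrier (Ind e M). z \<noteq> \<zero>\<^bsub>Ind e M\<^esub>"
proof -
  note D = is_lie_moduleD[OF star_rep]
  obtain j where j: "linear_map M (free_space (carrier M)) j"
    "\<And>v. v \<in> carrier M \<Longrightarrow> combination M (\<lambda>x. x) (j v) = v"
    using exists_linear_section[OF D(1)] by blast
  note jl = linear_mapD[OF j(1), unfolded free_space_simps]
  define rho where "rho x v = (if v \<in> carrier M then j (act M (basis x) v) else 0)" for x v
  let ?neg = "- hv_sub_basis e"
  have closed: "act M x v \<in> carrier M" if "keys x \<subseteq> hv_sub_basis e" "v \<in> carrier M" for x v
    using acts_linearlyD(3)[OF D(2)] that by simp
  have rho_keys: "keys (rho x v) \<subseteq> carrier M" if "x \<in> hv_sub_basis e" for x v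
    using jl(1) closed[of "basis x" v] that by (auto simp: rho_def)
  have rho_j: "linear_extension (rho x) (j v) = j (act M (basis x) v)"
    if x: "x \<in> hv_sub_basis e" and v: "v \<in> carrier M" for x v
  proof -
    have lin: "linear_map M (free_space (carrier M)) (\<lambda>v. j (act M (basis x) v))"
      by (rule linear_map_comp[OF acts_linearlyD(2)[OF D(2)] j(1)]) (use x in simp)
    have k: "keys (j v) \<subseteq> carrier M" using jl(1)[OF v] by simp
    have "j (act M (basis x) v) = j (act M (basis x) (combination M (\<lambda>x. x) (j v)))" using j(2)[OF v] by simp
    also have "\<dots> = combination (free_space (carrier M)) (\<lambda>v. j (act M (basis x) v)) (j v)"
      by (rule linear_map_of_combination[OF lin D(1) complex_space_free_space]) (use k in auto)
    also have "\<dots> = combination (free_space (carrier M)) (rho x) (j v)"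
      by (rule complex_space.combination_cong[OF complex_space_free_space])
        (use k linear_mapD(1)[OF lin] in \<open>auto simp: rho_def\<close>)
    also have "\<dots> = linear_extension (rho x) (j v)"
    proof -
      have "linear_map (free_space (carrier M)) (free_space (carrier M)) (linear_extension (rho x))"
        by (rule linear_map_linear_extension) (rule rho_keys[OF x])
      from complex_space.combination_unique[OF complex_space_free_space this k] show ?thesis by simp
    qed
    finally show ?thesis ..
  qed
  have act_sum: "linear_extension (\<lambda>x. rho x v) g = j (act M g v)"
    if g: "keys g \<subseteq> hv_sub_basis e" and v: "v \<in> carrier M" for g v
    using g
  proof (induction g rule: free_induct)
    case (basis x)
    show ?case using v by (simp add: rho_def)
  next
    case (add p q)
    then show ?case using D(3)[of p q v] v closed jl(2) by (simp add: linear_extension_add)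
  next
    case zero
    have "act M (scale 0 0) v = 0 \<odot>\<^bsub>M\<^esub> act M 0 v" using D(4)[of 0 v 0] v by simp
    then have "act M 0 v = \<zero>\<^bsub>M\<^esub>" using complex_space.smult_0[OF D(1) closed[OF _ v]] by simp
    then show ?case using linear_map_zero[OF j(1) D(1) complex_space_free_space] by simp
  next
    case (scale c p)
    then show ?case using D(4)[of p v c] v closed jl(3) by (simp add: linear_extension_scale)
  qed
  \<comment> \<open>twice the index, plus one for the letters \<open>I\<close>, is an injective rank on the complementary letters\<close>
  interpret P: partial_representation hv_bracket_basis ?neg
    "\<lambda>x. case x of L n \<Rightarrow> 2 * n | I n \<Rightarrow> 2 * n + 1 | _ \<Rightarrow> 0" rho
  proof unfold_locales
    show "inj_on (\<lambda>x. case x of L n \<Rightarrow> 2 * n | I n \<Rightarrow> 2 * n + 1 | _ \<Rightarrow> 0) ?neg"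
      by (rule inj_onI) (auto simp: hv_sub_basis_def split: hv_basis.splits; presburger)
    show "keys (hv_bracket_basis x y) \<inter> ?neg = {}" if "x \<notin> ?neg" "y \<notin> ?neg" for x y
      using hv_bracket_basis_closed[of x e y] that by auto
    show "linear_extension (rho x) (rho y v) - linear_extension (rho y) (rho x v) =
      linear_extension (\<lambda>z. rho z v) (hv_bracket_basis x y)" if "x \<notin> ?neg" "y \<notin> ?neg" for x y v
    proof (cases "v \<in> carrier M")
      case True
      have xy: "x \<in> hv_sub_basis e" "y \<in> hv_sub_basis e" using that by auto
      have c: "act M (basis x) v \<in> carrier M" "act M (basis y) v \<in> carrier M"
        "act M (basis x) (act M (basis y) v) \<in> carrier M" "act M (basis y) (act M (basis x) v) \<in> carrier M"
        using closed xy True by simp_all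
      have "linear_extension (\<lambda>z. rho z v) (hv_bracket_basis x y) = j (act M (hv_bracket_basis x y) v)"
        by (rule act_sum[OF hv_bracket_basis_closed[OF xy] True])
      also have "\<dots> = j (act M (basis x) (act M (basis y) v) \<oplus>\<^bsub>M\<^esub> (-1) \<odot>\<^bsub>M\<^esub> act M (basis y) (act M (basis x) v))"
        using D(5)[of "basis x" "basis y" v] xy True by simp
      also have "\<dots> = j (act M (basis x) (act M (basis y) v)) - j (act M (basis y) (act M (basis x) v))"
        using jl(2)[OF c(3) Ind.M.smult_in[OF c(4)]] jl(3)[OF c(4), of "-1"] by simp
      finally show ?thesis using rho_j[OF xy(1) c(2)] rho_j[OF xy(2) c(1)] True by (simp add: rho_def)
    next
      case False
      then show ?thesis by (simp add: rho_def) (simp add: linear_extension_def)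
    qed
  qed (rule hv_bracket_basis_self hv_bracket_basis_swap hv_jacobi)+
  let ?i = "\<lambda>p. linear_extension (\<lambda>v. basis ([], v)) p :: (hv_basis list \<times> 'v) \<Rightarrow>\<^sub>0 complex"
  have ext: "is_lie_module HV P.extended_module"
    by (rule P.is_lie_module_extended) (simp_all add: hv_bracket_def)
  have "linear_map (free_space (carrier M)) P.extended_module ?i"
  proof (rule linear_mapI)
    fix p :: "'v \<Rightarrow>\<^sub>0 complex"
    have "keys (?i p) \<subseteq> P.all_standard" by (rule keys_linear_extension) simp
    then show "?i p \<in> carrier P.extended_module" by simp
  qed (simp_all add: linear_extension_add linear_extension_scale)
  from linear_map_comp[OF j(1) this] have lin: "linear_map M P.extended_module (\<lambda>v. ?i (j v))" .
  have equiv: "?i (j (act M x v)) = act P.extended_module x (?i (j v))"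
    if x: "x \<in> carrier (HV_sub e)" and v: "v \<in> carrier M" for x v
  proof -
    have k: "keys x \<subseteq> hv_sub_basis e" using x by simp
    have "linear_extension (\<lambda>z. linear_extension (rho z) (j v)) x = linear_extension (\<lambda>z. rho z v) x"
      by (rule linear_extension_cong) (use k rho_j v in \<open>auto simp: rho_def\<close>)
    moreover have "keys x \<inter> ?neg = {}" using k by blast
    ultimately show ?thesis
      using P.act_vector_vacuum[of x "j v"] act_sum[OF k v] by simp
  qed
  obtain f where f: "linear_map (Ind e M) P.extended_module f"
    "\<And>v. v \<in> carrier M \<Longrightarrow> f (Ind.gen (basis []) v) = ?i (j v)"
    using Ind.exists_map_from_Ind[OF ext lin equiv] by blast
  obtain v where v: "v \<in> carrier M" "v \<noteq> \<zero>\<^bsub>M\<^esub>" using star_nonzero Ind.M.M.zero_closed by blast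
  have one: "basis [] \<in> Ind.G.W" by simp
  have "Ind.gen (basis []) v \<noteq> \<zero>\<^bsub>Ind e M\<^esub>"
  proof
    assume "Ind.gen (basis []) v = \<zero>\<^bsub>Ind e M\<^esub>"
    then have "?i (j v) = 0"
      using f(2)[OF v(1)] linear_map_zero[OF f(1) Ind.IndC.complex_space_axioms is_lie_moduleD(1)[OF ext]] by simp
    \<comment> \<open>forgetting the word is a left inverse of the embedding by empty words\<close>
    then have "linear_extension (\<lambda>s. basis (snd s)) (?i (j v)) = 0" by simp
    then have "j v = 0" by (simp add: linear_extension_linear_extension)
    then show False using j(2)[OF v(1)] v(2) by simp
  qed
  then show ?thesis using Ind.gen_closed[OF one v(1)] by blast
qed

end

section \<open>The classification\<close>

lemma omega_tensor_star:
  assumes "finite J" "inj_on lam J" "\<forall>i\<in>J. lam i \<noteq> 0" "condition_star e M"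
  shows "omega_tensor J lam (Ind e M)"
  by unfold_locales
    (use assms acts_linearly_star_Ind[OF assms(4)] restricted_star_Ind[OF assms(4)] in auto)

text \<open>
  Matching parameters means that the factors are equal modules in another order.
\<close>

lemma reindexed_isomorphic:
  fixes V :: "(hv, 'v) lie_module"
  assumes "bij_betw \<sigma> J J'"
    and "\<And>i. i \<in> J \<Longrightarrow> lam i = mu (\<sigma> i) \<and> alpha i = c (\<sigma> i) \<and> beta i = d (\<sigma> i)"
    and "acts_linearly HV V" "acts_linearly HV W" "lie_module_isomorphic HV V W"
  shows "lie_module_isomorphic HV
      (tensor_module (tensor_family J (\<lambda>i. Omega (lam i) (alpha i) (beta i))) V)
      (tensor_module (tensor_family J' (\<lambda>j. Omega (mu j) (c j) (d j))) W)"
proof -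
  have T: "acts_linearly HV (tensor_family K (\<lambda>i. Omega (l i) (a i) (b i)))" for K :: "'x set" and l a b
  proof -
    interpret tensor_power HV K "\<lambda>i. Omega (l i) (a i) (b i)"
      by unfold_locales (rule acts_linearly_Omega)
    show ?thesis by (rule acts_linearly_family)
  qed
  show ?thesis
    by (rule tensor_module_isomorphic[OF T T assms(3,4) _ assms(5)])
      (rule tensor_family_reindex[OF assms(1)], use assms(2) acts_linearly_Omega in auto)
qed

theorem theorem5p1:
  fixes m n e1 e2 :: nat
    and S' T' :: "nat set"
    and lam alpha beta mu c d :: "nat \<Rightarrow> complex"
    and M1 :: "(hv, 'a) lie_module"
    and M2 :: "(hv, 'b) lie_module"
  assumes "1 \<le> m" and "1 \<le> n"
    and "S' \<subseteq> {1..m}" and "T' \<subseteq> {1..n}"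
    and "\<forall>i\<in>{1..m}. lam i \<noteq> 0" and "inj_on lam {1..m}"
    and "\<forall>j\<in>{1..n}. mu j \<noteq> 0" and "inj_on mu {1..n}"
    and "\<forall>i\<in>S'. beta i \<noteq> 0"
    and "\<forall>i\<in>{1..m} - S'. alpha i \<noteq> 0 \<and> beta i = 0"
    and "\<forall>j\<in>T'. d j \<noteq> 0"
    and "\<forall>j\<in>{1..n} - T'. c j \<noteq> 0 \<and> d j = 0"
    and "condition_star e1 M1" and "condition_star e2 M2"
  shows "lie_module_isomorphic HV
      (tensor_module (tensor_family {1..m} (\<lambda>i. Omega (lam i) (alpha i) (beta i))) (Ind e1 M1))
      (tensor_module (tensor_family {1..n} (\<lambda>j. Omega (mu j) (c j) (d j))) (Ind e2 M2))
    \<longleftrightarrow>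
      m = n \<and> card S' = card T' \<and> lie_module_isomorphic HV (Ind e1 M1) (Ind e2 M2) \<and>
      (\<exists>\<phi>\<^sub>1 \<phi>\<^sub>2. bij_betw \<phi>\<^sub>1 S' T' \<and> bij_betw \<phi>\<^sub>2 ({1..m} - S') ({1..n} - T') \<and>
        (\<forall>i\<in>S'. (lam i, alpha i, beta i) = (mu (\<phi>\<^sub>1 i), c (\<phi>\<^sub>1 i), d (\<phi>\<^sub>1 i))) \<and>
        (\<forall>j\<in>{1..m} - S'. (lam j, alpha j) = (mu (\<phi>\<^sub>2 j), c (\<phi>\<^sub>2 j)) \<and>
          beta j = d (\<phi>\<^sub>2 j) \<and> d (\<phi>\<^sub>2 j) = 0))"
    (is "lie_module_isomorphic HV ?Z1 ?Z2 \<longleftrightarrow> ?R")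
proof -
  let ?V1 = "Ind e1 M1" and ?V2 = "Ind e2 M2"
  note V1 = acts_linearly_star_Ind[OF assms(13)] and V2 = acts_linearly_star_Ind[OF assms(14)]
  have O1: "omega_tensor {1..m} lam ?V1" and O2: "omega_tensor {1..n} mu ?V2" and O3: "omega_tensor {1..m} lam ?V2"
    using omega_tensor_star assms by auto
  have "?R" if iso: "lie_module_isomorphic HV ?Z1 ?Z2"
  proof -
    interpret A: omega_tensor "{1..m}" lam alpha beta ?V1 by (rule O1)
    interpret B: omega_tensor "{1..n}" mu c d ?V2 by (rule O2)
    interpret C: omega_tensor "{1..m}" lam alpha beta ?V2 by (rule O3)
    obtain f g where fg: "linear_map ?Z1 ?Z2 f" "linear_map ?Z2 ?Z1 g"
      "\<forall>z\<in>carrier ?Z1. g (f z) = z" "\<forall>z\<in>carrier ?Z2. f (g z) = z"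
      "\<forall>x\<in>carrier HV. \<forall>z\<in>carrier ?Z1. f (act ?Z1 x z) = act ?Z2 x (f z)"
      "\<forall>x\<in>carrier HV. \<forall>z\<in>carrier ?Z2. g (act ?Z2 x z) = act ?Z1 x (g z)"
      using isomorphic_inverse_maps[OF iso A.Z.acts_linearly_tensor] by (elim exE conjE) (rule that)
    have act_f: "f (act ?Z1 x z) = act ?Z2 x (f z)" if "z \<in> carrier ?Z1" for x z
      by (rule fg(5)[rule_format, OF _ that]) simp
    have act_g: "g (act ?Z2 x z) = act ?Z1 x (g z)" if "z \<in> carrier ?Z2" for x z
      by (rule fg(6)[rule_format, OF _ that]) simp
    obtain v1 where v1: "v1 \<in> carrier ?V1" "v1 \<noteq> \<zero>\<^bsub>?V1\<^esub>" using star_Ind_nonzero[OF assms(13)] by blast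
    obtain v2 where v2: "v2 \<in> carrier ?V2" "v2 \<noteq> \<zero>\<^bsub>?V2\<^esub>" using star_Ind_nonzero[OF assms(14)] by blast
    have there: "\<exists>j\<in>{1..n}. mu j = lam i \<and> d j = beta i \<and> (\<exists>k. alpha i = c j - of_nat k)"
      if "i \<in> {1..m}" for i
      by (rule parameters_recovered[OF O1 O2 fg(1,2) fg(3)[rule_format] act_f v1 that])
    have return: "\<exists>i\<in>{1..m}. lam i = mu j \<and> beta i = d j \<and> (\<exists>k. c j = alpha i - of_nat k)"
      if "j \<in> {1..n}" for j
      by (rule parameters_recovered[OF O2 O1 fg(2,1) fg(4)[rule_format] act_g v2 that])
    have match: "\<exists>j\<in>{1..n}. mu j = lam i \<and> d j = beta i \<and> c j = alpha i" if i: "i \<in> {1..m}" for i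
    proof -
      obtain j k where j: "j \<in> {1..n}" "mu j = lam i" "d j = beta i" "alpha i = c j - of_nat k"
        using there[OF i] by blast
      obtain i' k' where i': "i' \<in> {1..m}" "lam i' = mu j" "c j = alpha i' - of_nat k'"
        using return[OF j(1)] by blast
      have "lam i' = lam i" using i'(2) j(2) by (rule trans)
      then have "i' = i" by (rule inj_onD[OF assms(6) _ i'(1) i])
      then have "alpha i = alpha i - of_nat (k + k')" using i'(3) j(4) by (metis diff_diff_eq add.commute of_nat_add)
      then have "of_nat (k + k') = (0 :: complex)" by (metis diff_eq_eq add_cancel_left_right)
      then have "k = 0" by (simp only: of_nat_eq_0_iff)
      then show ?thesis using j by auto
    qed
    define \<sigma> where "\<sigma> i = (SOME j. j \<in> {1..n} \<and> mu j = lam i \<and> d j = beta i \<and> c j = alpha i)" for i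
    have \<sigma>: "\<sigma> i \<in> {1..n}" "mu (\<sigma> i) = lam i" "d (\<sigma> i) = beta i" "c (\<sigma> i) = alpha i" if "i \<in> {1..m}" for i
    proof -
      have "\<exists>j. j \<in> {1..n} \<and> mu j = lam i \<and> d j = beta i \<and> c j = alpha i"
        using match[OF that] by blast
      from someI_ex[OF this]
      show "\<sigma> i \<in> {1..n}" "mu (\<sigma> i) = lam i" "d (\<sigma> i) = beta i" "c (\<sigma> i) = alpha i"
        unfolding \<sigma>_def by blast+
    qed
    have bij: "bij_betw \<sigma> {1..m} {1..n}"
      unfolding bij_betw_def
    proof (intro conjI equalityI subsetI)
      show "inj_on \<sigma> {1..m}"
      proof (rule inj_onI)
        fix i i' assume "i \<in> {1..m}" "i' \<in> {1..m}" "\<sigma> i = \<sigma> i'"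
        then show "i = i'" using \<sigma>(2)[of i] \<sigma>(2)[of i'] inj_onD[OF assms(6)] by metis
      qed
      fix j assume j: "j \<in> {1..n}"
      then obtain i where i: "i \<in> {1..m}" "lam i = mu j" using return by blast
      then have "\<sigma> i = j" using \<sigma>(1,2)[OF i(1)] j inj_onD[OF assms(8)] by metis
      then show "j \<in> \<sigma> ` {1..m}" using i(1) by blast
    qed (use \<sigma>(1) in blast)
    have mn: "m = n" using bij_betw_same_card[OF bij] by simp
    have S': "i \<in> S' \<longleftrightarrow> beta i \<noteq> 0" if "i \<in> {1..m}" for i using assms(9,10) that by blast
    have T': "j \<in> T' \<longleftrightarrow> d j \<noteq> 0" if "j \<in> {1..n}" for j using assms(11,12) that by blast
    have ST: "\<sigma> i \<in> T' \<longleftrightarrow> i \<in> S'" if "i \<in> {1..m}" for i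
      using S'[OF that] T'[OF \<sigma>(1)[OF that]] \<sigma>(3)[OF that] by simp
    have im: "\<sigma> ` {1..m} = {1..n}" using bij by (simp add: bij_betw_def)
    have "\<sigma> ` S' = T'"
    proof (intro equalityI subsetI)
      fix j assume "j \<in> T'"
      then obtain i where "i \<in> {1..m}" "j = \<sigma> i" using im assms(4) by blast
      then show "j \<in> \<sigma> ` S'" using ST[of i] \<open>j \<in> T'\<close> by blast
    qed (use ST assms(3) in blast)
    then have bij1: "bij_betw \<sigma> S' T'" using bij_betw_subset[OF bij assms(3)] by blast
    have "\<sigma> ` ({1..m} - S') = {1..n} - T'"
    proof (intro equalityI subsetI)
      fix j assume "j \<in> {1..n} - T'"
      then obtain i where "i \<in> {1..m}" "j = \<sigma> i" using im by blast
      then show "j \<in> \<sigma> ` ({1..m} - S')" using ST[of i] \<open>j \<in> {1..n} - T'\<close> by blast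
    qed (use ST \<sigma>(1) in blast)
    then have bij2: "bij_betw \<sigma> ({1..m} - S') ({1..n} - T')" using bij_betw_subset[OF bij, of "{1..m} - S'"] by blast
    \<comment> \<open>\<open>C.Z\<close> has the polynomial factors of the first module and the last factor of the second\<close>
    have "lie_module_isomorphic HV C.Z B.Z"
      by (rule reindexed_isomorphic[OF bij _ V2 V2 isomorphic_refl]) (use \<sigma> in simp)
    then have "lie_module_isomorphic HV B.Z C.Z"
      by (rule isomorphic_sym[OF C.Z.acts_linearly_tensor])
    then have "lie_module_isomorphic HV A.Z C.Z"
      by (rule isomorphic_trans[OF iso _ A.Z.acts_linearly_tensor B.Z.acts_linearly_tensor])
    then have V: "lie_module_isomorphic HV ?V1 ?V2"
      by (rule tensor_cancel[OF O1 O3])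
    have "\<forall>i\<in>S'. (lam i, alpha i, beta i) = (mu (\<sigma> i), c (\<sigma> i), d (\<sigma> i))"
      using \<sigma> assms(3) by auto
    moreover have "\<forall>j\<in>{1..m} - S'. (lam j, alpha j) = (mu (\<sigma> j), c (\<sigma> j)) \<and> beta j = d (\<sigma> j) \<and> d (\<sigma> j) = 0"
      using \<sigma> S' by auto
    ultimately show ?R
      using mn bij_betw_same_card[OF bij1] V bij1 bij2 by blast
  qed
  moreover have "lie_module_isomorphic HV ?Z1 ?Z2" if R: ?R
  proof -
    from R obtain \<phi>1 \<phi>2 where \<phi>: "bij_betw \<phi>1 S' T'" "bij_betw \<phi>2 ({1..m} - S') ({1..n} - T')"
      "\<forall>i\<in>S'. (lam i, alpha i, beta i) = (mu (\<phi>1 i), c (\<phi>1 i), d (\<phi>1 i))"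
      "\<forall>j\<in>{1..m} - S'. (lam j, alpha j) = (mu (\<phi>2 j), c (\<phi>2 j)) \<and> beta j = d (\<phi>2 j) \<and> d (\<phi>2 j) = 0"
      and V: "lie_module_isomorphic HV ?V1 ?V2" by (elim conjE exE) (rule that)
    define \<sigma> where "\<sigma> i = (if i \<in> S' then \<phi>1 i else \<phi>2 i)" for i
    have "bij_betw \<sigma> S' T' \<longleftrightarrow> bij_betw \<phi>1 S' T'"
      "bij_betw \<sigma> ({1..m} - S') ({1..n} - T') \<longleftrightarrow> bij_betw \<phi>2 ({1..m} - S') ({1..n} - T')"
      by (rule bij_betw_cong; simp add: \<sigma>_def)+
    then have "bij_betw \<sigma> S' T'" "bij_betw \<sigma> ({1..m} - S') ({1..n} - T')"
      using \<phi>(1,2) by blast+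
    then have "bij_betw \<sigma> (S' \<union> ({1..m} - S')) (T' \<union> ({1..n} - T'))"
      by (rule bij_betw_combine) blast
    moreover have "S' \<union> ({1..m} - S') = {1..m}" "T' \<union> ({1..n} - T') = {1..n}" using assms(3,4) by blast+
    ultimately have "bij_betw \<sigma> {1..m} {1..n}" by simp
    then show "lie_module_isomorphic HV ?Z1 ?Z2"
    proof (rule reindexed_isomorphic[OF _ _ V1 V2 V])
      fix i assume "i \<in> {1..m}"
      then show "lam i = mu (\<sigma> i) \<and> alpha i = c (\<sigma> i) \<and> beta i = d (\<sigma> i)"
        using \<phi>(3,4) by (cases "i \<in> S'") (simp_all add: \<sigma>_def)
    qed
  qed
  ultimately show ?thesis by (rule iffI)
qed

end
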